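(* Let $\alpha\vdash r$ and $\beta\vdash k$ be two Young diagrams, where $0\le r,k\le n$. The number of times that $S(\beta)$ appears as a Jordan-Hölder factor in $P(\alpha)$ equals the number of times that $S^{\beta}\otimes S^{\alpha}$ appears as an irreducible constituent in the $S_k\times S_r$-module $\mathbb{C}\mathcal{SE}_n(r,k)$.
   Context: Composition of functions is from right to left. $\mathcal{SE}_n$ is the category with objects $0,1,\ldots,n$ whose hom-set $\mathcal{SE}_n(r,k)$ of morphisms from $r$ to $k$ consists of all onto total functions $\{1,\ldots,r\}\to\{1,\ldots,k\}$ (with $\{1,\ldots,0\}=\varnothing$). Its category algebra $\mathbb{C}\mathcal{SE}_n$ is the $\mathbb{C}$-vector space with basis all morphisms, with product $m'\cdot m=m'm$ if the composition is defined and $0$ otherwise. Modules are finite dimensional left modules. Young diagrams are identified with integer partitions; $0$ has exactly one partition, $\varnothing$. For $\alpha\vdash k$, $S^\alpha$ is the Specht module over $\mathbb{C}S_k$. We have $\mathcal{SE}_n(k,k)=S_k$, so $\mathbb{C}S_k\subseteq\mathbb{C}\mathcal{SE}_n$. For $\alpha\vdash k$ with $0\le k\le n$, let $e_\alpha\in\mathbb{C}S_k$ be a primitive idempotent with $\mathbb{C}S_ke_\alpha\simeq S^\alpha$; put $P(\alpha)=\mathbb{C}\mathcal{SE}_n\,e_\alpha$ and $S(\alpha)=P(\alpha)/\mathrm{Rad}\,P(\alpha)$. These give complete lists, up to isomorphism, of the indecomposable projective and the simple $\mathbb{C}\mathcal{SE}_n$-modules. $\mathbb{C}\mathcal{SE}_n(r,k)$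 is the vector space with basis $\mathcal{SE}_n(r,k)$, with $S_k\times S_r$ acting by $(g_1,g_2)\cdot m=g_1mg_2^{-1}$. $S^\beta\otimes S^\alpha$ is the outer tensor product. *)

theory Defs
  imports "HOL-Algebra.Module" "HOL-Algebra.AbelCoset" "HOL-Algebra.Sym_Groups" Complex_Main
begin

section \<open>Left modules over a not necessarily commutative ring\<close>

text \<open>The library locale \<open>module\<close> requires a commutative ring of scalars.  The library record type
  and the library locale \<open>submodule\<close> do not, and are used below; the fields \<open>mult\<close> and
  \<open>one\<close> of a module record carry no information.\<close>

locale left_module = R?: ring R + M?: abelian_group M
  for R :: "('a, 'm) ring_scheme" (structure) and M :: "('a, 'b, 'p) module_scheme" (structure) +
  assumes smult_closed:
      "\<lbrakk>a \<in> carrier R; x \<in> carrier M\<rbrakk> \<Longrightarrow> a \<odot>\<^bsub>M\<^esub> x \<in> carrier M"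
    and smult_l_distr:
      "\<lbrakk>a \<in> carrier R; b \<in> carrier R; x \<in> carrier M\<rbrakk> \<Longrightarrow>
        (a \<oplus>\<^bsub>R\<^esub> b) \<odot>\<^bsub>M\<^esub> x = a \<odot>\<^bsub>M\<^esub> x \<oplus>\<^bsub>M\<^esub> b \<odot>\<^bsub>M\<^esub> x"
    and smult_r_distr:
      "\<lbrakk>a \<in> carrier R; x \<in> carrier M; y \<in> carrier M\<rbrakk> \<Longrightarrow>
        a \<odot>\<^bsub>M\<^esub> (x \<oplus>\<^bsub>M\<^esub> y) = a \<odot>\<^bsub>M\<^esub> x \<oplus>\<^bsub>M\<^esub> a \<odot>\<^bsub>M\<^esub> y"
    and smult_assoc1:
      "\<lbrakk>a \<in> carrier R; b \<in> carrier R; x \<in> carrier M\<rbrakk> \<Longrightarrow>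
        (a \<otimes>\<^bsub>R\<^esub> b) \<odot>\<^bsub>M\<^esub> x = a \<odot>\<^bsub>M\<^esub> (b \<odot>\<^bsub>M\<^esub> x)"
    and smult_one:
      "x \<in> carrier M \<Longrightarrow> \<one>\<^bsub>R\<^esub> \<odot>\<^bsub>M\<^esub> x = x"

definition module_iso ::
  "('a, 'm) ring_scheme \<Rightarrow> ('a, 'b, 'p) module_scheme \<Rightarrow> ('a, 'c, 'q) module_scheme \<Rightarrow> bool" where
  "module_iso R M N \<longleftrightarrow>
     (\<exists>f. bij_betw f (carrier M) (carrier N) \<and>
          (\<forall>x\<in>carrier M. \<forall>y\<in>carrier M. f (x \<oplus>\<^bsub>M\<^esub> y) = f x \<oplus>\<^bsub>N\<^esub> f y) \<and>
          (\<forall>a\<in>carrier R. \<forall>x\<in>carrier M. f (a \<odot>\<^bsub>M\<^esub> x) = a \<odot>\<^bsub>N\<^esub> f x))"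

text \<open>In \<open>quotient_module\<close> the union defining \<open>a \<odot> X\<close> consists of equal cosets when \<open>N\<close> is a
  submodule, because \<open>a \<odot> (N +> x) \<subseteq> N +> (a \<odot> x)\<close>.\<close>

definition quotient_module ::
  "('a, 'b, 'p) module_scheme \<Rightarrow> 'b set \<Rightarrow> ('a, 'b set) module" where
  "quotient_module M N =
     \<lparr>carrier = a_rcosets\<^bsub>M\<^esub> N, monoid.mult = undefined, one = undefined, zero = N,
      add = set_add M, smult = (\<lambda>a X. \<Union>x\<in>X. N +>\<^bsub>M\<^esub> (a \<odot>\<^bsub>M\<^esub> x))\<rparr>"

definition generated_submodule ::
  "('a, 'm) ring_scheme \<Rightarrow> ('a, 'b, 'p) module_scheme \<Rightarrow> 'b set \<Rightarrow> 'b set" where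
  "generated_submodule R M S = \<Inter>{N. submodule N R M \<and> S \<subseteq> N}"

definition simple_module ::
  "('a, 'm) ring_scheme \<Rightarrow> ('a, 'b, 'p) module_scheme \<Rightarrow> bool" where
  "simple_module R M \<longleftrightarrow> left_module R M \<and> carrier M \<noteq> {\<zero>\<^bsub>M\<^esub>} \<and>
     (\<forall>N. submodule N R M \<longrightarrow> N = {\<zero>\<^bsub>M\<^esub>} \<or> N = carrier M)"

definition maximal_submodule ::
  "'b set \<Rightarrow> ('a, 'm) ring_scheme \<Rightarrow> ('a, 'b, 'p) module_scheme \<Rightarrow> bool" where
  "maximal_submodule N R M \<longleftrightarrow> submodule N R M \<and> N \<noteq> carrier M \<and>
     (\<forall>N'. submodule N' R M \<longrightarrow> N \<subseteq> N' \<longrightarrow> N' = N \<or> N' = carrier M)"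

definition module_radical ::
  "('a, 'm) ring_scheme \<Rightarrow> ('a, 'b, 'p) module_scheme \<Rightarrow> 'b set" where
  "module_radical R M = carrier M \<inter> \<Inter>{N. maximal_submodule N R M}"

definition series_factor ::
  "('a, 'b, 'p) module_scheme \<Rightarrow> 'b set list \<Rightarrow> nat \<Rightarrow> ('a, 'b set) module" where
  "series_factor M Ns i = quotient_module (M\<lparr>carrier := Ns ! Suc i\<rparr>) (Ns ! i)"

definition composition_series ::
  "('a, 'm) ring_scheme \<Rightarrow> ('a, 'b, 'p) module_scheme \<Rightarrow> 'b set list \<Rightarrow> bool" where
  "composition_series R M Ns \<longleftrightarrow>
     Ns \<noteq> [] \<and> hd Ns = {\<zero>\<^bsub>M\<^esub>} \<and> last Ns = carrier M \<and>
     (\<forall>N\<in>set Ns. submodule N R M) \<and>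
     (\<forall>i. Suc i < length Ns \<longrightarrow> Ns ! i \<subseteq> Ns ! Suc i \<and> simple_module R (series_factor M Ns i))"

text \<open>The description operator in \<open>jordan_hoelder_multiplicity\<close> is justified, for modules of finite
  length, by the Jordan-Hoelder theorem; the one in \<open>constituent_multiplicity\<close>, for finite direct
  sums of simple modules, by the uniqueness of the decomposition up to isomorphism.\<close>

definition jordan_hoelder_multiplicity ::
  "('a, 'm) ring_scheme \<Rightarrow> ('a, 'b, 'p) module_scheme \<Rightarrow> ('a, 'c, 'q) module_scheme \<Rightarrow> nat" where
  "jordan_hoelder_multiplicity R M S =
     (THE m. \<exists>Ns. composition_series R M Ns \<and>
        m = card {i. Suc i < length Ns \<and> module_iso R (series_factor M Ns i) S})"

definition simple_decomposition ::
  "('a, 'm) ring_scheme \<Rightarrow> ('a, 'b, 'p) module_scheme \<Rightarrow> 'b set set \<Rightarrow> bool" where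
  "simple_decomposition R M \<U> \<longleftrightarrow> finite \<U> \<and>
     (\<forall>U\<in>\<U>. submodule U R M \<and> simple_module R (M\<lparr>carrier := U\<rparr>)) \<and>
     (\<forall>x\<in>carrier M. \<exists>!u. u \<in> (\<Pi>\<^sub>E U\<in>\<U>. U) \<and> x = (\<Oplus>\<^bsub>M\<^esub>U\<in>\<U>. u U))"

definition constituent_multiplicity ::
  "('a, 'm) ring_scheme \<Rightarrow> ('a, 'b, 'p) module_scheme \<Rightarrow> ('a, 'c, 'q) module_scheme \<Rightarrow> nat" where
  "constituent_multiplicity R M S =
     (THE m. \<exists>\<U>. simple_decomposition R M \<U> \<and>
        m = card {U\<in>\<U>. module_iso R (M\<lparr>carrier := U\<rparr>) S})"

definition left_ideal_module :: "('a, 'm) ring_scheme \<Rightarrow> 'a \<Rightarrow> ('a, 'a) module" where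
  "left_ideal_module R e =
     \<lparr>carrier = {a \<otimes>\<^bsub>R\<^esub> e | a. a \<in> carrier R}, monoid.mult = undefined, one = undefined,
      zero = \<zero>\<^bsub>R\<^esub>, add = add R, smult = monoid.mult R\<rparr>"

definition idempotent_in :: "('a, 'm) ring_scheme \<Rightarrow> 'a \<Rightarrow> bool" where
  "idempotent_in R e \<longleftrightarrow> e \<in> carrier R \<and> e \<otimes>\<^bsub>R\<^esub> e = e"

definition primitive_idempotent :: "('a, 'm) ring_scheme \<Rightarrow> 'a \<Rightarrow> bool" where
  "primitive_idempotent R e \<longleftrightarrow> idempotent_in R e \<and> e \<noteq> \<zero>\<^bsub>R\<^esub> \<and>
     (\<forall>f g. idempotent_in R f \<longrightarrow> idempotent_in R g \<longrightarrow>
        f \<otimes>\<^bsub>R\<^esub> g = \<zero>\<^bsub>R\<^esub> \<longrightarrow> g \<otimes>\<^bsub>R\<^esub> f = \<zero>\<^bsub>R\<^esub> \<longrightarrow> e = f \<oplus>\<^bsub>R\<^esub> g \<longrightarrow>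
        f = \<zero>\<^bsub>R\<^esub> \<or> g = \<zero>\<^bsub>R\<^esub>)"


section \<open>Category algebras and group algebras\<close>

text \<open>The complex algebra of a category with finite set of morphisms \<open>C\<close>, partial composition
  \<open>cmp\<close> and set of identity morphisms \<open>I\<close>.  An element is given by its coefficients.\<close>

definition category_algebra ::
  "'m set \<Rightarrow> ('m \<Rightarrow> 'm \<Rightarrow> 'm option) \<Rightarrow> 'm set \<Rightarrow> ('m \<Rightarrow> complex) ring" where
  "category_algebra C cmp I =
     \<lparr>carrier = {a. \<forall>m. m \<notin> C \<longrightarrow> a m = 0},
      monoid.mult = (\<lambda>a b m. \<Sum>(x, y)\<in>{(x, y). x \<in> C \<and> y \<in> C \<and> cmp x y = Some m}. a x * b y),
      one = (\<lambda>m. if m \<in> I then 1 else 0),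
      zero = (\<lambda>m. 0),
      add = (\<lambda>a b m. a m + b m)\<rparr>"

definition group_algebra :: "('g, 'm) monoid_scheme \<Rightarrow> ('g \<Rightarrow> complex) ring" where
  "group_algebra G = category_algebra (carrier G) (\<lambda>g h. Some (g \<otimes>\<^bsub>G\<^esub> h)) {\<one>\<^bsub>G\<^esub>}"

definition basis_vector :: "'x \<Rightarrow> 'x \<Rightarrow> complex" where
  "basis_vector x = (\<lambda>y. if y = x then 1 else 0)"

text \<open>The vector space with basis \<open>X\<close>, as a module over the group algebra of a finite group \<open>G\<close>
  acting on \<open>X\<close>: the product \<open>g \<odot> x = act g x\<close> on basis elements, extended bilinearly.\<close>

definition permutation_module ::
  "('g, 'm) monoid_scheme \<Rightarrow> 'x set \<Rightarrow> ('g \<Rightarrow> 'x \<Rightarrow> 'x) \<Rightarrow> ('g \<Rightarrow> complex, 'x \<Rightarrow> complex) module"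
  where
  "permutation_module G X act =
     \<lparr>carrier = {v. finite {x. v x \<noteq> 0} \<and> (\<forall>x. x \<notin> X \<longrightarrow> v x = 0)},
      monoid.mult = undefined, one = undefined, zero = (\<lambda>x. 0), add = (\<lambda>v w x. v x + w x),
      smult = (\<lambda>a v y. \<Sum>g\<in>carrier G. \<Sum>x\<in>{x\<in>X. v x \<noteq> 0 \<and> act g x = y}. a g * v x)\<rparr>"

text \<open>The outer tensor product: the free vector space on \<open>carrier V \<times> carrier W\<close> modulo the
  bilinearity relations, with \<open>(g, h) (v \<otimes> w) = g v \<otimes> h w\<close>.  A scalar \<open>c\<close> acts on \<open>V\<close> as \<open>c\<close> times
  the unit of the group algebra.  The set of relators is stable under the group, so the submodule
  it generates is its linear span.\<close>

definition group_scalar :: "('g, 'm) monoid_scheme \<Rightarrow> complex \<Rightarrow> 'g \<Rightarrow> complex" where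
  "group_scalar G c = (\<lambda>g. c * basis_vector \<one>\<^bsub>G\<^esub> g)"

definition tensor_relators ::
  "('g, 'm) monoid_scheme \<Rightarrow> ('h, 'n) monoid_scheme \<Rightarrow>
   ('g \<Rightarrow> complex, 'v, 'p) module_scheme \<Rightarrow> ('h \<Rightarrow> complex, 'w, 'q) module_scheme \<Rightarrow>
   ('v \<times> 'w \<Rightarrow> complex) set" where
  "tensor_relators G H V W =
     {(\<lambda>p. basis_vector (v \<oplus>\<^bsub>V\<^esub> v', w) p - basis_vector (v, w) p - basis_vector (v', w) p)
        | v v' w. v \<in> carrier V \<and> v' \<in> carrier V \<and> w \<in> carrier W} \<union>
     {(\<lambda>p. basis_vector (v, w \<oplus>\<^bsub>W\<^esub> w') p - basis_vector (v, w) p - basis_vector (v, w') p)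
        | v w w'. v \<in> carrier V \<and> w \<in> carrier W \<and> w' \<in> carrier W} \<union>
     {(\<lambda>p. basis_vector (group_scalar G c \<odot>\<^bsub>V\<^esub> v, w) p - c * basis_vector (v, w) p)
        | c v w. v \<in> carrier V \<and> w \<in> carrier W} \<union>
     {(\<lambda>p. basis_vector (v, group_scalar H c \<odot>\<^bsub>W\<^esub> w) p - c * basis_vector (v, w) p)
        | c v w. v \<in> carrier V \<and> w \<in> carrier W}"

definition outer_tensor ::
  "('g, 'm) monoid_scheme \<Rightarrow> ('h, 'n) monoid_scheme \<Rightarrow>
   ('g \<Rightarrow> complex, 'v, 'p) module_scheme \<Rightarrow> ('h \<Rightarrow> complex, 'w, 'q) module_scheme \<Rightarrow>
   ('g \<times> 'h \<Rightarrow> complex, ('v \<times> 'w \<Rightarrow> complex) set) module" where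
  "outer_tensor G H V W =
     (let F = permutation_module (G \<times>\<times> H) (carrier V \<times> carrier W)
                (\<lambda>(g, h) (v, w). (basis_vector g \<odot>\<^bsub>V\<^esub> v, basis_vector h \<odot>\<^bsub>W\<^esub> w))
      in quotient_module F
           (generated_submodule (group_algebra (G \<times>\<times> H)) F (tensor_relators G H V W)))"


section \<open>Specht modules\<close>

definition partitions :: "nat \<Rightarrow> nat list set" where
  "partitions k = {\<alpha>. sorted_wrt (\<ge>) \<alpha> \<and> 0 \<notin> set \<alpha> \<and> sum_list \<alpha> = k}"

definition cells :: "nat list \<Rightarrow> (nat \<times> nat) set" where
  "cells \<alpha> = {(i, j). i < length \<alpha> \<and> j < \<alpha> ! i}"

abbreviation (input) row_cells :: "nat list \<Rightarrow> nat \<Rightarrow> (nat \<times> nat) set" where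
  "row_cells \<alpha> i \<equiv> {c \<in> cells \<alpha>. fst c = i}"

abbreviation (input) column_cells :: "nat list \<Rightarrow> nat \<Rightarrow> (nat \<times> nat) set" where
  "column_cells \<alpha> j \<equiv> {c \<in> cells \<alpha>. snd c = j}"

definition tableaux :: "nat \<Rightarrow> nat list \<Rightarrow> (nat \<times> nat \<Rightarrow> nat) set" where
  "tableaux k \<alpha> = {t \<in> extensional (cells \<alpha>). bij_betw t (cells \<alpha>) {1..k}}"

definition tabloid :: "nat \<Rightarrow> nat list \<Rightarrow> (nat \<times> nat \<Rightarrow> nat) \<Rightarrow> (nat \<times> nat \<Rightarrow> nat) set" where
  "tabloid k \<alpha> t = {s \<in> tableaux k \<alpha>. \<forall>i. s ` row_cells \<alpha> i = t ` row_cells \<alpha> i}"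

definition column_group ::
  "nat \<Rightarrow> nat list \<Rightarrow> (nat \<times> nat \<Rightarrow> nat) \<Rightarrow> (nat \<Rightarrow> nat) set" where
  "column_group k \<alpha> t =
     {\<pi> \<in> carrier (sym_group k). \<forall>j. \<pi> ` (t ` column_cells \<alpha> j) = t ` column_cells \<alpha> j}"

definition polytabloid ::
  "nat \<Rightarrow> nat list \<Rightarrow> (nat \<times> nat \<Rightarrow> nat) \<Rightarrow> (nat \<times> nat \<Rightarrow> nat) set \<Rightarrow> complex" where
  "polytabloid k \<alpha> t =
     (\<lambda>T. \<Sum>\<pi>\<in>column_group k \<alpha> t.
        of_int (sign \<pi>) * basis_vector (tabloid k \<alpha> (compose (cells \<alpha>) \<pi> t)) T)"

definition tabloid_module ::
  "nat \<Rightarrow> nat list \<Rightarrow> ((nat \<Rightarrow> nat) \<Rightarrow> complex, (nat \<times> nat \<Rightarrow> nat) set \<Rightarrow> complex) module" where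
  "tabloid_module k \<alpha> =
     permutation_module (sym_group k) (tabloid k \<alpha> ` tableaux k \<alpha>)
       (\<lambda>\<sigma> T. compose (cells \<alpha>) \<sigma> ` T)"

definition specht_module ::
  "nat \<Rightarrow> nat list \<Rightarrow> ((nat \<Rightarrow> nat) \<Rightarrow> complex, (nat \<times> nat \<Rightarrow> nat) set \<Rightarrow> complex) module" where
  "specht_module k \<alpha> =
     (tabloid_module k \<alpha>)
       \<lparr>carrier := generated_submodule (group_algebra (sym_group k)) (tabloid_module k \<alpha>)
                     (polytabloid k \<alpha> ` tableaux k \<alpha>)\<rparr>"


section \<open>The category of onto functions\<close>

text \<open>A function from \<open>{1..r}\<close> onto \<open>{1..k}\<close> is encoded by its extension to all natural numbers by
  the identity (the same convention as for \<open>permutes\<close>).  As \<open>k \<le> r\<close> for an onto function,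
  composition is then composition of the extended functions, and the endomorphisms of \<open>k\<close> are
  literally the elements of \<open>sym_group k\<close>.\<close>

definition SE_hom :: "nat \<Rightarrow> nat \<Rightarrow> (nat \<Rightarrow> nat) set" where
  "SE_hom r k = {f. f ` {1..r} = {1..k} \<and> (\<forall>i. i \<notin> {1..r} \<longrightarrow> f i = i)}"

lemma SE_hom_encoding:
  "bij_betw (\<lambda>f. restrict f {1..r}) (SE_hom r k)
     {f \<in> {1..r} \<rightarrow>\<^sub>E {1..k}. f ` {1..r} = {1..k}}"
proof (rule bij_betw_byWitness[where f' = "\<lambda>f i. if i \<in> {1..r} then f i else i"])
  show "(\<lambda>f i. if i \<in> {1..r} then f i else i) `
      {f \<in> {1..r} \<rightarrow>\<^sub>E {1..k}. f ` {1..r} = {1..k}} \<subseteq> SE_hom r k"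
    by (auto simp: SE_hom_def)
qed (fastforce simp: SE_hom_def PiE_def extensional_def restrict_def)+

lemma SE_hom_le: "f \<in> SE_hom r k \<Longrightarrow> k \<le> r"
  using card_image_le[of "{1..r}" f] by (simp add: SE_hom_def)

lemma SE_hom_comp:
  assumes "f \<in> SE_hom r k" and "g \<in> SE_hom k l"
  shows "g \<circ> f \<in> SE_hom r l"
proof -
  have "(g \<circ> f) ` {1..r} = {1..l}"
    using assms by (simp only: SE_hom_def image_comp[symmetric] mem_Collect_eq)
  with assms SE_hom_le[OF assms(1)] show ?thesis
    by (auto simp: SE_hom_def)
qed

lemma SE_hom_self: "SE_hom k k = carrier (sym_group k)"
proof (intro Set.set_eqI iffI)
  fix f assume f: "f \<in> SE_hom k k"
  then have "inj_on f {1..k}"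
    by (intro eq_card_imp_inj_on) (auto simp: SE_hom_def)
  with f show "f \<in> carrier (sym_group k)"
    by (auto simp: SE_hom_def sym_group_carrier bij_betw_def intro!: bij_imp_permutes)
qed (auto simp: SE_hom_def sym_group_carrier permutes_image permutes_not_in)

type_synonym SE_morphism = "nat \<times> nat \<times> (nat \<Rightarrow> nat)" \<comment> \<open>source, target, function\<close>

definition SE_morphisms :: "nat \<Rightarrow> SE_morphism set" where
  "SE_morphisms n = {(r, k, f). r \<le> n \<and> k \<le> n \<and> f \<in> SE_hom r k}"

fun SE_comp :: "SE_morphism \<Rightarrow> SE_morphism \<Rightarrow> SE_morphism option" where
  "SE_comp (k', l, g) (r, k, f) = (if k' = k then Some (r, l, g \<circ> f) else None)"

definition SE_algebra :: "nat \<Rightarrow> (SE_morphism \<Rightarrow> complex) ring" where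
  "SE_algebra n = category_algebra (SE_morphisms n) SE_comp {(k, k, id) | k. k \<le> n}"

text \<open>The inclusion of the group algebra of \<open>sym_group k\<close> into \<open>SE_algebra n\<close>, for \<open>k \<le> n\<close>.\<close>

definition SE_embed :: "nat \<Rightarrow> ((nat \<Rightarrow> nat) \<Rightarrow> complex) \<Rightarrow> SE_morphism \<Rightarrow> complex" where
  "SE_embed k a = (\<lambda>(r, l, f). if r = k \<and> l = k then a f else 0)"

definition SE_projective ::
  "nat \<Rightarrow> nat \<Rightarrow> ((nat \<Rightarrow> nat) \<Rightarrow> complex) \<Rightarrow> (SE_morphism \<Rightarrow> complex, SE_morphism \<Rightarrow> complex) module"
  where
  "SE_projective n k e = left_ideal_module (SE_algebra n) (SE_embed k e)"

definition SE_simple ::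
  "nat \<Rightarrow> nat \<Rightarrow> ((nat \<Rightarrow> nat) \<Rightarrow> complex) \<Rightarrow>
   (SE_morphism \<Rightarrow> complex, (SE_morphism \<Rightarrow> complex) set) module" where
  "SE_simple n k e =
     quotient_module (SE_projective n k e) (module_radical (SE_algebra n) (SE_projective n k e))"

definition SE_hom_module ::
  "nat \<Rightarrow> nat \<Rightarrow> ((nat \<Rightarrow> nat) \<times> (nat \<Rightarrow> nat) \<Rightarrow> complex, (nat \<Rightarrow> nat) \<Rightarrow> complex) module" where
  "SE_hom_module r k =
     permutation_module (sym_group k \<times>\<times> sym_group r) (SE_hom r k)
       (\<lambda>(g\<^sub>1, g\<^sub>2) m. g\<^sub>1 \<circ> m \<circ> inv\<^bsub>sym_group r\<^esub> g\<^sub>2)"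

end

theory Submission
  imports Defs "HOL-Library.Function_Algebras" "HOL-Computational_Algebra.Fundamental_Theorem_Algebra"
begin

text \<open>
  Both numbers are equal to the dimension of the space \<open>e\<^sub>\<beta> \<cdot> \<complex>SE(r,k) \<cdot> e\<^sub>\<alpha>\<close>.

  Write \<open>A\<close> for the category algebra. If \<open>e\<close> is an idempotent of a complex algebra \<open>R\<close> with
  \<open>eRe = \<complex>e\<close> (the locale \<open>scalar_corner\<close>), then up to isomorphism there is exactly one simple module
  \<open>S\<close> with \<open>eS \<noteq> 0\<close>, namely the quotient of \<open>Re\<close> by its radical, and \<open>eS\<close> is a line. As
  \<open>N \<mapsto> eN\<close> is exact, the dimension of \<open>eM\<close> counts the factors of a composition series of \<open>M\<close>
  that are isomorphic to \<open>S\<close> (\<open>jordan_hoelder_multiplicity_eq_dim\<close>), and also the summands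
  isomorphic to \<open>S\<close> in a decomposition of \<open>M\<close> into simple submodules
  (\<open>constituent_multiplicity_eq_dim\<close>). Since the dimension of \<open>eM\<close> mentions neither the series nor
  the decomposition, this also shows that the multiplicities are well defined. Two such
  idempotents are needed.

  \<^item> For the algebra \<open>A\<close> the idempotent is \<open>e\<^sub>\<beta>\<close>. A primitive idempotent of the group algebra of a
    finite group has scalar corner (\<open>primitive_idempotent_scalar_corner\<close>), and this carries over
    to \<open>A\<close> because the endomorphisms of the object \<open>k\<close> are the elements of the symmetric group. So
    the multiplicity of \<open>S(\<beta>)\<close> in \<open>P(\<alpha>) = A e\<^sub>\<alpha>\<close> is the dimension of
    \<open>e\<^sub>\<beta> A e\<^sub>\<alpha> = e\<^sub>\<beta> \<cdot> \<complex>SE(r,k) \<cdot> e\<^sub>\<alpha>\<close>.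

  \<^item> For the group algebra of the product of the two symmetric groups the idempotent is \<open>e\<^sub>\<beta> \<otimes> e\<^sub>\<alpha>\<^sup>*\<close>, where
    \<open>*\<close> is the linear extension of the inversion of permutations (\<open>flip\<close>). The pair \<open>(g\<^sub>1, g\<^sub>2)\<close>
    acts by \<open>m \<mapsto> g\<^sub>1 m g\<^sub>2\<^sup>-\<^sup>1\<close>, so this idempotent acts on \<open>\<complex>SE(r,k)\<close> as
    \<open>m \<mapsto> e\<^sub>\<beta> m e\<^sub>\<alpha>\<close>, and its image is the same space. It remains to see that the simple module that
    it detects is \<open>S\<^sup>\<beta> \<otimes> S\<^sup>\<alpha>\<close>. This module is simple (\<open>outer_tensor_simple\<close>), and the
    idempotent does not annihilate it, because \<open>e\<^sub>\<alpha>\<^sup>*\<close> does not annihilate \<open>S\<^sup>\<alpha>\<close>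
    (\<open>specht_flip_acts_nontrivially\<close>). The last point is the self-duality of Specht modules: the
    tabloid module has a positive definite invariant form, and the Specht module is spanned by
    real vectors.
\<close>

section \<open>Finite-dimensional spaces of complex functions\<close>

definition fscale :: "complex \<Rightarrow> ('x \<Rightarrow> complex) \<Rightarrow> 'x \<Rightarrow> complex" where
  "fscale c v = (\<lambda>x. c * v x)"

lemma fscale_apply [simp]: "fscale c v x = c * v x"
  by (simp add: fscale_def)

interpretation fs: vector_space "fscale :: complex \<Rightarrow> ('x \<Rightarrow> complex) \<Rightarrow> 'x \<Rightarrow> complex"
  by standard (auto simp: fun_eq_iff algebra_simps)

interpretation fsp: vector_space_pair "fscale :: complex \<Rightarrow> ('x \<Rightarrow> complex) \<Rightarrow> 'x \<Rightarrow> complex"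
    "fscale :: complex \<Rightarrow> ('y \<Rightarrow> complex) \<Rightarrow> 'y \<Rightarrow> complex"
  by standard

text \<open>The space of all functions on an infinite type has no finite basis, so finite dimension is a
  property of its subsets.\<close>

definition finite_dimensional :: "('x \<Rightarrow> complex) set \<Rightarrow> bool" where
  "finite_dimensional V \<longleftrightarrow> (\<exists>B. finite B \<and> V \<subseteq> fs.span B)"

lemma finite_dimensional_mono: "finite_dimensional W \<Longrightarrow> V \<subseteq> W \<Longrightarrow> finite_dimensional V"
  unfolding finite_dimensional_def by blast

lemma finite_basis_exists:
  assumes "finite_dimensional V"
  obtains B where "B \<subseteq> V" "fs.independent B" "V \<subseteq> fs.span B" "finite B" "card B = fs.dim V"
proof -
  obtain T where T: "finite T" "V \<subseteq> fs.span T"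
    using assms by (auto simp: finite_dimensional_def)
  obtain B where B: "B \<subseteq> V" "fs.independent B" "V \<subseteq> fs.span B" "card B = fs.dim V"
    by (rule fs.basis_exists)
  show thesis
    using that[OF B(1-3) _ B(4)] fs.independent_span_bound[OF T(1) B(2)] B(1) T(2) by blast
qed

lemma dim_mono_of_finite_dimensional:
  assumes "finite_dimensional W" "V \<subseteq> W"
  shows "fs.dim V \<le> fs.dim W"
proof -
  obtain B where B: "W \<subseteq> fs.span B" "finite B" "card B = fs.dim W"
    using finite_basis_exists[OF assms(1)] by blast
  then show ?thesis
    using fs.dim_le_card[of V B] assms(2) by auto
qed

lemma subspace_eq_of_dim_le:
  assumes "finite_dimensional W" "V \<subseteq> W" "fs.subspace V" "fs.dim W \<le> fs.dim V"
  shows "V = W"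
proof (rule ccontr)
  assume "V \<noteq> W"
  then obtain w where w: "w \<in> W" "w \<notin> V"
    using assms(2) by blast
  obtain B where B: "B \<subseteq> V" "fs.independent B" "V \<subseteq> fs.span B" "finite B" "card B = fs.dim V"
    using finite_basis_exists[OF finite_dimensional_mono[OF assms(1,2)]] by blast
  have "w \<notin> fs.span B"
    using w(2) B(1) assms(3) fs.span_minimal by blast
  then have ind: "fs.independent (insert w B)" and card: "card (insert w B) = Suc (fs.dim V)"
    using B fs.independent_insertI fs.span_base by (auto simp: card_insert_if)
  obtain C where C: "W \<subseteq> fs.span C" "finite C" "card C = fs.dim W"
    using finite_basis_exists[OF assms(1)] by blast
  have "card (insert w B) \<le> card C"
    using fs.independent_span_bound[OF C(2) ind] C(1) B(1) w(1) assms(2) by auto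
  then show False
    using card C(3) assms(4) by simp
qed

text \<open>A simple factor enlarges the part of a module that is cut out by an idempotent by at most one
  vector, so this case suffices for counting factors.\<close>

lemma dim_one_step_extension:
  assumes "finite_dimensional V" "fs.subspace V" "w \<notin> V"
  shows "fs.dim {v + fscale c w | v c. v \<in> V} = Suc (fs.dim V)"
proof -
  obtain B where B: "B \<subseteq> V" "fs.independent B" "V \<subseteq> fs.span B" "finite B" "card B = fs.dim V"
    using finite_basis_exists[OF assms(1)] by blast
  have V: "fs.span B = V"
    using B assms(2) by (simp add: fs.span_subspace)
  have "{v + fscale c w | v c. v \<in> V} = fs.span (insert w B)"
    unfolding fs.span_insert V
  proof (intro Set.set_eqI iffI)
    fix x assume "x \<in> {v + fscale c w | v c. v \<in> V}"
    then obtain v c where "v \<in> V" "x - fscale c w = v"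
      by (auto simp: algebra_simps)
    then show "x \<in> {x. \<exists>k. x - fscale k w \<in> V}"
      by blast
  qed (force simp: algebra_simps)
  moreover have "fs.independent (insert w B)"
    using B(2) V assms(3) by (simp add: fs.independent_insertI)
  moreover have "w \<notin> B"
    using assms(3) B(1) by blast
  ultimately show ?thesis
    using B fs.dim_span_eq_card_independent[of "insert w B"] by simp
qed

lemma dim_zero_space [simp]: "fs.dim {0} = 0"
  using fs.dim_unique[of "{}" "{0}" 0] fs.independent_empty by simp

text \<open>For \<open>P\<close> the property of being a submodule, this and the next lemma replace the chain conditions:
  the dimension bounds every chain of subspaces.\<close>

lemma minimal_nonzero_subset_exists:
  assumes V: "P V" "V \<noteq> {0}" and P: "\<And>W. P W \<Longrightarrow> fs.subspace W" and fin: "finite_dimensional V"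
  obtains U where "P U" "U \<subseteq> V" "U \<noteq> {0}" "\<And>W. P W \<Longrightarrow> W \<subseteq> U \<Longrightarrow> W \<noteq> {0} \<Longrightarrow> W = U"
proof -
  let ?Q = "\<lambda>U. P U \<and> U \<subseteq> V \<and> U \<noteq> {0}"
  obtain U where U: "?Q U" and min: "\<And>W. ?Q W \<Longrightarrow> fs.dim U \<le> fs.dim W"
    using ex_has_least_nat[of ?Q V fs.dim] V by blast
  show thesis
  proof (rule that)
    show "P U" "U \<subseteq> V" "U \<noteq> {0}" using U by auto
    fix W assume W: "P W" "W \<subseteq> U" "W \<noteq> {0}"
    then show "W = U"
      using U fin finite_dimensional_mono min[of W]
      by (intro subspace_eq_of_dim_le P) auto
  qed
qed

lemma maximal_proper_subset_exists:
  assumes W: "P W" "W \<subseteq> V" "W \<noteq> V" and P: "\<And>W. P W \<Longrightarrow> fs.subspace W" and fin: "finite_dimensional V"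
  obtains U where "P U" "U \<subseteq> V" "U \<noteq> V" "\<And>W. P W \<Longrightarrow> U \<subseteq> W \<Longrightarrow> W \<subseteq> V \<Longrightarrow> W = U \<or> W = V"
proof -
  let ?Q = "\<lambda>U. P U \<and> U \<subseteq> V \<and> U \<noteq> V"
  have "fs.dim U < Suc (fs.dim V)" if "?Q U" for U
    using dim_mono_of_finite_dimensional[OF fin, of U] that by auto
  then obtain U where U: "?Q U" and max: "\<And>W. ?Q W \<Longrightarrow> fs.dim W \<le> fs.dim U"
    using ex_has_greatest_nat[of ?Q W fs.dim "Suc (fs.dim V)"] W by (meson order_less_imp_le)
  show thesis
  proof (rule that)
    show "P U" "U \<subseteq> V" "U \<noteq> V" using U by auto
    fix W assume W: "P W" "U \<subseteq> W" "W \<subseteq> V"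
    show "W = U \<or> W = V"
    proof (cases "W = V")
      case False
      then have "U = W"
        using W U P max[of W] finite_dimensional_mono[OF fin W(3)]
        by (intro subspace_eq_of_dim_le) auto
      then show ?thesis by simp
    qed simp
  qed
qed

lemma dim_injective_image:
  assumes "Vector_Spaces.linear fscale fscale f" "fs.subspace V" "inj_on f V" "finite_dimensional V"
  shows "fs.dim (f ` V) = fs.dim V"
proof -
  obtain B where B: "B \<subseteq> V" "fs.independent B" "V \<subseteq> fs.span B" "finite B" "card B = fs.dim V"
    using finite_basis_exists[OF assms(4)] by blast
  have sp: "fs.span B = V"
    using B assms(2) by (simp add: fs.span_subspace)
  interpret f: Vector_Spaces.linear fscale fscale f by fact
  have "fs.independent (f ` B)"
    using f.independent_injective_image[OF B(2)] sp assms(3) by simp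
  moreover have "fs.span (f ` B) = f ` V"
    using sp f.span_image by simp
  moreover have "card (f ` B) = card B"
    using inj_on_subset[OF assms(3) B(1)] by (rule card_image)
  ultimately show ?thesis
    using B(5) fs.dim_span_eq_card_independent by metis
qed

lemma sum_fun_apply: "(\<Sum>i\<in>I. f i) x = (\<Sum>i\<in>I. f i x)"
  for f :: "'i \<Rightarrow> 'x \<Rightarrow> complex"
  by (induction I rule: infinite_finite_induct) auto

lemma basis_vector_apply: "basis_vector x y = (if y = x then 1 else 0)"
  by (simp add: basis_vector_def)

lemma basis_expansion:
  assumes "finite X" "\<And>x. x \<notin> X \<Longrightarrow> v x = 0"
  shows "v = (\<Sum>x\<in>X. fscale (v x) (basis_vector x))"
proof
  fix y
  have "(\<Sum>x\<in>X. fscale (v x) (basis_vector x)) y = (\<Sum>x\<in>X. if x = y then v x else 0)"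
    unfolding sum_fun_apply by (intro sum.cong) (auto simp: basis_vector_apply)
  then show "v y = (\<Sum>x\<in>X. fscale (v x) (basis_vector x)) y"
    using assms by simp
qed

lemma finite_dimensional_supported:
  assumes "finite X"
  shows "finite_dimensional {v. \<forall>x. x \<notin> X \<longrightarrow> v x = 0}"
  unfolding finite_dimensional_def
proof (intro exI conjI subsetI)
  show "finite (basis_vector ` X)" using assms by simp
  fix v assume "v \<in> {v. \<forall>x. x \<notin> X \<longrightarrow> v x = (0::complex)}"
  then have "v = (\<Sum>x\<in>X. fscale (v x) (basis_vector x))"
    by (intro basis_expansion assms) auto
  also have "\<dots> \<in> fs.span (basis_vector ` X)"
    by (intro fs.span_sum fs.span_scale fs.span_base) auto
  finally show "v \<in> fs.span (basis_vector ` X)" .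
qed

lemma nontrivial_relation_exists:
  fixes f :: "nat \<Rightarrow> 'x \<Rightarrow> complex"
  assumes "finite_dimensional V" and f: "\<And>i. f i \<in> V"
  obtains u N where "(\<Sum>i\<le>N. fscale (u i) (f i)) = 0" "\<exists>i\<le>N. u i \<noteq> 0"
proof -
  obtain B where B: "V \<subseteq> fs.span B" "finite B"
    using assms(1) by (auto simp: finite_dimensional_def)
  define N where "N = card B"
  show thesis
  proof (cases "inj_on f {..N}")
    case True
    have "card (f ` {..N}) = Suc N"
      using card_image[OF True] by simp
    moreover have "f ` {..N} \<subseteq> fs.span B"
      using f B by auto
    ultimately have "fs.dependent (f ` {..N})"
      using fs.independent_span_bound[OF B(2), of "f ` {..N}"] N_def by auto
    then obtain u where u: "\<exists>v\<in>f ` {..N}. u v \<noteq> 0" "(\<Sum>v\<in>f ` {..N}. fscale (u v) v) = 0"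
      using fs.dependent_finite[of "f ` {..N}"] by auto
    show thesis
    proof (rule that)
      show "(\<Sum>i\<le>N. fscale (u (f i)) (f i)) = 0"
        using u(2) sum.reindex[OF True, of "\<lambda>v. fscale (u v) v"] by simp
    qed (use u(1) in auto)
  next
    case False
    then obtain i j where ij: "i \<le> N" "j \<le> N" "i \<noteq> j" "f i = f j"
      by (auto simp: inj_on_def)
    define u where "u = (\<lambda>m. if m = i then 1 else if m = j then -1 else (0::complex))"
    show thesis
    proof (rule that)
      have "(\<Sum>m\<le>N. fscale (u m) (f m)) = (\<Sum>m\<in>{i,j}. fscale (u m) (f m))"
        using ij by (intro sum.mono_neutral_right) (auto simp: u_def fun_eq_iff)
      also have "\<dots> = 0"
        using ij by (auto simp: u_def fun_eq_iff)
      finally show "(\<Sum>m\<le>N. fscale (u m) (f m)) = 0" .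
      show "\<exists>m\<le>N. u m \<noteq> 0"
        using ij by (auto simp: u_def)
    qed
  qed
qed

text \<open>A finite-dimensional space cannot contain all iterates of a vector as independent vectors, so
  some polynomial in \<open>T\<close> kills the vector; the fundamental theorem of algebra splits off a linear
  factor.\<close>

lemma eigenvector_exists:
  fixes T :: "('x \<Rightarrow> complex) \<Rightarrow> 'x \<Rightarrow> complex"
  assumes T: "Vector_Spaces.linear fscale fscale T"
    and V: "fs.subspace V" "finite_dimensional V" "\<And>v. v \<in> V \<Longrightarrow> T v \<in> V"
    and v0: "v0 \<in> V" "v0 \<noteq> 0"
  obtains \<mu> v where "v \<in> V" "v \<noteq> 0" "T v = fscale \<mu> v"
proof -
  interpret T: Vector_Spaces.linear fscale fscale T by (rule T)
  \<comment> \<open>\<open>ev p\<close> is \<open>p(T) v0\<close>\<close>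
  define ev where "ev p = fold_coeffs (\<lambda>a v. fscale a v0 + T v) p 0" for p
  have fc: "fold_coeffs (\<lambda>a v. fscale a v0 + T v) (pCons a p) =
      (\<lambda>v. fscale a v0 + T v) \<circ> fold_coeffs (\<lambda>a v. fscale a v0 + T v) p" if "a \<noteq> 0 \<or> p \<noteq> 0" for a p
    using that by (auto simp: fun_eq_iff)
  have ev_0 [simp]: "ev 0 = 0"
    by (simp add: ev_def)
  have ev_pCons [simp]: "ev (pCons a p) = fscale a v0 + T (ev p)" for a p
  proof (cases "a = 0 \<and> p = 0")
    case True
    then show ?thesis by (simp add: ev_def T.zero)
  next
    case False
    then show ?thesis using fc[of a p] by (auto simp: ev_def)
  qed
  have ev_add: "ev (p + q) = ev p + ev q" for p q
  proof (induction p arbitrary: q)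
    case (pCons a p)
    obtain b q' where "q = pCons b q'" by (cases q)
    then show ?case
      using pCons.IH[of q'] by (simp add: T.add fs.scale_left_distrib algebra_simps
          del: plus_fun_apply fscale_apply zero_fun_apply)
  qed simp
  have ev_smult: "ev (Polynomial.smult c p) = fscale c (ev p)" for c p
    by (induction p) (simp_all add: T.scale fs.scale_right_distrib T.add
        del: plus_fun_apply fscale_apply zero_fun_apply)
  have ev_V: "ev p \<in> V" for p
    using V v0 by (induction p) (auto intro!: fs.subspace_add fs.subspace_scale fs.subspace_0)
  have ev_monom: "ev (monom c i) = fscale c ((T ^^ i) v0)" for c i
    by (induction i) (simp_all add: monom_0 monom_Suc T.zero T.scale
        del: plus_fun_apply fscale_apply zero_fun_apply)
  have iter: "(T ^^ i) v0 \<in> V" for i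
    using V v0 by (induction i) auto
  obtain u N where u: "(\<Sum>i\<le>N. fscale (u i) ((T ^^ i) v0)) = 0" "\<exists>i\<le>N. u i \<noteq> 0"
    using nontrivial_relation_exists[OF V(2), of "\<lambda>i. (T ^^ i) v0"] iter by blast
  define p0 where "p0 = (\<Sum>i\<le>N. monom (u i) i)"
  have "ev (\<Sum>i\<in>A. monom (u i) i) = (\<Sum>i\<in>A. fscale (u i) ((T ^^ i) v0))" if "finite A" for A
    using that by (induction A) (auto simp: ev_add ev_monom)
  then have "ev p0 = 0"
    using u(1) by (simp add: p0_def)
  moreover have "p0 \<noteq> 0"
  proof -
    obtain i where "i \<le> N" "u i \<noteq> 0" using u(2) by blast
    then have "coeff p0 i \<noteq> 0"
      by (simp add: p0_def coeff_sum)
    then show ?thesis by auto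
  qed
  \<comment> \<open>a polynomial of least degree that kills \<open>v0\<close>: dividing by a root gives an eigenvector\<close>
  ultimately obtain p where p: "p \<noteq> 0" "ev p = 0"
    and min: "\<And>q. q \<noteq> 0 \<and> ev q = 0 \<Longrightarrow> degree p \<le> degree q"
    using ex_has_least_nat[of "\<lambda>p. p \<noteq> 0 \<and> ev p = 0" p0 degree] by blast
  have "degree p \<noteq> 0"
  proof
    assume "degree p = 0"
    then obtain a where "p = [:a:]" by (rule degree_eq_zeroE)
    then show False
      using p v0 by (auto simp: T.zero)
  qed
  then obtain \<mu> where "poly p \<mu> = 0"
    using fundamental_theorem_of_algebra constant_degree by metis
  then obtain q where q: "p = [:-\<mu>, 1:] * q"
    by (auto simp: poly_eq_0_iff_dvd)
  then have "q \<noteq> 0" "degree q < degree p"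
    using p(1) degree_mult_eq[of "[:-\<mu>, 1:]" q] by (cases "q = 0"; simp only: q; simp del: mult_pCons_left)+
  then have "ev q \<noteq> 0"
    using min[of q] by fastforce
  moreover have "ev p = T (ev q) - fscale \<mu> (ev q)"
    unfolding q mult_pCons_left using ev_add[of "Polynomial.smult (-\<mu>) q" "pCons 0 q"] ev_smult[of "-\<mu>" q]
    by (simp add: fun_eq_iff)
  ultimately show thesis
    using that[of "ev q" \<mu>] ev_V p(2) by simp
qed

text \<open>Gram-Schmidt: the orthogonal projection to the span of a finite set is built by adding the
  vectors of the set one at a time.\<close>

lemma orthogonal_decomposition:
  fixes V :: "('x \<Rightarrow> complex) set"
  assumes X: "finite X" and supp: "\<And>v x. v \<in> V \<Longrightarrow> x \<notin> X \<Longrightarrow> v x = 0"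
    and V: "fs.subspace V"
  obtains l where "l \<in> V" "\<And>z. z \<in> V \<Longrightarrow> (\<Sum>x\<in>X. (v x - l x) * cnj (z x)) = 0"
proof -
  have "finite_dimensional V"
    using finite_dimensional_supported[OF X] supp finite_dimensional_mono by blast
  then obtain B where B: "B \<subseteq> V" "V \<subseteq> fs.span B" "finite B"
    using finite_basis_exists by metis
  have "\<exists>l\<in>fs.span C. \<forall>z\<in>fs.span C. (\<Sum>x\<in>X. (v x - l x) * cnj (z x)) = 0"
    if "finite C" "C \<subseteq> V" for C v
    using that
  proof (induction C arbitrary: v)
    case empty
    show "\<exists>l\<in>fs.span {}. \<forall>z\<in>fs.span {}. (\<Sum>x\<in>X. (v x - l x) * cnj (z x)) = 0"
      by auto
  next
    case (insert b C)
    let ?ip = "\<lambda>v w. \<Sum>x\<in>X. v x * cnj (w x :: complex)"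
    have CV: "fs.span C \<subseteq> V"
      using insert.prems V fs.span_minimal by blast
    obtain l where l: "l \<in> fs.span C" "\<And>z. z \<in> fs.span C \<Longrightarrow> (\<Sum>x\<in>X. (v x - l x) * cnj (z x)) = 0"
      using insert.IH[of v] insert.prems by blast
    obtain m where m: "m \<in> fs.span C" "\<And>z. z \<in> fs.span C \<Longrightarrow> (\<Sum>x\<in>X. (b x - m x) * cnj (z x)) = 0"
      using insert.IH[of b] insert.prems by blast
    define b' where "b' = (\<lambda>x. b x - m x)"
    have "b' = b - m" by (auto simp: b'_def)
    then have b'_span: "b' \<in> fs.span (insert b C)"
      using m(1) fs.span_base[of b] fs.span_mono[of C "insert b C"] by (auto intro!: fs.span_diff)
    have "b' \<in> V"
      using b'_span insert.prems V fs.span_minimal by blast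
    have b'_orth: "?ip b' z = 0" if "z \<in> fs.span C" for z
      using m(2)[OF that] by (simp add: b'_def)
    \<comment> \<open>\<open>b'\<close> is the part of \<open>b\<close> orthogonal to the span of \<open>C\<close>; if it is \<open>0\<close>,
        then so is the coefficient \<open>c\<close>, as division by \<open>0\<close> gives \<open>0\<close>\<close>
    define c where "c = ?ip v b' / ?ip b' b'"
    have norm0: "b' = 0" if "?ip b' b' = 0"
    proof
      fix x
      have "(\<Sum>x\<in>X. (cmod (b' x))\<^sup>2) = 0"
      proof -
        have "complex_of_real (\<Sum>x\<in>X. (cmod (b' x))\<^sup>2) = ?ip b' b'"
          unfolding of_real_sum by (intro sum.cong refl complex_norm_square)
        then show ?thesis using that by (metis of_real_eq_0_iff)
      qed
      then have "x \<in> X \<Longrightarrow> b' x = 0"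
        using X by (simp add: sum_nonneg_eq_0_iff)
      then show "b' x = 0 x"
        using supp[OF \<open>b' \<in> V\<close>, of x] by auto
    qed
    have c: "?ip v b' - c * ?ip b' b' = 0"
      using norm0 by (cases "?ip b' b' = 0") (auto simp: c_def)
    have cl: "?ip l b' = 0"
      using b'_orth[OF l(1)]
      by (metis (no_types, lifting) cnj_sum complex_cnj_cnj complex_cnj_mult complex_cnj_zero mult.commute sum.cong)
    show "\<exists>l\<in>fs.span (insert b C). \<forall>z\<in>fs.span (insert b C). (\<Sum>x\<in>X. (v x - l x) * cnj (z x)) = 0"
    proof (intro bexI ballI)
      show "l + fscale c b' \<in> fs.span (insert b C)"
        using l(1) b'_span fs.span_mono[of C "insert b C"] by (auto intro!: fs.span_add fs.span_scale)
      fix z assume "z \<in> fs.span (insert b C)"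
      then obtain k where "z - fscale k b \<in> fs.span C"
        unfolding fs.span_insert by blast
      then have "(z - fscale k b) + fscale k m \<in> fs.span C"
        using m(1) by (intro fs.span_add fs.span_scale)
      then obtain w where w: "w \<in> fs.span C" "z = w + fscale k b'"
        by (intro that[of "(z - fscale k b) + fscale k m"]) (auto simp: b'_def fun_eq_iff algebra_simps)
      have "(\<Sum>x\<in>X. (v x - (l + fscale c b') x) * cnj (z x)) =
          (\<Sum>x\<in>X. (v x - l x) * cnj (w x)) - c * ?ip b' w +
          cnj k * (?ip v b' - ?ip l b' - c * ?ip b' b')"
        unfolding w(2)
        by (simp add: sum_distrib_left sum_subtractf[symmetric] sum.distrib[symmetric] algebra_simps)
      also have "\<dots> = 0"
        using l(2)[OF w(1)] b'_orth[OF w(1)] c cl by simp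
      finally show "(\<Sum>x\<in>X. (v x - (l + fscale c b') x) * cnj (z x)) = 0" .
    qed
  qed
  from this[OF B(3,1), of v] show thesis
    using that B V fs.span_minimal[OF B(1) V] by (metis subset_antisym)
qed

text \<open>From here on vectors are treated as elements of a vector space, and evaluation at a point is
  requested explicitly.\<close>

declare fscale_apply [simp del]

section \<open>Submodules, quotients and simple modules\<close>

lemma submoduleD:
  assumes "submodule N R M"
  shows "N \<subseteq> carrier M" "\<zero>\<^bsub>M\<^esub> \<in> N"
    and "\<And>x y. x \<in> N \<Longrightarrow> y \<in> N \<Longrightarrow> x \<oplus>\<^bsub>M\<^esub> y \<in> N"
    and "\<And>a x. a \<in> carrier R \<Longrightarrow> x \<in> N \<Longrightarrow> a \<odot>\<^bsub>M\<^esub> x \<in> N"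
proof -
  interpret submodule N R M by fact
  show "N \<subseteq> carrier M" "\<zero>\<^bsub>M\<^esub> \<in> N" using subset one_closed by auto
  show "\<And>x y. x \<in> N \<Longrightarrow> y \<in> N \<Longrightarrow> x \<oplus>\<^bsub>M\<^esub> y \<in> N" using m_closed by auto
  show "\<And>a x. a \<in> carrier R \<Longrightarrow> x \<in> N \<Longrightarrow> a \<odot>\<^bsub>M\<^esub> x \<in> N" by (rule smult_closed)
qed

lemma simple_moduleD:
  assumes "simple_module R M"
  shows "left_module R M" "carrier M \<noteq> {\<zero>\<^bsub>M\<^esub>}"
    and "submodule N R M \<Longrightarrow> x \<in> N \<Longrightarrow> x \<noteq> \<zero>\<^bsub>M\<^esub> \<Longrightarrow> N = carrier M"
  using assms by (auto simp: simple_module_def)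

context left_module
begin

lemma zero_smult: "x \<in> carrier M \<Longrightarrow> \<zero>\<^bsub>R\<^esub> \<odot>\<^bsub>M\<^esub> x = \<zero>\<^bsub>M\<^esub>"
  using smult_l_distr[of "\<zero>\<^bsub>R\<^esub>" "\<zero>\<^bsub>R\<^esub>" x] smult_closed[of "\<zero>\<^bsub>R\<^esub>" x]
  by (metis M.add.r_cancel_one' R.add.l_one R.zero_closed)

lemma smult_zero: "a \<in> carrier R \<Longrightarrow> a \<odot>\<^bsub>M\<^esub> \<zero>\<^bsub>M\<^esub> = \<zero>\<^bsub>M\<^esub>"
  using smult_r_distr[of a "\<zero>\<^bsub>M\<^esub>" "\<zero>\<^bsub>M\<^esub>"] smult_closed[of a "\<zero>\<^bsub>M\<^esub>"]
  by (metis M.add.r_cancel_one' M.l_zero M.zero_closed)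

lemma minus_one_smult: "x \<in> carrier M \<Longrightarrow> (\<ominus>\<^bsub>R\<^esub> \<one>\<^bsub>R\<^esub>) \<odot>\<^bsub>M\<^esub> x = \<ominus>\<^bsub>M\<^esub> x"
  using smult_l_distr[of "\<ominus>\<^bsub>R\<^esub> \<one>\<^bsub>R\<^esub>" "\<one>\<^bsub>R\<^esub>" x] smult_one[of x] smult_closed[of "\<ominus>\<^bsub>R\<^esub> \<one>\<^bsub>R\<^esub>" x]
    zero_smult[of x]
  by (metis M.minus_equality R.add.inv_closed R.l_neg R.one_closed)

lemma submodule_of_closed:
  assumes "N \<subseteq> carrier M" "\<zero>\<^bsub>M\<^esub> \<in> N"
    and "\<And>x y. x \<in> N \<Longrightarrow> y \<in> N \<Longrightarrow> x \<oplus>\<^bsub>M\<^esub> y \<in> N"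
    and "\<And>a x. a \<in> carrier R \<Longrightarrow> x \<in> N \<Longrightarrow> a \<odot>\<^bsub>M\<^esub> x \<in> N"
  shows "submodule N R M"
proof (intro submodule.intro subgroup.intro)
  show "N \<subseteq> carrier (add_monoid M)" using assms(1) by simp
  fix x assume x: "x \<in> N"
  then have "\<ominus>\<^bsub>M\<^esub> x \<in> N"
    using assms(1) assms(4)[of "\<ominus>\<^bsub>R\<^esub> \<one>\<^bsub>R\<^esub>" x] minus_one_smult[of x] by auto
  then show "inv\<^bsub>add_monoid M\<^esub> x \<in> N"
    by (simp add: a_inv_def)
qed (use assms in \<open>auto simp: submodule_axioms_def\<close>)

lemma carrier_submodule: "submodule (carrier M) R M"
  by (rule submodule_of_closed) (auto intro: smult_closed)

lemma zero_submodule: "submodule {\<zero>\<^bsub>M\<^esub>} R M"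
  by (rule submodule_of_closed) (auto simp: smult_zero)

lemma submodule_Int:
  assumes "submodule N R M" "submodule K R M"
  shows "submodule (N \<inter> K) R M"
  using submoduleD[OF assms(1)] submoduleD[OF assms(2)] by (intro submodule_of_closed) auto

lemma submodule_sum:
  assumes "submodule N R M" "submodule K R M"
  shows "submodule {x \<oplus>\<^bsub>M\<^esub> y | x y. x \<in> N \<and> y \<in> K} R M"
proof (rule submodule_of_closed)
  note N = submoduleD[OF assms(1)] and K = submoduleD[OF assms(2)]
  show "{x \<oplus>\<^bsub>M\<^esub> y | x y. x \<in> N \<and> y \<in> K} \<subseteq> carrier M"
    using N(1) K(1) by auto
  show "\<zero>\<^bsub>M\<^esub> \<in> {x \<oplus>\<^bsub>M\<^esub> y | x y. x \<in> N \<and> y \<in> K}"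
    using N(2) K(2) M.l_zero[OF M.zero_closed] by force
next
  note N = submoduleD[OF assms(1)] and K = submoduleD[OF assms(2)]
  fix z w assume "z \<in> {x \<oplus>\<^bsub>M\<^esub> y | x y. x \<in> N \<and> y \<in> K}" "w \<in> {x \<oplus>\<^bsub>M\<^esub> y | x y. x \<in> N \<and> y \<in> K}"
  then obtain x y x' y' where *: "z = x \<oplus>\<^bsub>M\<^esub> y" "w = x' \<oplus>\<^bsub>M\<^esub> y'" "x \<in> N" "y \<in> K" "x' \<in> N" "y' \<in> K"
    by blast
  have "z \<oplus>\<^bsub>M\<^esub> w = (x \<oplus>\<^bsub>M\<^esub> x') \<oplus>\<^bsub>M\<^esub> (y \<oplus>\<^bsub>M\<^esub> y')"
    using * N(1) K(1) by (simp add: subset_iff M.a_ac)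
  then show "z \<oplus>\<^bsub>M\<^esub> w \<in> {x \<oplus>\<^bsub>M\<^esub> y | x y. x \<in> N \<and> y \<in> K}"
    using N(3)[OF *(3,5)] K(3)[OF *(4,6)] by blast
next
  note N = submoduleD[OF assms(1)] and K = submoduleD[OF assms(2)]
  fix a z assume a: "a \<in> carrier R" and "z \<in> {x \<oplus>\<^bsub>M\<^esub> y | x y. x \<in> N \<and> y \<in> K}"
  then obtain x y where *: "z = x \<oplus>\<^bsub>M\<^esub> y" "x \<in> N" "y \<in> K"
    by blast
  have "a \<odot>\<^bsub>M\<^esub> z = a \<odot>\<^bsub>M\<^esub> x \<oplus>\<^bsub>M\<^esub> a \<odot>\<^bsub>M\<^esub> y"
    using * a N(1) K(1) by (simp add: subset_iff smult_r_distr)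
  then show "a \<odot>\<^bsub>M\<^esub> z \<in> {x \<oplus>\<^bsub>M\<^esub> y | x y. x \<in> N \<and> y \<in> K}"
    using N(4)[OF a *(2)] K(4)[OF a *(3)] by blast
qed

lemma cyclic_submodule:
  assumes "x \<in> carrier M"
  shows "submodule {a \<odot>\<^bsub>M\<^esub> x | a. a \<in> carrier R} R M"
proof (rule submodule_of_closed)
  show "\<zero>\<^bsub>M\<^esub> \<in> {a \<odot>\<^bsub>M\<^esub> x |a. a \<in> carrier R}"
    using zero_smult[OF assms] by force
next
  fix y z assume "y \<in> {a \<odot>\<^bsub>M\<^esub> x |a. a \<in> carrier R}" "z \<in> {a \<odot>\<^bsub>M\<^esub> x |a. a \<in> carrier R}"
  then obtain a b where "a \<in> carrier R" "b \<in> carrier R" "y = a \<odot>\<^bsub>M\<^esub> x" "z = b \<odot>\<^bsub>M\<^esub> x" by blast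
  then show "y \<oplus>\<^bsub>M\<^esub> z \<in> {a \<odot>\<^bsub>M\<^esub> x |a. a \<in> carrier R}"
    using smult_l_distr[of a b x] assms
    by (intro CollectI exI[of _ "a \<oplus>\<^bsub>R\<^esub> b"]) simp
next
  fix b z assume "b \<in> carrier R" "z \<in> {a \<odot>\<^bsub>M\<^esub> x |a. a \<in> carrier R}"
  then obtain a where "a \<in> carrier R" "b \<in> carrier R" "z = a \<odot>\<^bsub>M\<^esub> x" by blast
  then show "b \<odot>\<^bsub>M\<^esub> z \<in> {a \<odot>\<^bsub>M\<^esub> x |a. a \<in> carrier R}"
    using smult_assoc1[of b a x] assms
    by (intro CollectI exI[of _ "b \<otimes>\<^bsub>R\<^esub> a"]) simp
qed (use assms in \<open>auto intro: smult_closed\<close>)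

lemma restrict_left_module:
  assumes "submodule N R M"
  shows "left_module R (M\<lparr>carrier := N\<rparr>)"
proof -
  interpret submodule N R M by fact
  note N = submoduleD[OF assms]
  have "abelian_group (M\<lparr>carrier := N\<rparr>)"
  proof (rule abelian_groupI)
    fix x assume "x \<in> carrier (M\<lparr>carrier := N\<rparr>)"
    then have x: "x \<in> N" "x \<in> carrier M" using N(1) by auto
    then show "\<exists>y\<in>carrier (M\<lparr>carrier := N\<rparr>). y \<oplus>\<^bsub>M\<lparr>carrier := N\<rparr>\<^esub> x = \<zero>\<^bsub>M\<lparr>carrier := N\<rparr>\<^esub>"
      using N(4)[of "\<ominus>\<^bsub>R\<^esub> \<one>\<^bsub>R\<^esub>" x] minus_one_smult[of x] M.l_neg[of x] by auto
  qed (use N in \<open>auto simp: subset_iff M.a_ac\<close>)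
  then show ?thesis
    unfolding left_module_def left_module_axioms_def
    using N R.ring_axioms smult_l_distr smult_r_distr smult_assoc1 smult_one
    by (auto simp: subset_iff)
qed

lemma submodule_of_restrict_iff:
  assumes "submodule N R M"
  shows "submodule K R (M\<lparr>carrier := N\<rparr>) \<longleftrightarrow> submodule K R M \<and> K \<subseteq> N"
proof
  interpret N: left_module R "M\<lparr>carrier := N\<rparr>" by (rule restrict_left_module[OF assms])
  show "submodule K R M \<and> K \<subseteq> N" if "submodule K R (M\<lparr>carrier := N\<rparr>)"
    using submoduleD[OF that] submoduleD(1)[OF assms] by (auto intro!: submodule_of_closed)
  show "submodule K R (M\<lparr>carrier := N\<rparr>)" if "submodule K R M \<and> K \<subseteq> N"
    using submoduleD[of K R M] that by (auto intro!: N.submodule_of_closed)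
qed

lemma generated_submodule_is_submodule:
  assumes "S \<subseteq> carrier M"
  shows "submodule (generated_submodule R M S) R M"
proof (rule submodule_of_closed)
  show "generated_submodule R M S \<subseteq> carrier M"
    using assms carrier_submodule by (auto simp: generated_submodule_def)
qed (auto simp: generated_submodule_def dest: submoduleD)

lemma generated_submodule_superset: "S \<subseteq> generated_submodule R M S"
  by (auto simp: generated_submodule_def)

lemma generated_submodule_least: "submodule N R M \<Longrightarrow> S \<subseteq> N \<Longrightarrow> generated_submodule R M S \<subseteq> N"
  by (auto simp: generated_submodule_def)

end

subsection \<open>Quotients\<close>

locale module_quotient = left_module R M for R (structure) and M :: "('a, 'b, 'p) module_scheme" (structure) +
  fixes N assumes N: "submodule N R M"
begin

sublocale abelian_subgroup N M
  by (rule abelian_subgroupI3) (use N in \<open>auto simp: additive_subgroup_def submodule_def M.abelian_group_axioms\<close>)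

abbreviation (input) "Q \<equiv> quotient_module M N"

abbreviation (input) "coset x \<equiv> N +>\<^bsub>M\<^esub> x"

lemma carrier_quotient: "carrier Q = {coset x | x. x \<in> carrier M}"
  by (auto simp: quotient_module_def A_RCOSETS_def')

lemma coset_in_quotient: "x \<in> carrier M \<Longrightarrow> coset x \<in> carrier Q"
  by (auto simp: carrier_quotient)

lemma coset_eq_iff:
  assumes "x \<in> carrier M" "y \<in> carrier M"
  shows "coset x = coset y \<longleftrightarrow> x \<ominus>\<^bsub>M\<^esub> y \<in> N"
proof
  have "x \<in> coset y \<longleftrightarrow> x \<ominus>\<^bsub>M\<^esub> y \<in> N"
    using a_rcos_module[OF assms(2,1)] by (simp add: a_minus_def)
  then show "coset x = coset y \<Longrightarrow> x \<ominus>\<^bsub>M\<^esub> y \<in> N" "x \<ominus>\<^bsub>M\<^esub> y \<in> N \<Longrightarrow> coset x = coset y"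
    using a_rcos_self[OF assms(1)] a_repr_independence[OF _ assms(2) a_subgroup] by auto
qed

lemma coset_eq_zero_iff:
  assumes "x \<in> carrier M"
  shows "coset x = N \<longleftrightarrow> x \<in> N"
  using a_rcos_self[OF assms] M.a_coset_join2[OF assms a_subgroup] by auto

lemma coset_of_member: "x \<in> N \<Longrightarrow> coset x = N"
  using coset_eq_zero_iff[of x] submoduleD(1)[OF N] by blast

lemma zero_quotient: "\<zero>\<^bsub>Q\<^esub> = N"
  by (simp add: quotient_module_def)

lemma add_quotient: "x \<in> carrier M \<Longrightarrow> y \<in> carrier M \<Longrightarrow> coset x \<oplus>\<^bsub>Q\<^esub> coset y = coset (x \<oplus>\<^bsub>M\<^esub> y)"
  by (simp add: quotient_module_def a_rcos_sum)

text \<open>The cosets united in the definition of the quotient are all equal, since \<open>a\<close> maps the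
  difference of two elements of one coset into \<open>N\<close>.\<close>

lemma smult_quotient:
  assumes "a \<in> carrier R" "x \<in> carrier M"
  shows "a \<odot>\<^bsub>Q\<^esub> coset x = coset (a \<odot>\<^bsub>M\<^esub> x)"
proof -
  have "coset (a \<odot>\<^bsub>M\<^esub> y) = coset (a \<odot>\<^bsub>M\<^esub> x)" if "y \<in> coset x" for y
  proof -
    have y: "y \<in> carrier M"
      using that a_r_coset_subset_G[OF a_subset assms(2)] by blast
    then have "y \<ominus>\<^bsub>M\<^esub> x \<in> N"
      using a_rcos_module[OF assms(2) y] that by (simp add: a_minus_def)
    then have "a \<odot>\<^bsub>M\<^esub> (y \<ominus>\<^bsub>M\<^esub> x) \<in> N"
      using submoduleD(4)[OF N assms(1)] by blast
    moreover have "a \<odot>\<^bsub>M\<^esub> (y \<ominus>\<^bsub>M\<^esub> x) = a \<odot>\<^bsub>M\<^esub> y \<ominus>\<^bsub>M\<^esub> a \<odot>\<^bsub>M\<^esub> x"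
    proof -
      have "a \<odot>\<^bsub>M\<^esub> (y \<ominus>\<^bsub>M\<^esub> x) \<oplus>\<^bsub>M\<^esub> a \<odot>\<^bsub>M\<^esub> x = a \<odot>\<^bsub>M\<^esub> y"
        using assms y by (simp add: smult_r_distr[symmetric] M.a_assoc M.l_neg a_minus_def)
      then show ?thesis
        using assms y smult_closed by (metis M.add.inv_solve_right M.minus_closed a_minus_def)
    qed
    ultimately show ?thesis
      using coset_eq_iff y assms smult_closed by simp
  qed
  then have "(\<Union>y\<in>coset x. coset (a \<odot>\<^bsub>M\<^esub> y)) = (\<Union>y\<in>coset x. coset (a \<odot>\<^bsub>M\<^esub> x))"
    by (intro SUP_cong) simp_all
  moreover have "coset x \<noteq> {}"
    using a_rcos_self[OF assms(2)] by blast
  ultimately show ?thesis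
    by (simp add: quotient_module_def)
qed

lemma quotient_left_module: "left_module R Q"
proof -
  have "abelian_group Q"
  proof (rule abelian_groupI)
    show "\<zero>\<^bsub>Q\<^esub> \<in> carrier Q"
      using coset_eq_zero_iff[of "\<zero>\<^bsub>M\<^esub>"] zero_quotient coset_in_quotient[of "\<zero>\<^bsub>M\<^esub>"] by simp
  next
    fix X assume "X \<in> carrier Q"
    then obtain x where x: "x \<in> carrier M" "X = coset x" by (auto simp: carrier_quotient)
    have "coset \<zero>\<^bsub>M\<^esub> = \<zero>\<^bsub>Q\<^esub>"
      using coset_eq_zero_iff zero_quotient by simp
    then show "\<zero>\<^bsub>Q\<^esub> \<oplus>\<^bsub>Q\<^esub> X = X"
      using x add_quotient[of "\<zero>\<^bsub>M\<^esub>" x] by simp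
    have "coset (\<ominus>\<^bsub>M\<^esub> x) \<oplus>\<^bsub>Q\<^esub> X = \<zero>\<^bsub>Q\<^esub>"
      using x add_quotient[of "\<ominus>\<^bsub>M\<^esub> x" x] \<open>coset \<zero>\<^bsub>M\<^esub> = \<zero>\<^bsub>Q\<^esub>\<close> by (simp add: M.l_neg)
    then show "\<exists>Y\<in>carrier Q. Y \<oplus>\<^bsub>Q\<^esub> X = \<zero>\<^bsub>Q\<^esub>"
      using coset_in_quotient[of "\<ominus>\<^bsub>M\<^esub> x"] x(1) by blast
  qed (auto simp: carrier_quotient add_quotient M.a_ac)
  then show ?thesis
    unfolding left_module_def left_module_axioms_def
    using R.ring_axioms smult_closed
    by (auto simp: carrier_quotient add_quotient smult_quotient smult_l_distr smult_r_distr
        smult_assoc1 smult_one)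
qed

text \<open>Submodules of the quotient correspond to submodules of \<open>M\<close> that contain \<open>N\<close>.\<close>

lemma simple_quotient_iff: "simple_module R Q \<longleftrightarrow> maximal_submodule N R M"
proof
  interpret Q: left_module R Q by (rule quotient_left_module)
  note NM = submoduleD(1)[OF N]
  assume simp: "simple_module R Q"
  show "maximal_submodule N R M"
    unfolding maximal_submodule_def
  proof (intro conjI allI impI)
    show "submodule N R M" by (rule N)
    show "N \<noteq> carrier M"
    proof
      assume "N = carrier M"
      have "X = \<zero>\<^bsub>Q\<^esub>" if X: "X \<in> carrier Q" for X
      proof -
        obtain x where x: "x \<in> carrier M" "X = coset x"
          using X by (auto simp: carrier_quotient)
        have "x \<in> N"
          using x(1) \<open>N = carrier M\<close> by (rule back_subst[of "\<lambda>Z. x \<in> Z", OF _ sym])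
        then show ?thesis
          unfolding x(2) zero_quotient by (rule coset_of_member)
      qed
      then show False
        using simple_moduleD(2)[OF simp] Q.M.zero_closed by blast
    qed
    fix K assume K: "submodule K R M" "N \<subseteq> K"
    note KD = submoduleD[OF K(1)]
    have sub: "submodule {coset x | x. x \<in> K} R Q"
    proof (rule Q.submodule_of_closed)
      show "\<zero>\<^bsub>Q\<^esub> \<in> {coset x |x. x \<in> K}"
        using KD(2) coset_eq_zero_iff[of "\<zero>\<^bsub>M\<^esub>"] zero_quotient by (intro CollectI exI[of _ "\<zero>\<^bsub>M\<^esub>"]) simp
    next
      fix X Y assume "X \<in> {coset x |x. x \<in> K}" "Y \<in> {coset x |x. x \<in> K}"
      then show "X \<oplus>\<^bsub>Q\<^esub> Y \<in> {coset x |x. x \<in> K}"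
        using KD(1) KD(3) add_quotient by blast
    next
      fix a X assume "a \<in> carrier R" "X \<in> {coset x |x. x \<in> K}"
      then show "a \<odot>\<^bsub>Q\<^esub> X \<in> {coset x |x. x \<in> K}"
        using KD(1) KD(4) smult_quotient by blast
    qed (use KD(1) in \<open>auto simp: carrier_quotient\<close>)
    have "K = carrier M" if "K \<noteq> N"
    proof -
      obtain k where k: "k \<in> K" "k \<notin> N" using K(2) \<open>K \<noteq> N\<close> by blast
      then have "coset k \<noteq> \<zero>\<^bsub>Q\<^esub>"
        using coset_eq_zero_iff KD(1) zero_quotient by auto
      then have all: "{coset x | x. x \<in> K} = carrier Q"
        using simple_moduleD(3)[OF simp sub, of "coset k"] k(1) by blast
      show "K = carrier M"
      proof
        show "carrier M \<subseteq> K"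
        proof
          fix x assume x: "x \<in> carrier M"
          then obtain y where y: "y \<in> K" "coset x = coset y"
            using all coset_in_quotient[OF x] by auto
          then have "x \<ominus>\<^bsub>M\<^esub> y \<in> K"
            using coset_eq_iff x KD(1) K(2) by blast
          then have "(x \<ominus>\<^bsub>M\<^esub> y) \<oplus>\<^bsub>M\<^esub> y \<in> K"
            using KD(3) y(1) by blast
          moreover have "(x \<ominus>\<^bsub>M\<^esub> y) \<oplus>\<^bsub>M\<^esub> y = x"
            using x y(1) KD(1) by (auto simp: a_minus_def M.a_assoc M.l_neg subset_iff)
          ultimately show "x \<in> K" by simp
        qed
      qed (rule KD(1))
    qed
    then show "K = N \<or> K = carrier M" by blast
  qed
next
  interpret Q: left_module R Q by (rule quotient_left_module)
  assume max: "maximal_submodule N R M"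
  show "simple_module R Q"
    unfolding simple_module_def
  proof (intro conjI allI impI)
    show "left_module R Q" by (rule quotient_left_module)
    show "carrier Q \<noteq> {\<zero>\<^bsub>Q\<^esub>}"
    proof
      assume triv: "carrier Q = {\<zero>\<^bsub>Q\<^esub>}"
      have "carrier M \<subseteq> N"
      proof
        fix x assume "x \<in> carrier M"
        then show "x \<in> N"
          using coset_in_quotient[of x] triv coset_eq_zero_iff zero_quotient by simp
      qed
      then show False
        using max submoduleD(1)[OF N] by (auto simp: maximal_submodule_def)
    qed
    fix \<K> assume "submodule \<K> R Q"
    note KD = submoduleD[OF this]
    define K where "K = {x \<in> carrier M. coset x \<in> \<K>}"
    have "submodule K R M"
    proof (rule submodule_of_closed)
      show "\<zero>\<^bsub>M\<^esub> \<in> K"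
        using KD(2) coset_eq_zero_iff[of "\<zero>\<^bsub>M\<^esub>"] zero_quotient by (simp add: K_def)
    next
      fix x y assume "x \<in> K" "y \<in> K"
      then show "x \<oplus>\<^bsub>M\<^esub> y \<in> K"
        using KD(3)[of "coset x" "coset y"] by (simp add: K_def add_quotient)
    next
      fix a x assume "a \<in> carrier R" "x \<in> K"
      then show "a \<odot>\<^bsub>M\<^esub> x \<in> K"
        using KD(4)[of a "coset x"] by (simp add: K_def smult_quotient smult_closed)
    qed (auto simp: K_def)
    moreover have "N \<subseteq> K"
      using submoduleD(1)[OF N] KD(2) zero_quotient by (auto simp: K_def coset_of_member)
    ultimately have "K = N \<or> K = carrier M"
      using max by (simp add: maximal_submodule_def)
    moreover have \<K>: "\<K> = {coset x | x. x \<in> K}"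
      using KD(1) by (auto simp: K_def carrier_quotient)
    moreover have "{coset x | x. x \<in> N} = {\<zero>\<^bsub>Q\<^esub>}"
      using submoduleD(2)[OF N] by (auto simp: coset_of_member zero_quotient intro!: exI[of _ "\<zero>\<^bsub>M\<^esub>"])
    ultimately show "\<K> = {\<zero>\<^bsub>Q\<^esub>} \<or> \<K> = carrier Q"
      using carrier_quotient by auto
  qed
qed

end

text \<open>With this, a composition factor can be studied inside the ambient module, without cosets.\<close>

lemma (in left_module) simple_subquotient_iff:
  assumes "submodule N R M" "submodule N' R M" "N \<subseteq> N'"
  shows "simple_module R (quotient_module (M\<lparr>carrier := N'\<rparr>) N) \<longleftrightarrow>
    N \<noteq> N' \<and> (\<forall>K. submodule K R M \<longrightarrow> N \<subseteq> K \<longrightarrow> K \<subseteq> N' \<longrightarrow> K = N \<or> K = N')"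
proof -
  interpret N': left_module R "M\<lparr>carrier := N'\<rparr>"
    by (rule restrict_left_module[OF assms(2)])
  interpret module_quotient R "M\<lparr>carrier := N'\<rparr>" N
    unfolding module_quotient_def module_quotient_axioms_def
    using submodule_of_restrict_iff[OF assms(2)] assms N'.left_module_axioms by simp
  show ?thesis
    unfolding simple_quotient_iff maximal_submodule_def
    by (auto simp: submodule_of_restrict_iff[OF assms(2)] assms)
qed

subsection \<open>Isomorphisms\<close>

lemma module_iso_sym:
  assumes "left_module R M" "module_iso R M N"
  shows "module_iso R N M"
proof -
  interpret left_module R M by fact
  obtain f where f: "bij_betw f (carrier M) (carrier N)"
      "\<And>x y. x \<in> carrier M \<Longrightarrow> y \<in> carrier M \<Longrightarrow> f (x \<oplus>\<^bsub>M\<^esub> y) = f x \<oplus>\<^bsub>N\<^esub> f y"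
      "\<And>a x. a \<in> carrier R \<Longrightarrow> x \<in> carrier M \<Longrightarrow> f (a \<odot>\<^bsub>M\<^esub> x) = a \<odot>\<^bsub>N\<^esub> f x"
    using assms(2) by (auto simp: module_iso_def)
  let ?g = "inv_into (carrier M) f"
  have g: "bij_betw ?g (carrier N) (carrier M)" "\<And>y. y \<in> carrier N \<Longrightarrow> f (?g y) = y"
      "\<And>x. x \<in> carrier M \<Longrightarrow> ?g (f x) = x"
    using f(1) bij_betw_inv_into bij_betw_inv_into_right bij_betw_inv_into_left by metis+
  have gM: "\<And>y. y \<in> carrier N \<Longrightarrow> ?g y \<in> carrier M"
    using g(1) by (auto simp: bij_betw_def)
  show ?thesis
    unfolding module_iso_def
  proof (intro exI conjI ballI)
    show "bij_betw ?g (carrier N) (carrier M)" by (rule g(1))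
    fix x y assume "x \<in> carrier N" "y \<in> carrier N"
    then show "?g (x \<oplus>\<^bsub>N\<^esub> y) = ?g x \<oplus>\<^bsub>M\<^esub> ?g y"
      using f(2)[of "?g x" "?g y"] g gM by (metis M.a_closed)
  next
    fix a x assume "a \<in> carrier R" "x \<in> carrier N"
    then show "?g (a \<odot>\<^bsub>N\<^esub> x) = a \<odot>\<^bsub>M\<^esub> ?g x"
      using f(3)[of a "?g x"] g gM by (metis smult_closed)
  qed
qed

lemma module_isoE:
  assumes "module_iso R M N" "left_module R M" "left_module R N"
  obtains f where "bij_betw f (carrier M) (carrier N)" "f \<zero>\<^bsub>M\<^esub> = \<zero>\<^bsub>N\<^esub>"
    "\<And>x. x \<in> carrier M \<Longrightarrow> f x \<in> carrier N"
    "\<And>x. x \<in> carrier M \<Longrightarrow> f x = \<zero>\<^bsub>N\<^esub> \<longleftrightarrow> x = \<zero>\<^bsub>M\<^esub>"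
    "\<And>x y. x \<in> carrier M \<Longrightarrow> y \<in> carrier M \<Longrightarrow> f (x \<oplus>\<^bsub>M\<^esub> y) = f x \<oplus>\<^bsub>N\<^esub> f y"
    "\<And>a x. a \<in> carrier R \<Longrightarrow> x \<in> carrier M \<Longrightarrow> f (a \<odot>\<^bsub>M\<^esub> x) = a \<odot>\<^bsub>N\<^esub> f x"
proof -
  interpret M: left_module R M by fact
  interpret N: left_module R N by fact
  obtain f where f: "bij_betw f (carrier M) (carrier N)"
      "\<And>x y. x \<in> carrier M \<Longrightarrow> y \<in> carrier M \<Longrightarrow> f (x \<oplus>\<^bsub>M\<^esub> y) = f x \<oplus>\<^bsub>N\<^esub> f y"
      "\<And>a x. a \<in> carrier R \<Longrightarrow> x \<in> carrier M \<Longrightarrow> f (a \<odot>\<^bsub>M\<^esub> x) = a \<odot>\<^bsub>N\<^esub> f x"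
    using assms(1) by (auto simp: module_iso_def)
  have fc: "\<And>x. x \<in> carrier M \<Longrightarrow> f x \<in> carrier N"
    using f(1) by (auto simp: bij_betw_def)
  have f0: "f \<zero>\<^bsub>M\<^esub> = \<zero>\<^bsub>N\<^esub>"
    using f(3)[of "\<zero>\<^bsub>R\<^esub>" "\<zero>\<^bsub>M\<^esub>"] fc M.zero_smult N.zero_smult by simp
  moreover have "f x = \<zero>\<^bsub>N\<^esub> \<longleftrightarrow> x = \<zero>\<^bsub>M\<^esub>" if "x \<in> carrier M" for x
    using f0 f(1) that bij_betw_imp_inj_on[OF f(1)] by (metis M.M.zero_closed inj_on_def)
  ultimately show thesis
    using that f fc by blast
qed

lemma simple_module_iso:
  assumes "module_iso R M N" "left_module R N" "simple_module R M"
  shows "simple_module R N"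
proof -
  interpret M: left_module R M using simple_moduleD(1)[OF assms(3)] .
  interpret N: left_module R N by fact
  obtain f where f: "bij_betw f (carrier M) (carrier N)" "f \<zero>\<^bsub>M\<^esub> = \<zero>\<^bsub>N\<^esub>"
    "\<And>x. x \<in> carrier M \<Longrightarrow> f x \<in> carrier N"
    "\<And>x. x \<in> carrier M \<Longrightarrow> f x = \<zero>\<^bsub>N\<^esub> \<longleftrightarrow> x = \<zero>\<^bsub>M\<^esub>"
    "\<And>x y. x \<in> carrier M \<Longrightarrow> y \<in> carrier M \<Longrightarrow> f (x \<oplus>\<^bsub>M\<^esub> y) = f x \<oplus>\<^bsub>N\<^esub> f y"
    "\<And>a x. a \<in> carrier R \<Longrightarrow> x \<in> carrier M \<Longrightarrow> f (a \<odot>\<^bsub>M\<^esub> x) = a \<odot>\<^bsub>N\<^esub> f x"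
    using module_isoE[OF assms(1) M.left_module_axioms N.left_module_axioms] by blast
  have img: "f ` carrier M = carrier N"
    using f(1) by (simp add: bij_betw_def)
  show ?thesis
    unfolding simple_module_def
  proof (intro conjI allI impI)
    show "left_module R N" by fact
    show "carrier N \<noteq> {\<zero>\<^bsub>N\<^esub>}"
      using simple_moduleD(2)[OF assms(3)] img f(4) M.M.zero_closed by blast
    fix K assume "submodule K R N"
    note K = submoduleD[OF this]
    define L where "L = {x \<in> carrier M. f x \<in> K}"
    have "submodule L R M"
      using K f(2,3,5,6) unfolding L_def
      by (intro M.submodule_of_closed) (auto intro: M.smult_closed)
    then have "L = {\<zero>\<^bsub>M\<^esub>} \<or> L = carrier M"
      using assms(3) by (simp add: simple_module_def)
    moreover have "K = f ` L"
      using K(1) img by (auto simp: L_def)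
    ultimately show "K = {\<zero>\<^bsub>N\<^esub>} \<or> K = carrier N"
      using img f(2) by auto
  qed
qed

section \<open>Idempotents whose corner algebra consists of scalars\<close>

text \<open>The ring records have no field for complex scalars; \<open>sc\<close> is the structure map of a complex
  algebra, with image in the centre.\<close>

locale complex_algebra = ring R for R (structure) +
  fixes sc :: "complex \<Rightarrow> 'a"
  assumes sc_closed [simp, intro]: "sc c \<in> carrier R"
    and sc_zero: "sc 0 = \<zero>"
    and sc_one: "sc 1 = \<one>"
    and sc_mult: "sc (c * d) = sc c \<otimes> sc d"
    and sc_central: "a \<in> carrier R \<Longrightarrow> sc c \<otimes> a = a \<otimes> sc c"

definition acts_nontrivially :: "'a \<Rightarrow> ('a, 'b, 'p) module_scheme \<Rightarrow> bool" where
  "acts_nontrivially a M \<longleftrightarrow> (\<exists>x\<in>carrier M. a \<odot>\<^bsub>M\<^esub> x \<noteq> \<zero>\<^bsub>M\<^esub>)"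

lemma acts_nontrivially_iso:
  assumes "module_iso R M N" "left_module R M" "left_module R N" "a \<in> carrier R"
    and "acts_nontrivially a M"
  shows "acts_nontrivially a N"
proof -
  interpret M: left_module R M by fact
  obtain f where "bij_betw f (carrier M) (carrier N)" "f \<zero>\<^bsub>M\<^esub> = \<zero>\<^bsub>N\<^esub>"
    and f: "\<And>x. x \<in> carrier M \<Longrightarrow> f x \<in> carrier N"
      "\<And>x. x \<in> carrier M \<Longrightarrow> f x = \<zero>\<^bsub>N\<^esub> \<longleftrightarrow> x = \<zero>\<^bsub>M\<^esub>"
    and "\<And>x y. x \<in> carrier M \<Longrightarrow> y \<in> carrier M \<Longrightarrow> f (x \<oplus>\<^bsub>M\<^esub> y) = f x \<oplus>\<^bsub>N\<^esub> f y"
    and f3: "\<And>a x. a \<in> carrier R \<Longrightarrow> x \<in> carrier M \<Longrightarrow> f (a \<odot>\<^bsub>M\<^esub> x) = a \<odot>\<^bsub>N\<^esub> f x"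
    using module_isoE[OF assms(1-3)] by blast
  obtain x where x: "x \<in> carrier M" "a \<odot>\<^bsub>M\<^esub> x \<noteq> \<zero>\<^bsub>M\<^esub>"
    using assms(5) by (auto simp: acts_nontrivially_def)
  then have "a \<odot>\<^bsub>N\<^esub> f x \<noteq> \<zero>\<^bsub>N\<^esub>"
    using f(2)[of "a \<odot>\<^bsub>M\<^esub> x"] f3[OF assms(4) x(1)] M.smult_closed[OF assms(4) x(1)] by simp
  then show ?thesis
    using f(1)[OF x(1)] by (auto simp: acts_nontrivially_def)
qed

lemma (in module_quotient) acts_nontrivially_quotient:
  assumes "a \<in> carrier R" "x \<in> carrier M" "a \<odot>\<^bsub>M\<^esub> x \<notin> N"
  shows "acts_nontrivially a (quotient_module M N)"
proof -
  have "a \<odot>\<^bsub>Q\<^esub> coset x \<noteq> \<zero>\<^bsub>Q\<^esub>"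
    unfolding smult_quotient[OF assms(1,2)] zero_quotient
    using coset_eq_zero_iff smult_closed assms by blast
  then show ?thesis
    unfolding acts_nontrivially_def using coset_in_quotient[OF assms(2)] by blast
qed

text \<open>The corner \<open>eRe\<close> is an algebra with unit \<open>e\<close>; here it is as small as possible, the line
  \<open>\<complex>e\<close>.\<close>

locale scalar_corner = complex_algebra +
  fixes e
  assumes e_closed [simp, intro]: "e \<in> carrier R"
    and e_idem: "e \<otimes> e = e"
    and e_nonzero: "e \<noteq> \<zero>"
    and corner: "a \<in> carrier R \<Longrightarrow> \<exists>c. e \<otimes> a \<otimes> e = sc c \<otimes> e"
begin

lemma corner_invertible:
  assumes "a \<in> carrier R" "e \<otimes> a \<otimes> e \<noteq> \<zero>"
  obtains d where "sc d \<otimes> (e \<otimes> a \<otimes> e) = e"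
proof -
  obtain c where c: "e \<otimes> a \<otimes> e = sc c \<otimes> e"
    using corner[OF assms(1)] by blast
  have "c \<noteq> 0"
    using assms(2) c sc_zero by auto
  then have "sc (inverse c) \<otimes> sc c = \<one>"
    by (simp add: sc_mult[symmetric] sc_one)
  then have "sc (inverse c) \<otimes> (e \<otimes> a \<otimes> e) = e"
    unfolding c by (simp add: m_assoc[symmetric])
  then show thesis by (rule that)
qed

text \<open>The right-hand side does not mention the module \<open>X\<close>. If \<open>e b a e\<close> is a nonzero multiple of
  \<open>e\<close>, then it moves \<open>x\<close> to a nonzero multiple of \<open>x\<close>, so \<open>a\<close> cannot kill \<open>x\<close>. Conversely, if \<open>a x\<close> is
  not zero, then it generates \<open>X\<close>, and some \<open>b\<close> brings it back to \<open>x\<close>.\<close>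

lemma annihilator_of_fixed_vector:
  assumes X: "simple_module R X" and x: "x \<in> carrier X" "e \<odot>\<^bsub>X\<^esub> x = x" "x \<noteq> \<zero>\<^bsub>X\<^esub>"
    and a: "a \<in> carrier R"
  shows "a \<odot>\<^bsub>X\<^esub> x = \<zero>\<^bsub>X\<^esub> \<longleftrightarrow> (\<forall>b\<in>carrier R. e \<otimes> (b \<otimes> a) \<otimes> e = \<zero>)"
proof -
  interpret X: left_module R X using simple_moduleD(1)[OF X] .
  have key: "(e \<otimes> (b \<otimes> a) \<otimes> e) \<odot>\<^bsub>X\<^esub> x = e \<odot>\<^bsub>X\<^esub> (b \<odot>\<^bsub>X\<^esub> (a \<odot>\<^bsub>X\<^esub> x))" if "b \<in> carrier R" for b
    using that a x by (simp add: X.smult_assoc1 X.smult_closed)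
  show ?thesis
  proof
    assume ax: "a \<odot>\<^bsub>X\<^esub> x = \<zero>\<^bsub>X\<^esub>"
    show "\<forall>b\<in>carrier R. e \<otimes> (b \<otimes> a) \<otimes> e = \<zero>"
    proof (rule ballI, rule ccontr)
      fix b assume b: "b \<in> carrier R" and nz: "e \<otimes> (b \<otimes> a) \<otimes> e \<noteq> \<zero>"
      then obtain d where d: "sc d \<otimes> (e \<otimes> (b \<otimes> a) \<otimes> e) = e"
        using corner_invertible[of "b \<otimes> a"] a by blast
      have "x = (sc d \<otimes> (e \<otimes> (b \<otimes> a) \<otimes> e)) \<odot>\<^bsub>X\<^esub> x"
        using d x by simp
      also have "\<dots> = sc d \<odot>\<^bsub>X\<^esub> (e \<odot>\<^bsub>X\<^esub> (b \<odot>\<^bsub>X\<^esub> (a \<odot>\<^bsub>X\<^esub> x)))"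
        using b a x(1) key[OF b] X.smult_assoc1[of "sc d" "e \<otimes> (b \<otimes> a) \<otimes> e" x] by simp
      also have "\<dots> = \<zero>\<^bsub>X\<^esub>"
        using ax b by (simp add: X.smult_zero)
      finally show False using x(3) by simp
    qed
  next
    assume *: "\<forall>b\<in>carrier R. e \<otimes> (b \<otimes> a) \<otimes> e = \<zero>"
    show "a \<odot>\<^bsub>X\<^esub> x = \<zero>\<^bsub>X\<^esub>"
    proof (rule ccontr)
      let ?y = "a \<odot>\<^bsub>X\<^esub> x"
      assume nz: "?y \<noteq> \<zero>\<^bsub>X\<^esub>"
      have y: "?y \<in> carrier X" using a x by (simp add: X.smult_closed)
      have "?y \<in> {b \<odot>\<^bsub>X\<^esub> ?y | b. b \<in> carrier R}"
        using X.smult_one[OF y] by force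
      then have "{b \<odot>\<^bsub>X\<^esub> ?y | b. b \<in> carrier R} = carrier X"
        using simple_moduleD(3)[OF X X.cyclic_submodule[OF y] _ nz] by blast
      then obtain b where b: "b \<in> carrier R" "x = b \<odot>\<^bsub>X\<^esub> ?y"
        using x(1) by blast
      have "(e \<otimes> (b \<otimes> a) \<otimes> e) \<odot>\<^bsub>X\<^esub> x = x"
        using key[OF b(1)] b(2) x(2) by simp
      moreover have "(e \<otimes> (b \<otimes> a) \<otimes> e) \<odot>\<^bsub>X\<^esub> x = \<zero>\<^bsub>X\<^esub>"
        using * b(1) X.zero_smult[OF x(1)] by simp
      ultimately show False using x(3) by simp
    qed
  qed
qed

lemma fixed_vector_exists:
  assumes "left_module R X" "acts_nontrivially e X"
  obtains x where "x \<in> carrier X" "e \<odot>\<^bsub>X\<^esub> x = x" "x \<noteq> \<zero>\<^bsub>X\<^esub>"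
proof -
  interpret X: left_module R X by fact
  obtain x where "x \<in> carrier X" "e \<odot>\<^bsub>X\<^esub> x \<noteq> \<zero>\<^bsub>X\<^esub>"
    using assms(2) by (auto simp: acts_nontrivially_def)
  then show thesis
    using that[of "e \<odot>\<^bsub>X\<^esub> x"] X.smult_closed X.smult_assoc1[of e e x] by (simp add: e_idem)
qed

lemma simple_module_generated_by:
  assumes X: "simple_module R X" and x: "x \<in> carrier X" "x \<noteq> \<zero>\<^bsub>X\<^esub>"
  shows "carrier X = {a \<odot>\<^bsub>X\<^esub> x | a. a \<in> carrier R}"
proof -
  interpret X: left_module R X using simple_moduleD(1)[OF X] .
  have "x \<in> {a \<odot>\<^bsub>X\<^esub> x | a. a \<in> carrier R}"
    using X.smult_one[OF x(1)] by force
  then show ?thesis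
    using simple_moduleD(3)[OF X X.cyclic_submodule[OF x(1)] _ x(2)] by blast
qed

text \<open>Both modules are quotients of the ring by the annihilator of a vector fixed by \<open>e\<close>, and these
  annihilators agree.\<close>

theorem simple_modules_iso:
  assumes X: "simple_module R X" "acts_nontrivially e X"
    and Y: "simple_module R Y" "acts_nontrivially e Y"
  shows "module_iso R X Y"
proof -
  interpret X: left_module R X using simple_moduleD(1)[OF X(1)] .
  interpret Y: left_module R Y using simple_moduleD(1)[OF Y(1)] .
  obtain x where x: "x \<in> carrier X" "e \<odot>\<^bsub>X\<^esub> x = x" "x \<noteq> \<zero>\<^bsub>X\<^esub>"
    using fixed_vector_exists[OF simple_moduleD(1)[OF X(1)] X(2)] by blast
  obtain y where y: "y \<in> carrier Y" "e \<odot>\<^bsub>Y\<^esub> y = y" "y \<noteq> \<zero>\<^bsub>Y\<^esub>"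
    using fixed_vector_exists[OF simple_moduleD(1)[OF Y(1)] Y(2)] by blast
  have gx: "carrier X = {a \<odot>\<^bsub>X\<^esub> x | a. a \<in> carrier R}"
    by (rule simple_module_generated_by[OF X(1) x(1,3)])
  have gy: "carrier Y = {a \<odot>\<^bsub>Y\<^esub> y | a. a \<in> carrier R}"
    by (rule simple_module_generated_by[OF Y(1) y(1,3)])
  have eq_iff_ann: "a \<odot>\<^bsub>M\<^esub> z = b \<odot>\<^bsub>M\<^esub> z \<longleftrightarrow> (a \<ominus> b) \<odot>\<^bsub>M\<^esub> z = \<zero>\<^bsub>M\<^esub>"
    if M: "left_module R M" and ab: "a \<in> carrier R" "b \<in> carrier R" and z: "z \<in> carrier M"
    for M :: "('a, 'z, 'q) module_scheme" and a b z
  proof -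
    interpret M: left_module R M by fact
    have key: "a \<odot>\<^bsub>M\<^esub> z = (a \<ominus> b) \<odot>\<^bsub>M\<^esub> z \<oplus>\<^bsub>M\<^esub> b \<odot>\<^bsub>M\<^esub> z"
      using ab z by (simp add: M.smult_l_distr[symmetric] a_minus_def a_assoc l_neg)
    have "(a \<ominus> b) \<odot>\<^bsub>M\<^esub> z \<in> carrier M" "b \<odot>\<^bsub>M\<^esub> z \<in> carrier M"
      using ab z by (simp_all add: M.smult_closed)
    then show ?thesis
      unfolding key by simp
  qed
  have wd: "a \<odot>\<^bsub>X\<^esub> x = b \<odot>\<^bsub>X\<^esub> x \<longleftrightarrow> a \<odot>\<^bsub>Y\<^esub> y = b \<odot>\<^bsub>Y\<^esub> y" if "a \<in> carrier R" "b \<in> carrier R" for a b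
    unfolding eq_iff_ann[OF X.left_module_axioms that x(1)] eq_iff_ann[OF Y.left_module_axioms that y(1)]
    using annihilator_of_fixed_vector[OF X(1) x] annihilator_of_fixed_vector[OF Y(1) y] that by simp
  define f where "f z = (SOME a. a \<in> carrier R \<and> a \<odot>\<^bsub>X\<^esub> x = z) \<odot>\<^bsub>Y\<^esub> y" for z
  have f: "f (a \<odot>\<^bsub>X\<^esub> x) = a \<odot>\<^bsub>Y\<^esub> y" if a: "a \<in> carrier R" for a
  proof -
    let ?b = "SOME b. b \<in> carrier R \<and> b \<odot>\<^bsub>X\<^esub> x = a \<odot>\<^bsub>X\<^esub> x"
    have b: "?b \<in> carrier R \<and> ?b \<odot>\<^bsub>X\<^esub> x = a \<odot>\<^bsub>X\<^esub> x"
      by (rule someI[of _ a]) (simp add: a)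
    show ?thesis
      unfolding f_def using wd[of ?b a] b a by blast
  qed
  show ?thesis
    unfolding module_iso_def
  proof (intro exI conjI ballI)
    show "bij_betw f (carrier X) (carrier Y)"
      unfolding bij_betw_def inj_on_def gx gy
      using f wd by (auto simp: image_iff) (metis f)
  next
    fix z w assume "z \<in> carrier X" "w \<in> carrier X"
    then obtain a b where ab: "a \<in> carrier R" "b \<in> carrier R" "z = a \<odot>\<^bsub>X\<^esub> x" "w = b \<odot>\<^bsub>X\<^esub> x"
      unfolding gx by blast
    then show "f (z \<oplus>\<^bsub>X\<^esub> w) = f z \<oplus>\<^bsub>Y\<^esub> f w"
      using x(1) y(1) f[of a] f[of b] f[of "a \<oplus> b"] by (simp add: X.smult_l_distr Y.smult_l_distr)
  next
    fix a z assume a: "a \<in> carrier R" and "z \<in> carrier X"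
    then obtain b where b: "b \<in> carrier R" "z = b \<odot>\<^bsub>X\<^esub> x"
      unfolding gx by blast
    then show "f (a \<odot>\<^bsub>X\<^esub> z) = a \<odot>\<^bsub>Y\<^esub> f z"
      using a x(1) y(1) f[of b] f[of "a \<otimes> b"] by (simp add: X.smult_assoc1 Y.smult_assoc1)
  qed
qed

end

subsection \<open>The simple top of a left ideal generated by such an idempotent\<close>

lemma left_ideal_module_simps:
  "carrier (left_ideal_module R e) = {a \<otimes>\<^bsub>R\<^esub> e | a. a \<in> carrier R}"
  "\<zero>\<^bsub>left_ideal_module R e\<^esub> = \<zero>\<^bsub>R\<^esub>"
  "x \<oplus>\<^bsub>left_ideal_module R e\<^esub> y = x \<oplus>\<^bsub>R\<^esub> y"
  "a \<odot>\<^bsub>left_ideal_module R e\<^esub> x = a \<otimes>\<^bsub>R\<^esub> x"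
  by (simp_all add: left_ideal_module_def)

context ring
begin

lemma left_ideal_module_left_module:
  assumes e: "e \<in> carrier R"
  shows "left_module R (left_ideal_module R e)"
proof -
  let ?P = "left_ideal_module R e"
  have add: "a \<otimes> e \<oplus> b \<otimes> e = (a \<oplus> b) \<otimes> e" if "a \<in> carrier R" "b \<in> carrier R" for a b
    using that e by (simp add: l_distr)
  have "abelian_group ?P"
  proof (rule abelian_groupI)
    show "\<zero>\<^bsub>?P\<^esub> \<in> carrier ?P"
      unfolding left_ideal_module_simps using e by (intro CollectI exI[of _ \<zero>]) simp
  next
    fix x y assume "x \<in> carrier ?P" "y \<in> carrier ?P"
    then obtain a b where "a \<in> carrier R" "b \<in> carrier R" "x = a \<otimes> e" "y = b \<otimes> e"
      unfolding left_ideal_module_simps by blast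
    then show "x \<oplus>\<^bsub>?P\<^esub> y \<in> carrier ?P"
      unfolding left_ideal_module_simps using add by (intro CollectI exI[of _ "a \<oplus> b"]) simp
  next
    fix x assume "x \<in> carrier ?P"
    then obtain a where a: "a \<in> carrier R" "x = a \<otimes> e"
      unfolding left_ideal_module_simps by blast
    have "(\<ominus> a) \<otimes> e \<in> carrier ?P"
      unfolding left_ideal_module_simps using a by blast
    moreover have "(\<ominus> a) \<otimes> e \<oplus> x = \<zero>"
      using a e add[of "\<ominus> a" a] by (simp add: l_neg)
    ultimately show "\<exists>y\<in>carrier ?P. y \<oplus>\<^bsub>?P\<^esub> x = \<zero>\<^bsub>?P\<^esub>"
      unfolding left_ideal_module_simps(2,3) by blast
  qed (use e in \<open>auto simp: left_ideal_module_simps a_ac\<close>)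
  moreover have "a \<otimes> x \<in> carrier ?P" if a: "a \<in> carrier R" and x: "x \<in> carrier ?P" for a x
  proof -
    obtain b where "b \<in> carrier R" "x = b \<otimes> e"
      using x unfolding left_ideal_module_simps by blast
    then show ?thesis
      unfolding left_ideal_module_simps using a e by (intro CollectI exI[of _ "a \<otimes> b"]) (simp add: m_assoc)
  qed
  ultimately show ?thesis
    unfolding left_module_def left_module_axioms_def using ring_axioms e
    by (auto simp: left_ideal_module_simps l_distr r_distr m_assoc)
qed

lemma left_ideal_module_subset: "e \<in> carrier R \<Longrightarrow> carrier (left_ideal_module R e) \<subseteq> carrier R"
  by (auto simp: left_ideal_module_simps)

lemma idempotent_in_left_ideal_module:
  assumes "e \<in> carrier R" "e \<otimes> e = e"
  shows "e \<in> carrier (left_ideal_module R e)"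
    and "x \<in> carrier (left_ideal_module R e) \<Longrightarrow> x \<otimes> e = x"
  using assms by (force simp: left_ideal_module_simps, auto simp: left_ideal_module_simps m_assoc)

end

context scalar_corner
begin

abbreviation (input) "P \<equiv> left_ideal_module R e"

sublocale P: left_module R P
  by (rule left_ideal_module_left_module) simp

text \<open>A submodule containing some \<open>a\<close> with \<open>e b a e \<noteq> 0\<close> contains a nonzero multiple of \<open>e\<close>, hence
  everything. So the elements without such a \<open>b\<close> form the largest proper submodule.\<close>

lemma unique_maximal_submodule:
  shows "maximal_submodule {a \<in> carrier P. \<forall>b\<in>carrier R. e \<otimes> (b \<otimes> a) \<otimes> e = \<zero>} R P" (is "maximal_submodule ?K R P")
    and "maximal_submodule N R P \<Longrightarrow> N = {a \<in> carrier P. \<forall>b\<in>carrier R. e \<otimes> (b \<otimes> a) \<otimes> e = \<zero>}"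
    and "e \<notin> {a \<in> carrier P. \<forall>b\<in>carrier R. e \<otimes> (b \<otimes> a) \<otimes> e = \<zero>}"
proof -
  note eP = idempotent_in_left_ideal_module(1)[OF e_closed e_idem]
    and Pe = idempotent_in_left_ideal_module(2)[OF e_closed e_idem]
  note PR = subsetD[OF left_ideal_module_subset[OF e_closed]]
  have K: "submodule ?K R P"
  proof (rule P.submodule_of_closed)
    show "\<zero>\<^bsub>P\<^esub> \<in> ?K"
      using P.M.zero_closed by (simp add: left_ideal_module_simps(2))
  next
    fix x y assume x: "x \<in> ?K" and y: "y \<in> ?K"
    have "x \<oplus> y \<in> carrier P"
      using P.M.a_closed[of x y] x y by (simp add: left_ideal_module_simps(3))
    moreover have "e \<otimes> (b \<otimes> (x \<oplus> y)) \<otimes> e = e \<otimes> (b \<otimes> x) \<otimes> e \<oplus> e \<otimes> (b \<otimes> y) \<otimes> e" if "b \<in> carrier R" for b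
      using that x y PR by (simp add: l_distr r_distr)
    ultimately show "x \<oplus>\<^bsub>P\<^esub> y \<in> ?K"
      using x y by (simp add: left_ideal_module_simps(3))
  next
    fix a x assume a: "a \<in> carrier R" and x: "x \<in> ?K"
    have "a \<otimes> x \<in> carrier P"
      using P.smult_closed[of a x] a x by (simp add: left_ideal_module_simps(4))
    moreover have "e \<otimes> (b \<otimes> (a \<otimes> x)) \<otimes> e = \<zero>" if "b \<in> carrier R" for b
    proof -
      have "b \<otimes> (a \<otimes> x) = (b \<otimes> a) \<otimes> x"
        using that a x PR by (simp add: m_assoc)
      then show ?thesis using x a that by simp
    qed
    ultimately show "a \<odot>\<^bsub>P\<^esub> x \<in> ?K"
      by (simp add: left_ideal_module_simps(4))
  qed auto
  show eK: "e \<notin> ?K"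
    using e_nonzero by (auto simp: e_idem intro!: bexI[of _ \<one>])
  have sub: "N \<subseteq> ?K" if N: "submodule N R P" "N \<noteq> carrier P" for N
  proof (rule ccontr)
    note ND = submoduleD[OF N(1)]
    assume "\<not> N \<subseteq> ?K"
    then obtain a b where a: "a \<in> N" and b: "b \<in> carrier R" and nz: "e \<otimes> (b \<otimes> a) \<otimes> e \<noteq> \<zero>"
      using ND(1) by blast
    have aR: "a \<in> carrier R" "a \<otimes> e = a" using a ND(1) PR Pe by auto
    obtain d where d: "sc d \<otimes> (e \<otimes> (b \<otimes> a) \<otimes> e) = e"
      using corner_invertible[of "b \<otimes> a"] b aR nz by blast
    have "sc d \<otimes> (e \<otimes> (b \<otimes> a) \<otimes> e) = (sc d \<otimes> (e \<otimes> b)) \<otimes> a"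
      using aR b by (simp add: m_assoc)
    then have "e = (sc d \<otimes> (e \<otimes> b)) \<odot>\<^bsub>P\<^esub> a"
      using d by (simp add: left_ideal_module_simps(4))
    then have eN: "e \<in> N"
      using ND(4)[OF _ a, of "sc d \<otimes> (e \<otimes> b)"] b by simp
    have "carrier P \<subseteq> N"
    proof
      fix x assume "x \<in> carrier P"
      then obtain c where "c \<in> carrier R" "x = c \<odot>\<^bsub>P\<^esub> e"
        unfolding left_ideal_module_simps by blast
      then show "x \<in> N" using ND(4) eN by simp
    qed
    then show False using N(2) ND(1) by blast
  qed
  have proper: "?K \<noteq> carrier P"
    using eK eP by blast
  show "maximal_submodule ?K R P"
    unfolding maximal_submodule_def using K proper sub by blast
  show "N = ?K" if "maximal_submodule N R P"
    using that K proper sub[of N] unfolding maximal_submodule_def by blast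
qed

text \<open>The radical, as the intersection of the maximal submodules, is the unique one of them. It does
  not contain \<open>e\<close>, so the class of \<open>e\<close> is a nonzero vector fixed by \<open>e\<close>.\<close>

theorem simple_top:
  defines "S \<equiv> quotient_module P (module_radical R P)"
  shows "simple_module R S" "acts_nontrivially e S"
proof -
  let ?K = "{a \<in> carrier P. \<forall>b\<in>carrier R. e \<otimes> (b \<otimes> a) \<otimes> e = \<zero>}"
  have "{N. maximal_submodule N R P} = {?K}"
    using unique_maximal_submodule(1,2) by blast
  then have rad: "module_radical R P = ?K"
    unfolding module_radical_def by auto
  have "submodule ?K R P"
    using unique_maximal_submodule(1) unfolding maximal_submodule_def by (rule conjunct1)
  then interpret module_quotient R P "?K"
    by (intro module_quotient.intro module_quotient_axioms.intro P.left_module_axioms)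
  show "simple_module R S"
    unfolding S_def rad simple_quotient_iff by (rule unique_maximal_submodule(1))
  note eP = idempotent_in_left_ideal_module(1)[OF e_closed e_idem]
  have "e \<odot>\<^bsub>P\<^esub> e \<notin> ?K"
    unfolding left_ideal_module_simps(4) e_idem by (rule unique_maximal_submodule(3))
  from acts_nontrivially_quotient[OF e_closed eP this]
  show "acts_nontrivially e S"
    unfolding S_def rad .
qed

end

section \<open>Multiplicities as dimensions\<close>

text \<open>Modules realised as spaces of complex functions with pointwise operations: there the notion of
  dimension from the vector space of all functions applies, and no choice of a basis is
  needed.\<close>

locale function_module = complex_algebra R sc + left_module R M
  for R (structure) and sc and M :: "('a, 'x \<Rightarrow> complex, 'p) module_scheme" +
  assumes zero_fun: "\<zero>\<^bsub>M\<^esub> = 0"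
    and add_fun: "v \<oplus>\<^bsub>M\<^esub> w = v + w"
    and sc_smult: "v \<in> carrier M \<Longrightarrow> sc c \<odot>\<^bsub>M\<^esub> v = fscale c v"
    and finite_dimensional: "finite_dimensional (carrier M)"
begin

definition part :: "'a \<Rightarrow> ('x \<Rightarrow> complex) set \<Rightarrow> ('x \<Rightarrow> complex) set" where
  "part a N = (\<lambda>v. a \<odot>\<^bsub>M\<^esub> v) ` N"

lemma fscale_closed: "v \<in> carrier M \<Longrightarrow> fscale c v \<in> carrier M"
  using smult_closed[of "sc c" v] by (simp add: sc_smult)

lemma submodule_subspace:
  assumes "submodule N R M" shows "fs.subspace N"
proof (rule fs.subspaceI)
  note N = submoduleD[OF assms]
  show "0 \<in> N" using N(2) zero_fun by simp
  show "x + y \<in> N" if "x \<in> N" "y \<in> N" for x y using N(3)[OF that] by (simp add: add_fun)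
  show "fscale c x \<in> N" if "x \<in> N" for c x
    using N(4)[of "sc c" x] that N(1) sc_smult[of x c] by auto
qed

lemma submodule_finite_dimensional:
  assumes "submodule N R M" shows "finite_dimensional N"
  using finite_dimensional_mono[OF finite_dimensional submoduleD(1)[OF assms]] .

lemma smult_add: "a \<in> carrier R \<Longrightarrow> v \<in> carrier M \<Longrightarrow> w \<in> carrier M \<Longrightarrow>
    a \<odot>\<^bsub>M\<^esub> (v + w) = a \<odot>\<^bsub>M\<^esub> v + a \<odot>\<^bsub>M\<^esub> w"
  using smult_r_distr[of a v w] by (simp add: add_fun)

lemma smult_fscale:
  assumes "a \<in> carrier R" "v \<in> carrier M"
  shows "a \<odot>\<^bsub>M\<^esub> fscale c v = fscale c (a \<odot>\<^bsub>M\<^esub> v)"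
proof -
  have "a \<odot>\<^bsub>M\<^esub> fscale c v = (a \<otimes> sc c) \<odot>\<^bsub>M\<^esub> v"
    using assms by (simp add: smult_assoc1 sc_smult)
  also have "\<dots> = (sc c \<otimes> a) \<odot>\<^bsub>M\<^esub> v"
    using sc_central[OF assms(1)] by simp
  also have "\<dots> = fscale c (a \<odot>\<^bsub>M\<^esub> v)"
    using assms by (simp add: smult_assoc1 sc_smult smult_closed)
  finally show ?thesis .
qed

lemma sum_in_submodule:
  assumes "submodule N R M" "\<And>i. i \<in> I \<Longrightarrow> f i \<in> N"
  shows "(\<Sum>i\<in>I. f i) \<in> N"
  using fs.subspace_sum[OF submodule_subspace[OF assms(1)] assms(2)] .

lemma finsum_eq_sum:
  assumes "finite I" "\<And>i. i \<in> I \<Longrightarrow> f i \<in> carrier M"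
  shows "(\<Oplus>\<^bsub>M\<^esub>i\<in>I. f i) = (\<Sum>i\<in>I. f i)"
  using assms
proof (induction I)
  case empty
  show "(\<Oplus>\<^bsub>M\<^esub>i\<in>{}. f i) = (\<Sum>i\<in>{}. f i)"
    by (simp only: M.finsum_empty zero_fun sum.empty)
next
  case (insert i I)
  have "(\<Oplus>\<^bsub>M\<^esub>i\<in>I. f i) = (\<Sum>i\<in>I. f i)"
    by (rule insert.IH) (use insert.prems in blast)
  then show "(\<Oplus>\<^bsub>M\<^esub>j\<in>insert i I. f j) = (\<Sum>j\<in>insert i I. f j)"
    using insert.hyps insert.prems
    by (simp add: M.finsum_insert Pi_def add_fun del: plus_fun_apply)
qed

lemma part_subspace:
  assumes "a \<in> carrier R" "submodule N R M"
  shows "fs.subspace (part a N)"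
proof (rule fs.subspaceI)
  note N = submoduleD[OF assms(2)] and S = submodule_subspace[OF assms(2)]
  show "0 \<in> part a N"
    using N(2) smult_zero[OF assms(1)] zero_fun unfolding part_def by (metis image_eqI)
next
  note N = submoduleD[OF assms(2)] and S = submodule_subspace[OF assms(2)]
  fix x y assume "x \<in> part a N" "y \<in> part a N"
  then obtain v w where "v \<in> N" "w \<in> N" "x = a \<odot>\<^bsub>M\<^esub> v" "y = a \<odot>\<^bsub>M\<^esub> w"
    unfolding part_def by blast
  then show "x + y \<in> part a N"
    unfolding part_def using subsetD[OF N(1)] assms(1) fs.subspace_add[OF S, of v w] smult_add[of a v w]
    by (intro image_eqI[of _ _ "v + w"]) simp_all
next
  note N = submoduleD[OF assms(2)] and S = submodule_subspace[OF assms(2)]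
  fix c x assume "x \<in> part a N"
  then obtain v where "v \<in> N" "x = a \<odot>\<^bsub>M\<^esub> v"
    unfolding part_def by blast
  then show "fscale c x \<in> part a N"
    unfolding part_def using subsetD[OF N(1)] assms(1) fs.subspace_scale[OF S, of v c] smult_fscale[of a v c]
    by (intro image_eqI[of _ _ "fscale c v"]) simp_all
qed

lemma part_subset:
  assumes "a \<in> carrier R" "submodule N R M"
  shows "part a N \<subseteq> N"
  unfolding part_def using submoduleD(4)[OF assms(2,1)] by blast

lemma part_finite_dimensional:
  assumes "a \<in> carrier R" "submodule N R M"
  shows "finite_dimensional (part a N)"
  by (rule finite_dimensional_mono[OF submodule_finite_dimensional[OF assms(2)] part_subset[OF assms]])

text \<open>A series is built downwards, through maximal proper submodules.\<close>

theorem composition_series_exists: "\<exists>Ns. composition_series R M Ns"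
proof -
  have "\<exists>Ns. Ns \<noteq> [] \<and> hd Ns = {\<zero>\<^bsub>M\<^esub>} \<and> last Ns = N \<and> (\<forall>K\<in>set Ns. submodule K R M) \<and>
      (\<forall>i. Suc i < length Ns \<longrightarrow> Ns ! i \<subseteq> Ns ! Suc i \<and> simple_module R (series_factor M Ns i))"
    if "submodule N R M" for N
    using that
  proof (induction "fs.dim N" arbitrary: N rule: less_induct)
    case less
    show ?case
    proof (cases "N = {\<zero>\<^bsub>M\<^esub>}")
      case True
      then show ?thesis using less.prems by (intro exI[of _ "[N]"]) simp
    next
      case False
      have zero_sub: "{\<zero>\<^bsub>M\<^esub>} \<subseteq> N" using submoduleD(2)[OF less.prems] by simp
      obtain U where U: "submodule U R M" "U \<subseteq> N" "U \<noteq> N"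
        and max: "\<And>W. submodule W R M \<Longrightarrow> U \<subseteq> W \<Longrightarrow> W \<subseteq> N \<Longrightarrow> W = U \<or> W = N"
        using maximal_proper_subset_exists[of "\<lambda>W. submodule W R M", OF zero_submodule zero_sub
            _ submodule_subspace submodule_finite_dimensional[OF less.prems]] False by blast
      have "fs.dim U < fs.dim N"
      proof (rule ccontr)
        assume "\<not> fs.dim U < fs.dim N"
        then have "U = N"
          using subspace_eq_of_dim_le[OF submodule_finite_dimensional[OF less.prems] U(2)
              submodule_subspace[OF U(1)]] by simp
        then show False using U(3) by simp
      qed
      then obtain Ns where Ns: "Ns \<noteq> []" "hd Ns = {\<zero>\<^bsub>M\<^esub>}" "last Ns = U" "\<forall>K\<in>set Ns. submodule K R M"
        "\<And>i. Suc i < length Ns \<Longrightarrow> Ns ! i \<subseteq> Ns ! Suc i \<and> simple_module R (series_factor M Ns i)"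
        using less.hyps[OF _ U(1)] by blast
      have simple: "simple_module R (quotient_module (M\<lparr>carrier := N\<rparr>) U)"
        using simple_subquotient_iff[OF U(1) less.prems U(2)] U(3) max by blast
      show ?thesis
      proof (intro exI[of _ "Ns @ [N]"] conjI allI impI)
        fix i assume i: "Suc i < length (Ns @ [N])"
        have "(Ns @ [N]) ! i \<subseteq> (Ns @ [N]) ! Suc i \<and> simple_module R (series_factor M (Ns @ [N]) i)"
        proof (cases "Suc i < length Ns")
          case True
          then show ?thesis
            using Ns(5)[OF True] by (simp add: nth_append series_factor_def)
        next
          case False
          then have "i = length Ns - 1" using i Ns(1) by simp
          then have "(Ns @ [N]) ! i = U" "(Ns @ [N]) ! Suc i = N"
            using Ns(1,3) by (simp_all add: nth_append last_conv_nth)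
          then show ?thesis
            using U(2) simple by (simp add: series_factor_def)
        qed
        then show "(Ns @ [N]) ! i \<subseteq> (Ns @ [N]) ! Suc i" "simple_module R (series_factor M (Ns @ [N]) i)"
          by auto
      qed (use Ns less.prems in auto)
    qed
  qed
  from this[OF carrier_submodule] show ?thesis
    unfolding composition_series_def .
qed

text \<open>If every submodule has a complement, minimal submodules can be split off one at a time; the
  rest has smaller dimension. For \<open>N\<close> inside the module, a complement is obtained by intersecting
  with \<open>N\<close>.\<close>

theorem simple_decomposition_exists:
  assumes complement: "\<And>N. submodule N R M \<Longrightarrow>
    \<exists>K. submodule K R M \<and> N \<inter> K = {0} \<and> (\<forall>x\<in>carrier M. \<exists>y\<in>N. x - y \<in> K)"
  shows "\<exists>\<U>. simple_decomposition R M \<U>"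
proof -
  have "\<exists>\<U>. finite \<U> \<and> (\<forall>U\<in>\<U>. submodule U R M \<and> U \<subseteq> N \<and> simple_module R (M\<lparr>carrier := U\<rparr>)) \<and>
      (\<forall>x\<in>N. \<exists>!u. u \<in> (\<Pi>\<^sub>E U\<in>\<U>. U) \<and> x = (\<Sum>U\<in>\<U>. u U))"
    if "submodule N R M" for N
    using that
  proof (induction "fs.dim N" arbitrary: N rule: less_induct)
    case less
    note ND = submoduleD[OF less.prems] and NS = submodule_subspace[OF less.prems]
    show ?case
    proof (cases "N = {0}")
      case True
      show ?thesis
        by (rule exI[of _ "{}"]) (simp add: True)
    next
      case False
      obtain U where U: "submodule U R M" "U \<subseteq> N" "U \<noteq> {0}"
        and min: "\<And>W. submodule W R M \<Longrightarrow> W \<subseteq> U \<Longrightarrow> W \<noteq> {0} \<Longrightarrow> W = U"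
        using minimal_nonzero_subset_exists[of "\<lambda>W. submodule W R M", OF less.prems False
          submodule_subspace submodule_finite_dimensional[OF less.prems]] by blast
      note UD = submoduleD[OF U(1)] and US = submodule_subspace[OF U(1)]
      have simple: "simple_module R (M\<lparr>carrier := U\<rparr>)"
        unfolding simple_module_def
        using restrict_left_module[OF U(1)] U(3) min submodule_of_restrict_iff[OF U(1)]
        by (simp add: zero_fun) blast
      obtain K where K: "submodule K R M" "U \<inter> K = {0}" "\<And>x. x \<in> carrier M \<Longrightarrow> \<exists>y\<in>U. x - y \<in> K"
        using complement[OF U(1)] by blast
      define N' where "N' = K \<inter> N"
      have N': "submodule N' R M"
        unfolding N'_def by (rule submodule_Int[OF K(1) less.prems])
      note N'S = submodule_subspace[OF N']
      have UN': "U \<inter> N' = {0}" "N' \<subseteq> N"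
        using K(2) fs.subspace_0[OF NS] unfolding N'_def by auto
      have "fs.dim N' < fs.dim N"
      proof (rule ccontr)
        assume "\<not> fs.dim N' < fs.dim N"
        then have "N' = N"
          using subspace_eq_of_dim_le[OF submodule_finite_dimensional[OF less.prems] UN'(2) N'S] by simp
        then show False using UN'(1) U(2,3) by blast
      qed
      from less.hyps[OF this N'] obtain \<U> where "finite \<U> \<and>
          (\<forall>V\<in>\<U>. submodule V R M \<and> V \<subseteq> N' \<and> simple_module R (M\<lparr>carrier := V\<rparr>)) \<and>
          (\<forall>x\<in>N'. \<exists>!u. u \<in> (\<Pi>\<^sub>E V\<in>\<U>. V) \<and> x = (\<Sum>V\<in>\<U>. u V))"
        by (rule exE)
      then have \<U>: "finite \<U>"
          "\<And>V. V \<in> \<U> \<Longrightarrow> submodule V R M \<and> V \<subseteq> N' \<and> simple_module R (M\<lparr>carrier := V\<rparr>)"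
          "\<And>x. x \<in> N' \<Longrightarrow> \<exists>!u. u \<in> (\<Pi>\<^sub>E V\<in>\<U>. V) \<and> x = (\<Sum>V\<in>\<U>. u V)"
        by simp_all
      have notin: "U \<notin> \<U>"
        using \<U>(2)[of U] UN'(1) U(3) by blast
      have sum_N': "(\<Sum>V\<in>\<U>. u V) \<in> N'" if "u \<in> (\<Pi>\<^sub>E V\<in>\<U>. V)" for u
        using that \<U>(2) by (intro sum_in_submodule[OF N']) (auto dest: PiE_mem)
      have "\<exists>!u. u \<in> (\<Pi>\<^sub>E V\<in>insert U \<U>. V) \<and> x = (\<Sum>V\<in>insert U \<U>. u V)" if x: "x \<in> N" for x
      proof -
        obtain y where y: "y \<in> U" "x - y \<in> K"
          using K(3)[of x] x ND(1) by blast
        have z: "x - y \<in> N'"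
          unfolding N'_def using y x U(2) fs.subspace_diff[OF NS] by blast
        from \<U>(3)[OF z] obtain u where "u \<in> (\<Pi>\<^sub>E V\<in>\<U>. V) \<and> x - y = (\<Sum>V\<in>\<U>. u V)"
          and uniq: "\<forall>v. v \<in> (\<Pi>\<^sub>E V\<in>\<U>. V) \<and> x - y = (\<Sum>V\<in>\<U>. v V) \<longrightarrow> v = u"
          by (rule ex1E)
        note u = conjunct1[OF this(1)] conjunct2[OF this(1)]
        have upd: "(\<Sum>V\<in>\<U>. (w(U := a)) V) = (\<Sum>V\<in>\<U>. w V)" for w :: "('x \<Rightarrow> complex) set \<Rightarrow> 'x \<Rightarrow> complex" and a
          using notin by (intro sum.cong) auto
        show ?thesis
        proof (rule ex1I[of _ "u(U := y)"], intro conjI)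
          show "u(U := y) \<in> (\<Pi>\<^sub>E V\<in>insert U \<U>. V)"
            using u(1) y(1) by (intro PiE_fun_upd)
          have "(\<Sum>V\<in>insert U \<U>. (u(U := y)) V) = y + (\<Sum>V\<in>\<U>. u V)"
            using \<U>(1) notin upd[of u y] by simp
          also have "\<dots> = x"
            unfolding u(2)[symmetric] by simp
          finally show "x = (\<Sum>V\<in>insert U \<U>. (u(U := y)) V)" by (rule sym)
        next
          fix w assume w: "w \<in> (\<Pi>\<^sub>E V\<in>insert U \<U>. V) \<and> x = (\<Sum>V\<in>insert U \<U>. w V)"
          define w' where "w' = restrict w \<U>"
          have w': "w' \<in> (\<Pi>\<^sub>E V\<in>\<U>. V)"
            using w unfolding w'_def by auto
          have sw: "(\<Sum>V\<in>\<U>. w V) = (\<Sum>V\<in>\<U>. w' V)"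
            unfolding w'_def by (intro sum.cong) auto
          have wU: "w U \<in> U" using w by auto
          have xw: "x = w U + (\<Sum>V\<in>\<U>. w' V)"
            using w \<U>(1) notin sw by simp
          have eq: "y - w U = (\<Sum>V\<in>\<U>. w' V) - (x - y)"
            unfolding xw by simp
          have "y - w U \<in> U"
            by (rule fs.subspace_diff[OF US y(1) wU])
          moreover have "y - w U \<in> N'"
            unfolding eq by (rule fs.subspace_diff[OF N'S sum_N'[OF w'] z])
          ultimately have "y - w U = 0" using UN'(1) by blast
          then have yw: "y = w U" by simp
          then have "x - y = (\<Sum>V\<in>\<U>. w' V)"
            unfolding xw by simp
          then have "w' = u" using uniq w' by blast
          then show "w = u(U := y)"
          proof (intro ext)
            fix V
            have wu: "u V = w' V" using \<open>w' = u\<close> by simp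
            have "V \<notin> insert U \<U> \<Longrightarrow> w V = undefined"
              using w PiE_arb[of w "insert U \<U>" "\<lambda>V. V" V] by blast
            then have "w V = (u(U := y)) V"
              using yw wu by (cases "V = U"; cases "V \<in> \<U>") (simp_all add: w'_def)
            then show "w V x = (u(U := y)) V x" for x by simp
          qed
        qed
      qed
      then have decomposes: "\<forall>x\<in>N. \<exists>!u. u \<in> (\<Pi>\<^sub>E V\<in>insert U \<U>. V) \<and> x = (\<Sum>V\<in>insert U \<U>. u V)"
        by (rule ballI)
      have "submodule V R M \<and> V \<subseteq> N \<and> simple_module R (M\<lparr>carrier := V\<rparr>)" if "V \<in> insert U \<U>" for V
        using that \<U>(2)[of V] U(1,2) simple UN'(2) by auto
      then have "\<forall>V\<in>insert U \<U>. submodule V R M \<and> V \<subseteq> N \<and> simple_module R (M\<lparr>carrier := V\<rparr>)"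
        by (rule ballI)
      moreover have "finite (insert U \<U>)" using \<U>(1) by simp
      ultimately show ?thesis
        using decomposes by (intro exI[of _ "insert U \<U>"] conjI)
    qed
  qed
  from this[OF carrier_submodule] obtain \<U> where "finite \<U> \<and>
      (\<forall>U\<in>\<U>. submodule U R M \<and> U \<subseteq> carrier M \<and> simple_module R (M\<lparr>carrier := U\<rparr>)) \<and>
      (\<forall>x\<in>carrier M. \<exists>!u. u \<in> (\<Pi>\<^sub>E U\<in>\<U>. U) \<and> x = (\<Sum>U\<in>\<U>. u U))"
    by (rule exE)
  then have \<U>: "finite \<U>"
      "\<And>U. U \<in> \<U> \<Longrightarrow> submodule U R M \<and> U \<subseteq> carrier M \<and> simple_module R (M\<lparr>carrier := U\<rparr>)"
      "\<And>x. x \<in> carrier M \<Longrightarrow> \<exists>!u. u \<in> (\<Pi>\<^sub>E U\<in>\<U>. U) \<and> x = (\<Sum>U\<in>\<U>. u U)"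
    by simp_all
  have "(\<Oplus>\<^bsub>M\<^esub>U\<in>\<U>. u U) = (\<Sum>U\<in>\<U>. u U)" if "u \<in> (\<Pi>\<^sub>E U\<in>\<U>. U)" for u
    using that \<U>(2) by (intro finsum_eq_sum \<U>(1)) (auto dest: PiE_mem)
  then have "u \<in> (\<Pi>\<^sub>E U\<in>\<U>. U) \<and> x = (\<Oplus>\<^bsub>M\<^esub>U\<in>\<U>. u U) \<longleftrightarrow>
      u \<in> (\<Pi>\<^sub>E U\<in>\<U>. U) \<and> x = (\<Sum>U\<in>\<U>. u U)" for u x
    by auto
  then show ?thesis
    unfolding simple_decomposition_def using \<U> by (intro exI[of _ \<U>]) simp
qed

end

locale corner_function_module = scalar_corner R sc e + function_module R sc M
  for R :: "('a, 'm) ring_scheme" (structure) and sc and e and M :: "('a, 'x \<Rightarrow> complex, 'p) module_scheme"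
begin

text \<open>The map \<open>N \<mapsto> eN\<close> is exact, so the step from \<open>eN\<close> to \<open>eN'\<close> is \<open>e\<close> applied to the simple factor
  \<open>N'/N\<close>. If that is not zero, choose \<open>w = e w\<close> in \<open>N'\<close> outside \<open>N\<close>. By simplicity
  \<open>N' = N + Rw\<close>, and \<open>e R w = e R e w = \<complex>w\<close> is a line.\<close>

lemma dim_part_step:
  assumes N: "submodule N R M" and N': "submodule N' R M" and sub: "N \<subseteq> N'"
    and simple: "simple_module R (quotient_module (M\<lparr>carrier := N'\<rparr>) N)"
  shows "fs.dim (part e N') = fs.dim (part e N) +
    (if acts_nontrivially e (quotient_module (M\<lparr>carrier := N'\<rparr>) N) then 1 else 0)"
proof -
  let ?M' = "M\<lparr>carrier := N'\<rparr>"
  note ND = submoduleD[OF N] and N'D = submoduleD[OF N']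
  have "module_quotient R ?M' N"
    using submodule_of_restrict_iff[OF N', of N] N sub restrict_left_module[OF N']
    by (simp add: module_quotient_def module_quotient_axioms_def)
  then interpret Q: module_quotient R ?M' N .
  have acts_iff: "acts_nontrivially e (quotient_module ?M' N) \<longleftrightarrow> (\<exists>x\<in>N'. e \<odot>\<^bsub>M\<^esub> x \<notin> N)"
  proof
    assume "\<exists>x\<in>N'. e \<odot>\<^bsub>M\<^esub> x \<notin> N"
    then show "acts_nontrivially e (quotient_module ?M' N)"
      using Q.acts_nontrivially_quotient[OF e_closed] by auto
  next
    assume "acts_nontrivially e (quotient_module ?M' N)"
    then obtain x where "x \<in> N'" "N +>\<^bsub>?M'\<^esub> (e \<odot>\<^bsub>M\<^esub> x) \<noteq> N"
      unfolding acts_nontrivially_def Q.carrier_quotient Q.zero_quotient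
      using Q.smult_quotient[OF e_closed] by auto
    then show "\<exists>x\<in>N'. e \<odot>\<^bsub>M\<^esub> x \<notin> N"
      using Q.coset_of_member by blast
  qed
  show ?thesis
  proof (cases "\<exists>x\<in>N'. e \<odot>\<^bsub>M\<^esub> x \<notin> N")
    case False
    have "part e N' \<subseteq> part e N"
    proof
      fix y assume "y \<in> part e N'"
      then obtain x where x: "x \<in> N'" "y = e \<odot>\<^bsub>M\<^esub> x" unfolding part_def by blast
      have "e \<odot>\<^bsub>M\<^esub> (e \<odot>\<^bsub>M\<^esub> x) = e \<odot>\<^bsub>M\<^esub> x"
        using smult_assoc1[of e e x] x(1) N'D(1) by (auto simp: e_idem)
      then show "y \<in> part e N"
        unfolding part_def using x False by (metis image_eqI)
    qed
    moreover have "part e N \<subseteq> part e N'"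
      unfolding part_def using sub by blast
    ultimately show ?thesis
      using False acts_iff by simp
  next
    case True
    then obtain x0 where x0: "x0 \<in> N'" "e \<odot>\<^bsub>M\<^esub> x0 \<notin> N" by blast
    have x0M: "x0 \<in> carrier M" using x0(1) N'D(1) by blast
    define w where "w = e \<odot>\<^bsub>M\<^esub> x0"
    have w: "w \<in> N'" "w \<in> carrier M" "w \<notin> N" "e \<odot>\<^bsub>M\<^esub> w = w"
      using x0 N'D(1) N'D(4)[OF e_closed x0(1)] smult_assoc1[OF e_closed e_closed x0M]
      by (auto simp: w_def e_idem)
    let ?C = "{a \<odot>\<^bsub>M\<^esub> w | a. a \<in> carrier R}"
    let ?K = "{x \<oplus>\<^bsub>M\<^esub> y | x y. x \<in> N \<and> y \<in> ?C}"
    have C: "submodule ?C R M" by (rule cyclic_submodule[OF w(2)])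
    have K: "submodule ?K R M" by (rule submodule_sum[OF N C])
    have "N \<subseteq> ?K"
    proof
      fix x assume x: "x \<in> N"
      then have "x = x \<oplus>\<^bsub>M\<^esub> \<zero>\<^bsub>M\<^esub>" using ND(1) by auto
      then show "x \<in> ?K" using x submoduleD(2)[OF C] by blast
    qed
    moreover have "?K \<subseteq> N'"
      using sub N'D(3) N'D(4)[OF _ w(1)] by blast
    moreover have "w \<in> ?K"
    proof -
      have "w = \<zero>\<^bsub>M\<^esub> \<oplus>\<^bsub>M\<^esub> \<one> \<odot>\<^bsub>M\<^esub> w" using w(2) by (simp add: smult_one)
      then show ?thesis using ND(2) one_closed by blast
    qed
    ultimately have "?K = N'"
      using simple w(3) K unfolding simple_subquotient_iff[OF N N' sub] by blast
    have eN: "part e N' = {v + fscale c w | v c. v \<in> part e N}"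
    proof (intro Set.set_eqI iffI)
      fix y assume "y \<in> part e N'"
      then obtain x where x: "x \<in> N'" "y = e \<odot>\<^bsub>M\<^esub> x" unfolding part_def by blast
      then obtain n a where na: "n \<in> N" "a \<in> carrier R" "x = n \<oplus>\<^bsub>M\<^esub> a \<odot>\<^bsub>M\<^esub> w"
        using \<open>?K = N'\<close> by blast
      obtain c where c: "e \<otimes> a \<otimes> e = sc c \<otimes> e" using corner[OF na(2)] by blast
      have "e \<odot>\<^bsub>M\<^esub> (a \<odot>\<^bsub>M\<^esub> w) = (e \<otimes> a \<otimes> e) \<odot>\<^bsub>M\<^esub> x0"
        using na(2) x0M by (simp add: w_def smult_assoc1 smult_closed)
      also have "\<dots> = fscale c w"
        unfolding c using x0M w(2) by (simp add: smult_assoc1 w_def[symmetric] sc_smult)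
      finally have "y = e \<odot>\<^bsub>M\<^esub> n + fscale c w"
        using x(2) na ND(1) w(2) smult_r_distr[of e n "a \<odot>\<^bsub>M\<^esub> w"] by (auto simp: add_fun smult_closed)
      then show "y \<in> {v + fscale c w | v c. v \<in> part e N}"
        unfolding part_def using na(1) by blast
    next
      fix y assume "y \<in> {v + fscale c w | v c. v \<in> part e N}"
      then obtain n c where n: "n \<in> N" "y = e \<odot>\<^bsub>M\<^esub> n + fscale c w"
        unfolding part_def by blast
      have "e \<odot>\<^bsub>M\<^esub> (n + fscale c w) = y"
        unfolding n(2) using n(1) ND(1) w smult_add[OF e_closed _ fscale_closed[OF w(2)], of n c]
        by (auto simp: smult_fscale)
      moreover have "n + fscale c w \<in> N'"
        using n(1) sub w(1) submodule_subspace[OF N'] by (intro fs.subspace_add fs.subspace_scale) auto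
      ultimately show "y \<in> part e N'"
        unfolding part_def by blast
    qed
    have "w \<notin> part e N"
      using part_subset[OF e_closed N] w(3) by blast
    then have "fs.dim (part e N') = Suc (fs.dim (part e N))"
      unfolding eN using part_subspace[OF e_closed N] part_finite_dimensional[OF e_closed N]
      by (intro dim_one_step_extension)
    then show ?thesis
      using True acts_iff by simp
  qed
qed

lemma simple_iso_iff:
  assumes "simple_module R X" "simple_module R S" "acts_nontrivially e S"
  shows "module_iso R X S \<longleftrightarrow> acts_nontrivially e X"
proof
  assume "module_iso R X S"
  then have "module_iso R S X"
    by (rule module_iso_sym[OF simple_moduleD(1)[OF assms(1)]])
  then show "acts_nontrivially e X"
    using acts_nontrivially_iso[OF _ simple_moduleD(1)[OF assms(2)] simple_moduleD(1)[OF assms(1)] e_closed assms(3)]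
    by blast
qed (use simple_modules_iso assms in blast)

lemma part_zero: "fs.dim (part e {\<zero>\<^bsub>M\<^esub>}) = 0"
  using smult_zero[OF e_closed] by (simp add: part_def zero_fun)

text \<open>The dimensions of the parts telescope along any composition series. The count is therefore the
  same for all series, which justifies the description operator.\<close>

theorem jordan_hoelder_multiplicity_eq_dim:
  assumes S: "simple_module R S" "acts_nontrivially e S"
  shows "jordan_hoelder_multiplicity R M S = fs.dim (part e (carrier M))"
proof -
  have count: "card {i. Suc i < length Ns \<and> module_iso R (series_factor M Ns i) S} = fs.dim (part e (carrier M))"
    if Ns: "composition_series R M Ns" for Ns
  proof -
    have Ns: "Ns \<noteq> []" "Ns ! 0 = {\<zero>\<^bsub>M\<^esub>}" "Ns ! (length Ns - 1) = carrier M"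
      "\<And>i. i < length Ns \<Longrightarrow> submodule (Ns ! i) R M"
      "\<And>i. Suc i < length Ns \<Longrightarrow> Ns ! i \<subseteq> Ns ! Suc i"
      "\<And>i. Suc i < length Ns \<Longrightarrow> simple_module R (series_factor M Ns i)"
      using Ns unfolding composition_series_def by (auto simp: hd_conv_nth last_conv_nth)
    have "fs.dim (part e (Ns ! j)) = card {i. i < j \<and> module_iso R (series_factor M Ns i) S}"
      if "j < length Ns" for j
      using that
    proof (induction j)
      case 0
      then show ?case using Ns(2) part_zero by simp
    next
      case (Suc j)
      let ?I = "\<lambda>i. module_iso R (series_factor M Ns i) S"
      have "{i. i < Suc j \<and> ?I i} = {i. i < j \<and> ?I i} \<union> (if ?I j then {j} else {})"
        by (auto simp: less_Suc_eq)
      then have "card {i. i < Suc j \<and> ?I i} = card {i. i < j \<and> ?I i} + (if ?I j then 1 else 0)"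
        by simp
      moreover have "fs.dim (part e (Ns ! Suc j)) = fs.dim (part e (Ns ! j)) + (if ?I j then 1 else 0)"
        unfolding simple_iso_iff[OF Ns(6)[OF Suc.prems] S]
        using dim_part_step[OF Ns(4) Ns(4)[OF Suc.prems] Ns(5)[OF Suc.prems]] Ns(6)[OF Suc.prems] Suc.prems
        unfolding series_factor_def by simp
      ultimately show ?case using Suc.IH Suc.prems by simp
    qed
    from this[of "length Ns - 1"] Ns(1,3) have
      "fs.dim (part e (carrier M)) = card {i. i < length Ns - 1 \<and> module_iso R (series_factor M Ns i) S}"
      by simp
    moreover have "{i. i < length Ns - 1 \<and> module_iso R (series_factor M Ns i) S} =
        {i. Suc i < length Ns \<and> module_iso R (series_factor M Ns i) S}"
      by auto
    ultimately show ?thesis by simp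
  qed
  show ?thesis
    unfolding jordan_hoelder_multiplicity_def
  proof (rule the_equality)
    show "\<exists>Ns. composition_series R M Ns \<and>
        fs.dim (part e (carrier M)) = card {i. Suc i < length Ns \<and> module_iso R (series_factor M Ns i) S}"
    proof -
      obtain Ns where Ns: "composition_series R M Ns"
        using composition_series_exists by (rule exE)
      show ?thesis
        by (intro exI[of _ Ns] conjI Ns count[OF Ns, symmetric])
    qed
  next
    fix m assume "\<exists>Ns. composition_series R M Ns \<and>
        m = card {i. Suc i < length Ns \<and> module_iso R (series_factor M Ns i) S}"
    then show "m = fs.dim (part e (carrier M))"
      using count by (elim exE conjE) simp
  qed
qed

text \<open>For a simple \<open>U\<close> that meets \<open>V\<close> trivially, \<open>(V + U)/V\<close> is simple and is detected by \<open>e\<close>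
  exactly if \<open>U\<close> is, so the step from \<open>V\<close> to \<open>V + U\<close> is one of the steps already treated.\<close>

lemma dim_part_direct_sum:
  assumes V: "submodule V R M" and U: "submodule U R M" "simple_module R (M\<lparr>carrier := U\<rparr>)"
    and disj: "V \<inter> U = {0}"
  shows "fs.dim (part e {x \<oplus>\<^bsub>M\<^esub> y | x y. x \<in> V \<and> y \<in> U}) =
    fs.dim (part e V) + (if acts_nontrivially e (M\<lparr>carrier := U\<rparr>) then 1 else 0)"
proof -
  define W where "W = {x \<oplus>\<^bsub>M\<^esub> y | x y. x \<in> V \<and> y \<in> U}"
  note VD = submoduleD[OF V] and UD = submoduleD[OF U(1)]
  note VS = submodule_subspace[OF V] and US = submodule_subspace[OF U(1)]
  have W: "submodule W R M"
    unfolding W_def by (rule submodule_sum[OF V U(1)])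
  have VW: "V \<subseteq> W"
  proof
    fix x assume "x \<in> V"
    then have "x = x \<oplus>\<^bsub>M\<^esub> \<zero>\<^bsub>M\<^esub>" using VD(1) by auto
    then show "x \<in> W" using \<open>x \<in> V\<close> UD(2) unfolding W_def by blast
  qed
  have UW: "U \<subseteq> W"
  proof
    fix x assume "x \<in> U"
    then have "x = \<zero>\<^bsub>M\<^esub> \<oplus>\<^bsub>M\<^esub> x" using UD(1) by auto
    then show "x \<in> W" using \<open>x \<in> U\<close> VD(2) unfolding W_def by blast
  qed
  have between: "K = V \<or> K = W" if K: "submodule K R M" "V \<subseteq> K" "K \<subseteq> W" for K
  proof -
    have "submodule (K \<inter> U) R (M\<lparr>carrier := U\<rparr>)"
      using submodule_of_restrict_iff[OF U(1)] submodule_Int[OF K(1) U(1)] by blast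
    then have "K \<inter> U = {0} \<or> K \<inter> U = U"
      using U(2) by (simp add: simple_module_def zero_fun)
    then show ?thesis
    proof
      assume triv: "K \<inter> U = {0}"
      have "K \<subseteq> V"
      proof
        fix k assume k: "k \<in> K"
        then obtain x y where xy: "k = x + y" "x \<in> V" "y \<in> U"
          using K(3) unfolding W_def by (auto simp: add_fun)
        then have "y = k - x" by simp
        then have "y \<in> K \<inter> U"
          using xy(2,3) k K(2) fs.subspace_diff[OF submodule_subspace[OF K(1)], of k x] by auto
        then show "k \<in> V" using xy triv by simp
      qed
      then show ?thesis using K(2) by blast
    next
      assume "K \<inter> U = U"
      then have "W \<subseteq> K"
        unfolding W_def using K(2) submoduleD(3)[OF K(1)] by blast
      then show ?thesis using K(3) by blast
    qed
  qed
  have "U \<noteq> {0}" using simple_moduleD(2)[OF U(2)] by (simp add: zero_fun)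
  then have "V \<noteq> W" using UW disj fs.subspace_0[OF US] by blast
  then have simple: "simple_module R (quotient_module (M\<lparr>carrier := W\<rparr>) V)"
    unfolding simple_subquotient_iff[OF V W VW] using between by blast
  have "module_quotient R (M\<lparr>carrier := W\<rparr>) V"
    using submodule_of_restrict_iff[OF W, of V] V VW restrict_left_module[OF W]
    by (simp add: module_quotient_def module_quotient_axioms_def)
  then interpret Q: module_quotient R "M\<lparr>carrier := W\<rparr>" V .
  have "acts_nontrivially e (quotient_module (M\<lparr>carrier := W\<rparr>) V) \<longleftrightarrow>
      acts_nontrivially e (M\<lparr>carrier := U\<rparr>)"
  proof
    assume "acts_nontrivially e (M\<lparr>carrier := U\<rparr>)"
    then obtain u where u: "u \<in> U" "e \<odot>\<^bsub>M\<^esub> u \<noteq> 0"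
      by (auto simp: acts_nontrivially_def zero_fun)
    then have "e \<odot>\<^bsub>M\<^esub> u \<notin> V" using UD(4)[OF e_closed u(1)] disj by blast
    then show "acts_nontrivially e (quotient_module (M\<lparr>carrier := W\<rparr>) V)"
      using Q.acts_nontrivially_quotient[OF e_closed, of u] UW u(1) by auto
  next
    assume "acts_nontrivially e (quotient_module (M\<lparr>carrier := W\<rparr>) V)"
    then obtain x where x: "x \<in> W" "V +>\<^bsub>M\<lparr>carrier := W\<rparr>\<^esub> (e \<odot>\<^bsub>M\<^esub> x) \<noteq> V"
      unfolding acts_nontrivially_def Q.carrier_quotient Q.zero_quotient
      using Q.smult_quotient[OF e_closed] by auto
    then have nV: "e \<odot>\<^bsub>M\<^esub> x \<notin> V" using Q.coset_of_member by blast
    obtain v u where vu: "x = v \<oplus>\<^bsub>M\<^esub> u" "v \<in> V" "u \<in> U"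
      using x(1) unfolding W_def by blast
    have "e \<odot>\<^bsub>M\<^esub> x = e \<odot>\<^bsub>M\<^esub> v \<oplus>\<^bsub>M\<^esub> e \<odot>\<^bsub>M\<^esub> u"
      using vu VD(1) UD(1) smult_r_distr[OF e_closed, of v u] by blast
    then have "e \<odot>\<^bsub>M\<^esub> u \<noteq> 0"
      using nV VD(4)[OF e_closed vu(2)] by (auto simp: add_fun)
    then show "acts_nontrivially e (M\<lparr>carrier := U\<rparr>)"
      using vu(3) by (auto simp: acts_nontrivially_def zero_fun)
  qed
  then show ?thesis
    using dim_part_step[OF V W VW simple] unfolding W_def by simp
qed

text \<open>The summands are added one at a time; uniqueness of the representation as a sum says that the
  next summand meets the sum of the previous ones trivially.\<close>

theorem constituent_multiplicity_eq_dim: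
  assumes S: "simple_module R S" "acts_nontrivially e S"
    and exists: "\<exists>\<U>. simple_decomposition R M \<U>"
  shows "constituent_multiplicity R M S = fs.dim (part e (carrier M))"
proof -
  have count: "card {U \<in> \<U>. module_iso R (M\<lparr>carrier := U\<rparr>) S} = fs.dim (part e (carrier M))"
    if dec: "simple_decomposition R M \<U>" for \<U>
  proof -
    have fin: "finite \<U>" and U: "\<And>U. U \<in> \<U> \<Longrightarrow> submodule U R M" "\<And>U. U \<in> \<U> \<Longrightarrow> simple_module R (M\<lparr>carrier := U\<rparr>)"
      using dec by (auto simp: simple_decomposition_def)
    have finsum: "(\<Oplus>\<^bsub>M\<^esub>U\<in>\<U>. u U) = (\<Sum>U\<in>\<U>. u U)" if "u \<in> (\<Pi>\<^sub>E U\<in>\<U>. U)" for u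
      using that submoduleD(1)[OF U(1)] by (intro finsum_eq_sum fin) (auto dest: PiE_mem)
    have ex: "\<exists>u. u \<in> (\<Pi>\<^sub>E U\<in>\<U>. U) \<and> x = (\<Sum>U\<in>\<U>. u U)" if "x \<in> carrier M" for x
      using dec that finsum unfolding simple_decomposition_def by metis
    have uniq: "u = v" if "u \<in> (\<Pi>\<^sub>E U\<in>\<U>. U)" "v \<in> (\<Pi>\<^sub>E U\<in>\<U>. U)" "(\<Sum>U\<in>\<U>. u U) = (\<Sum>U\<in>\<U>. v U)" for u v
    proof -
      have "(\<Sum>U\<in>\<U>. u U) \<in> carrier M"
        using that(1) submoduleD(1)[OF U(1)] by (intro sum_in_submodule carrier_submodule) (auto dest: PiE_mem)
      then have "\<exists>!w. w \<in> (\<Pi>\<^sub>E U\<in>\<U>. U) \<and> (\<Sum>U\<in>\<U>. u U) = (\<Oplus>\<^bsub>M\<^esub>U\<in>\<U>. w U)"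
        using dec by (simp add: simple_decomposition_def)
      then show ?thesis
        using that finsum[OF that(1)] finsum[OF that(2)] by metis
    qed
    define D where "D \<V> = {\<Sum>U\<in>\<V>. u U | u. \<forall>U\<in>\<V>. u U \<in> U}" for \<V> :: "('x \<Rightarrow> complex) set set"
    have zeroU: "0 \<in> U" if "U \<in> \<U>" for U
      using fs.subspace_0[OF submodule_subspace[OF U(1)[OF that]]] .
    have "submodule (D \<V>) R M \<and> fs.dim (part e (D \<V>)) = card {U \<in> \<V>. module_iso R (M\<lparr>carrier := U\<rparr>) S}"
      if "finite \<V>" "\<V> \<subseteq> \<U>" for \<V>
      using that
    proof (induction \<V>)
      case empty
      have "D {} = {\<zero>\<^bsub>M\<^esub>}" by (simp add: D_def zero_fun)
      then show ?case using zero_submodule part_zero by simp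
    next
      case (insert U \<V>)
      have IH: "submodule (D \<V>) R M" "fs.dim (part e (D \<V>)) = card {U \<in> \<V>. module_iso R (M\<lparr>carrier := U\<rparr>) S}"
        using insert by auto
      have UU: "U \<in> \<U>" "\<V> \<subseteq> \<U>" using insert.prems by auto
      have D_insert: "D (insert U \<V>) = {x \<oplus>\<^bsub>M\<^esub> y | x y. x \<in> D \<V> \<and> y \<in> U}"
      proof (intro Set.set_eqI iffI)
        fix z assume "z \<in> D (insert U \<V>)"
        then obtain u where u: "z = (\<Sum>V\<in>insert U \<V>. u V)" "\<forall>V\<in>insert U \<V>. u V \<in> V"
          unfolding D_def by blast
        then have "z = (\<Sum>V\<in>\<V>. u V) \<oplus>\<^bsub>M\<^esub> u U"
          using insert.hyps by (simp add: add_fun add.commute)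
        then show "z \<in> {x \<oplus>\<^bsub>M\<^esub> y | x y. x \<in> D \<V> \<and> y \<in> U}"
          unfolding D_def using u(2) by blast
      next
        fix z assume "z \<in> {x \<oplus>\<^bsub>M\<^esub> y | x y. x \<in> D \<V> \<and> y \<in> U}"
        then obtain u y where u: "z = (\<Sum>V\<in>\<V>. u V) + y" "\<forall>V\<in>\<V>. u V \<in> V" "y \<in> U"
          unfolding D_def by (auto simp: add_fun)
        have "(\<Sum>V\<in>\<V>. (u(U := y)) V) = (\<Sum>V\<in>\<V>. u V)"
          using insert.hyps by (intro sum.cong) auto
        then have "z = (\<Sum>V\<in>insert U \<V>. (u(U := y)) V)"
          using insert.hyps u(1) by (simp add: add.commute)
        moreover have "\<forall>V\<in>insert U \<V>. (u(U := y)) V \<in> V"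
          using u(2,3) by simp
        ultimately show "z \<in> D (insert U \<V>)"
          unfolding D_def by blast
      qed
      have disj: "D \<V> \<inter> U = {0}"
      proof
        show "{0} \<subseteq> D \<V> \<inter> U"
          using zeroU[OF UU(1)] submoduleD(2)[OF IH(1)] zero_fun by simp
        show "D \<V> \<inter> U \<subseteq> {0}"
        proof
          fix z assume "z \<in> D \<V> \<inter> U"
          then obtain u where u: "z = (\<Sum>V\<in>\<V>. u V)" "\<forall>V\<in>\<V>. u V \<in> V" "z \<in> U"
            unfolding D_def by blast
          \<comment> \<open>two expressions of \<open>z\<close> as a sum over the decomposition\<close>
          define a where "a = (\<lambda>V\<in>\<U>. if V \<in> \<V> then u V else 0)"
          define b where "b = (\<lambda>V\<in>\<U>. if V = U then z else 0)"
          have "a \<in> (\<Pi>\<^sub>E U\<in>\<U>. U)" "b \<in> (\<Pi>\<^sub>E U\<in>\<U>. U)"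
            using u(2,3) zeroU by (auto simp: a_def b_def)
          moreover have "(\<Sum>V\<in>\<U>. a V) = z"
          proof -
            have "(\<Sum>V\<in>\<U>. a V) = (\<Sum>V\<in>\<V>. a V)"
              using UU fin by (intro sum.mono_neutral_right) (auto simp: a_def)
            also have "\<dots> = z"
              unfolding u(1) using UU by (intro sum.cong) (auto simp: a_def)
            finally show ?thesis .
          qed
          moreover have "(\<Sum>V\<in>\<U>. b V) = z"
          proof -
            have "(\<Sum>V\<in>\<U>. b V) = (\<Sum>V\<in>{U}. b V)"
              using UU fin by (intro sum.mono_neutral_right) (auto simp: b_def)
            then show ?thesis using UU by (simp add: b_def)
          qed
          ultimately have "a = b" using uniq by simp
          moreover have "a U = 0"
            using UU insert.hyps(2) by (simp add: a_def)
          ultimately have "b U = 0" by simp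
          then show "z \<in> {0}" using UU by (simp add: b_def)
        qed
      qed
      have iso: "module_iso R (M\<lparr>carrier := U\<rparr>) S \<longleftrightarrow> acts_nontrivially e (M\<lparr>carrier := U\<rparr>)"
        by (rule simple_iso_iff[OF U(2)[OF UU(1)] S])
      have "{V \<in> insert U \<V>. module_iso R (M\<lparr>carrier := V\<rparr>) S} = {V \<in> \<V>. module_iso R (M\<lparr>carrier := V\<rparr>) S} \<union>
          (if acts_nontrivially e (M\<lparr>carrier := U\<rparr>) then {U} else {})"
        using iso by auto
      then have "card {V \<in> insert U \<V>. module_iso R (M\<lparr>carrier := V\<rparr>) S} =
          card {V \<in> \<V>. module_iso R (M\<lparr>carrier := V\<rparr>) S} + (if acts_nontrivially e (M\<lparr>carrier := U\<rparr>) then 1 else 0)"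
        using insert.hyps by simp
      then show ?case
        using submodule_sum[OF IH(1) U(1)[OF UU(1)]] IH(2)
          dim_part_direct_sum[OF IH(1) U(1)[OF UU(1)] U(2)[OF UU(1)] disj]
        unfolding D_insert by simp
    qed
    from this[OF fin subset_refl]
    have "fs.dim (part e (D \<U>)) = card {U \<in> \<U>. module_iso R (M\<lparr>carrier := U\<rparr>) S}" "submodule (D \<U>) R M"
      by auto
    moreover have "D \<U> = carrier M"
    proof
      show "carrier M \<subseteq> D \<U>"
        unfolding D_def using ex by (fastforce dest: PiE_mem)
    qed (use \<open>submodule (D \<U>) R M\<close> submoduleD(1) in blast)
    ultimately show ?thesis by simp
  qed
  show ?thesis
    unfolding constituent_multiplicity_def
  proof (rule the_equality)
    show "\<exists>\<U>. simple_decomposition R M \<U> \<and>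
        fs.dim (part e (carrier M)) = card {U \<in> \<U>. module_iso R (M\<lparr>carrier := U\<rparr>) S}"
    proof -
      obtain \<U> where \<U>: "simple_decomposition R M \<U>"
        using exists by (rule exE)
      show ?thesis
        by (intro exI[of _ \<U>] conjI \<U> count[OF \<U>, symmetric])
    qed
  next
    fix m assume "\<exists>\<U>. simple_decomposition R M \<U> \<and>
        m = card {U \<in> \<U>. module_iso R (M\<lparr>carrier := U\<rparr>) S}"
    then show "m = fs.dim (part e (carrier M))"
      using count by (elim exE conjE) simp
  qed
qed

end

section \<open>Category algebras and group algebras\<close>

text \<open>A small category given by its morphisms only. Associativity in terms of \<open>Option.bind\<close> covers the
  case that one of the compositions is not defined.\<close>

locale finite_category =
  fixes C :: "'m set" and cmp :: "'m \<Rightarrow> 'm \<Rightarrow> 'm option" and I :: "'m set"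
  assumes finite_C: "finite C" and I_C: "I \<subseteq> C"
    and cmp_closed: "\<lbrakk>x \<in> C; y \<in> C; cmp x y = Some z\<rbrakk> \<Longrightarrow> z \<in> C"
    and cmp_assoc: "\<lbrakk>x \<in> C; y \<in> C; z \<in> C\<rbrakk> \<Longrightarrow>
      Option.bind (cmp x y) (\<lambda>w. cmp w z) = Option.bind (cmp y z) (\<lambda>w. cmp x w)"
    and left_identity: "m \<in> C \<Longrightarrow> \<exists>i\<in>I. \<forall>j\<in>I. cmp j m = (if j = i then Some m else None)"
    and right_identity: "m \<in> C \<Longrightarrow> \<exists>i\<in>I. \<forall>j\<in>I. cmp m j = (if j = i then Some m else None)"
begin

abbreviation (input) "A \<equiv> category_algebra C cmp I"

lemma algebra_simps:
  "carrier A = {a. \<forall>m. m \<notin> C \<longrightarrow> a m = 0}"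
  "\<zero>\<^bsub>A\<^esub> = 0" "\<one>\<^bsub>A\<^esub> = (\<lambda>m. of_bool (m \<in> I))" "a \<oplus>\<^bsub>A\<^esub> b = a + b"
  by (auto simp: category_algebra_def fun_eq_iff)

lemma mult_apply:
  "(a \<otimes>\<^bsub>A\<^esub> b) m = (\<Sum>x\<in>C. \<Sum>y\<in>C. of_bool (cmp x y = Some m) * (a x * b y))"
proof -
  have "(a \<otimes>\<^bsub>A\<^esub> b) m = (\<Sum>(x, y)\<in>{p \<in> C \<times> C. cmp (fst p) (snd p) = Some m}. a x * b y)"
    by (auto simp: category_algebra_def intro!: sum.cong)
  also have "\<dots> = (\<Sum>(x, y)\<in>C \<times> C. of_bool (cmp x y = Some m) * (a x * b y))"
    using finite_C by (intro sum.mono_neutral_cong_left) auto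
  finally show ?thesis
    by (simp add: sum.cartesian_product)
qed

lemma mult_closed: "a \<otimes>\<^bsub>A\<^esub> b \<in> carrier A"
proof -
  have "(a \<otimes>\<^bsub>A\<^esub> b) m = 0" if m: "m \<notin> C" for m
    unfolding mult_apply
  proof (intro sum.neutral ballI)
    fix x y assume "x \<in> C" "y \<in> C"
    then have "cmp x y \<noteq> Some m" using cmp_closed m by blast
    then show "of_bool (cmp x y = Some m) * (a x * b y) = 0" by simp
  qed
  then show ?thesis by (simp add: algebra_simps(1))
qed

lemma mult_add_left: "(a + b) \<otimes>\<^bsub>A\<^esub> c = a \<otimes>\<^bsub>A\<^esub> c + b \<otimes>\<^bsub>A\<^esub> c"
  by (rule ext) (simp add: mult_apply sum.distrib[symmetric] Rings.ring_distribs)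

lemma mult_add_right: "c \<otimes>\<^bsub>A\<^esub> (a + b) = c \<otimes>\<^bsub>A\<^esub> a + c \<otimes>\<^bsub>A\<^esub> b"
  by (rule ext) (simp add: mult_apply sum.distrib[symmetric] Rings.ring_distribs)

lemma mult_fscale_left: "fscale k a \<otimes>\<^bsub>A\<^esub> b = fscale k (a \<otimes>\<^bsub>A\<^esub> b)"
  by (rule ext) (simp add: mult_apply sum_distrib_left fscale_apply mult_ac)

lemma mult_fscale_right: "a \<otimes>\<^bsub>A\<^esub> fscale k b = fscale k (a \<otimes>\<^bsub>A\<^esub> b)"
  by (rule ext) (simp add: mult_apply sum_distrib_left fscale_apply mult_ac)

lemma mult_linear: "Vector_Spaces.linear fscale fscale (\<lambda>b. a \<otimes>\<^bsub>A\<^esub> b)"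
  by (simp add: Vector_Spaces.linear_iff fs.vector_space_axioms mult_add_right mult_fscale_right)

text \<open>Each side sums \<open>a x * b y * c z\<close> over the triples that compose to \<open>m\<close>; summing over the
  intermediate morphism \<open>w\<close> turns two compositions into a \<open>bind\<close>.\<close>

lemma mult_assoc: "(a \<otimes>\<^bsub>A\<^esub> b) \<otimes>\<^bsub>A\<^esub> c = a \<otimes>\<^bsub>A\<^esub> (b \<otimes>\<^bsub>A\<^esub> c)"
proof
  fix m
  have bind_sum: "(\<Sum>w\<in>C. of_bool (f = Some w) * of_bool (g w = Some m)) =
      (of_bool (Option.bind f g = Some m) :: complex)" if "\<And>w. f = Some w \<Longrightarrow> w \<in> C"
    for f :: "'m option" and g :: "'m \<Rightarrow> 'm option"
  proof (cases f)
    case (Some v)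
    then have "(\<Sum>w\<in>C. of_bool (f = Some w) * of_bool (g w = Some m)) =
        (\<Sum>w\<in>C. if w = v then of_bool (g v = Some m) else (0 :: complex))"
      by (intro sum.cong) auto
    then show ?thesis using Some that[of v] finite_C by simp
  qed simp
  have "((a \<otimes>\<^bsub>A\<^esub> b) \<otimes>\<^bsub>A\<^esub> c) m = (\<Sum>w\<in>C. \<Sum>z\<in>C. \<Sum>x\<in>C. \<Sum>y\<in>C.
      of_bool (cmp w z = Some m) * (of_bool (cmp x y = Some w) * (a x * b y) * c z))"
    by (simp add: mult_apply sum_distrib_left sum_distrib_right)
  also have "\<dots> = (\<Sum>z\<in>C. \<Sum>w\<in>C. \<Sum>x\<in>C. \<Sum>y\<in>C.
      of_bool (cmp w z = Some m) * (of_bool (cmp x y = Some w) * (a x * b y) * c z))"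
    by (rule sum.swap)
  also have "\<dots> = (\<Sum>z\<in>C. \<Sum>x\<in>C. \<Sum>w\<in>C. \<Sum>y\<in>C.
      of_bool (cmp w z = Some m) * (of_bool (cmp x y = Some w) * (a x * b y) * c z))"
    by (intro sum.cong refl sum.swap)
  also have "\<dots> = (\<Sum>z\<in>C. \<Sum>x\<in>C. \<Sum>y\<in>C. \<Sum>w\<in>C.
      of_bool (cmp w z = Some m) * (of_bool (cmp x y = Some w) * (a x * b y) * c z))"
    by (intro sum.cong refl sum.swap)
  also have "\<dots> = (\<Sum>z\<in>C. \<Sum>x\<in>C. \<Sum>y\<in>C.
      (\<Sum>w\<in>C. of_bool (cmp x y = Some w) * of_bool (cmp w z = Some m)) * (a x * b y * c z))"
    by (simp add: sum_distrib_left sum_distrib_right mult_ac)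
  also have "\<dots> = (\<Sum>z\<in>C. \<Sum>x\<in>C. \<Sum>y\<in>C.
      of_bool (Option.bind (cmp x y) (\<lambda>w. cmp w z) = Some m) * (a x * b y * c z))"
    using cmp_closed by (intro sum.cong refl arg_cong2[of _ _ _ _ "(*)"] bind_sum) blast
  also have "\<dots> = (\<Sum>x\<in>C. \<Sum>z\<in>C. \<Sum>y\<in>C.
      of_bool (Option.bind (cmp x y) (\<lambda>w. cmp w z) = Some m) * (a x * b y * c z))"
    by (rule sum.swap)
  also have "\<dots> = (\<Sum>x\<in>C. \<Sum>y\<in>C. \<Sum>z\<in>C.
      of_bool (Option.bind (cmp x y) (\<lambda>w. cmp w z) = Some m) * (a x * b y * c z))"
    by (intro sum.cong refl sum.swap)
  also have "\<dots> = (\<Sum>x\<in>C. \<Sum>y\<in>C. \<Sum>z\<in>C.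
      of_bool (Option.bind (cmp y z) (\<lambda>w. cmp x w) = Some m) * (a x * b y * c z))"
    using cmp_assoc by (intro sum.cong refl) simp
  also have "\<dots> = (\<Sum>x\<in>C. \<Sum>y\<in>C. \<Sum>z\<in>C.
      (\<Sum>w\<in>C. of_bool (cmp y z = Some w) * of_bool (cmp x w = Some m)) * (a x * b y * c z))"
    using cmp_closed by (intro sum.cong refl arg_cong2[of _ _ _ _ "(*)"] bind_sum[symmetric]) blast
  also have "\<dots> = (\<Sum>x\<in>C. \<Sum>y\<in>C. \<Sum>z\<in>C. \<Sum>w\<in>C.
      of_bool (cmp x w = Some m) * (a x * (of_bool (cmp y z = Some w) * (b y * c z))))"
    by (simp add: sum_distrib_left sum_distrib_right mult_ac)
  also have "\<dots> = (\<Sum>x\<in>C. \<Sum>y\<in>C. \<Sum>w\<in>C. \<Sum>z\<in>C.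
      of_bool (cmp x w = Some m) * (a x * (of_bool (cmp y z = Some w) * (b y * c z))))"
    by (intro sum.cong refl sum.swap)
  also have "\<dots> = (\<Sum>x\<in>C. \<Sum>w\<in>C. \<Sum>y\<in>C. \<Sum>z\<in>C.
      of_bool (cmp x w = Some m) * (a x * (of_bool (cmp y z = Some w) * (b y * c z))))"
    by (intro sum.cong refl sum.swap)
  also have "\<dots> = (a \<otimes>\<^bsub>A\<^esub> (b \<otimes>\<^bsub>A\<^esub> c)) m"
    by (simp add: mult_apply sum_distrib_left)
  finally show "((a \<otimes>\<^bsub>A\<^esub> b) \<otimes>\<^bsub>A\<^esub> c) m = (a \<otimes>\<^bsub>A\<^esub> (b \<otimes>\<^bsub>A\<^esub> c)) m" .
qed

lemma one_mult:
  assumes "a \<in> carrier A" shows "\<one>\<^bsub>A\<^esub> \<otimes>\<^bsub>A\<^esub> a = a"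
proof
  fix m
  have "(\<one>\<^bsub>A\<^esub> \<otimes>\<^bsub>A\<^esub> a) m = (\<Sum>y\<in>C. \<Sum>x\<in>C. of_bool (cmp x y = Some m) * (of_bool (x \<in> I) * a y))"
    unfolding mult_apply algebra_simps by (rule sum.swap)
  also have "\<dots> = (\<Sum>y\<in>C. if y = m then a m else 0)"
  proof (rule sum.cong[OF refl])
    fix y assume "y \<in> C"
    then obtain i where i: "i \<in> I" "\<And>j. j \<in> I \<Longrightarrow> cmp j y = (if j = i then Some y else None)"
      using left_identity by blast
    have "(\<Sum>x\<in>C. of_bool (cmp x y = Some m) * (of_bool (x \<in> I) * a y)) =
        (\<Sum>x\<in>C. if x = i then (if y = m then a m else 0) else 0)"
      using i by (intro sum.cong) (auto split: if_splits)
    then show "(\<Sum>x\<in>C. of_bool (cmp x y = Some m) * (of_bool (x \<in> I) * a y)) = (if y = m then a m else 0)"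
      using finite_C i(1) I_C by auto
  qed
  finally show "(\<one>\<^bsub>A\<^esub> \<otimes>\<^bsub>A\<^esub> a) m = a m"
    using assms finite_C by (simp add: algebra_simps)
qed

lemma mult_one:
  assumes "a \<in> carrier A" shows "a \<otimes>\<^bsub>A\<^esub> \<one>\<^bsub>A\<^esub> = a"
proof
  fix m
  have "(a \<otimes>\<^bsub>A\<^esub> \<one>\<^bsub>A\<^esub>) m = (\<Sum>x\<in>C. \<Sum>y\<in>C. of_bool (cmp x y = Some m) * (a x * of_bool (y \<in> I)))"
    unfolding mult_apply algebra_simps ..
  also have "\<dots> = (\<Sum>x\<in>C. if x = m then a m else 0)"
  proof (rule sum.cong[OF refl])
    fix x assume "x \<in> C"
    then obtain i where i: "i \<in> I" "\<And>j. j \<in> I \<Longrightarrow> cmp x j = (if j = i then Some x else None)"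
      using right_identity by blast
    have "(\<Sum>y\<in>C. of_bool (cmp x y = Some m) * (a x * of_bool (y \<in> I))) =
        (\<Sum>y\<in>C. if y = i then (if x = m then a m else 0) else 0)"
      using i by (intro sum.cong) (auto split: if_splits)
    then show "(\<Sum>y\<in>C. of_bool (cmp x y = Some m) * (a x * of_bool (y \<in> I))) = (if x = m then a m else 0)"
      using finite_C i(1) I_C by auto
  qed
  finally show "(a \<otimes>\<^bsub>A\<^esub> \<one>\<^bsub>A\<^esub>) m = a m"
    using assms finite_C by (simp add: algebra_simps)
qed

lemma one_closed: "\<one>\<^bsub>A\<^esub> \<in> carrier A"
  using I_C by (auto simp: algebra_simps)

lemma algebra_ring: "ring A"
proof (rule ringI)
  show "abelian_group A"
  proof (rule abelian_groupI)
    fix x assume "x \<in> carrier A"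
    then have "- x \<in> carrier A" "(- x) \<oplus>\<^bsub>A\<^esub> x = \<zero>\<^bsub>A\<^esub>"
      unfolding algebra_simps by auto
    then show "\<exists>y\<in>carrier A. y \<oplus>\<^bsub>A\<^esub> x = \<zero>\<^bsub>A\<^esub>" by blast
  qed (simp_all add: algebra_simps add_ac)
  show "monoid A"
    by (rule monoidI) (simp_all add: mult_closed one_closed mult_assoc one_mult mult_one)
qed (simp_all add: algebra_simps(4) mult_add_left mult_add_right)

definition scalar :: "complex \<Rightarrow> 'm \<Rightarrow> complex" where
  "scalar c = fscale c \<one>\<^bsub>A\<^esub>"

lemma scalar_mult: "a \<in> carrier A \<Longrightarrow> scalar c \<otimes>\<^bsub>A\<^esub> a = fscale c a"
  by (simp add: scalar_def mult_fscale_left one_mult)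

lemma algebra_complex_algebra: "complex_algebra A scalar"
proof (intro complex_algebra.intro algebra_ring complex_algebra_axioms.intro)
  fix c d
  show closed: "scalar c \<in> carrier A" for c
    using one_closed by (simp add: scalar_def algebra_simps(1) fscale_apply)
  show "scalar 0 = \<zero>\<^bsub>A\<^esub>" by (simp add: scalar_def algebra_simps(2))
  show "scalar 1 = \<one>\<^bsub>A\<^esub>" by (simp add: scalar_def)
  show "scalar (c * d) = scalar c \<otimes>\<^bsub>A\<^esub> scalar d"
    using scalar_mult[OF closed, of c d] by (simp add: scalar_def)
  fix a assume a: "a \<in> carrier A"
  then show "scalar c \<otimes>\<^bsub>A\<^esub> a = a \<otimes>\<^bsub>A\<^esub> scalar c"
    unfolding scalar_mult[OF a] by (simp add: scalar_def mult_fscale_right mult_one)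
qed

lemma left_ideal_function_module:
  assumes e: "e \<in> carrier A"
  shows "function_module A scalar (left_ideal_module A e)"
proof -
  interpret complex_algebra A scalar by (rule algebra_complex_algebra)
  have "finite_dimensional (carrier (left_ideal_module A e))"
    using finite_dimensional_supported[OF finite_C] left_ideal_module_subset[OF e]
    unfolding algebra_simps(1) by (rule finite_dimensional_mono)
  moreover have "carrier (left_ideal_module A e) \<subseteq> carrier A"
    by (rule left_ideal_module_subset[OF e])
  ultimately show ?thesis
    by (intro function_module.intro function_module_axioms.intro algebra_complex_algebra
        left_ideal_module_left_module[OF e])
      (auto simp: left_ideal_module_simps(2-4) algebra_simps(2,4) scalar_mult)
qed

end

subsection \<open>Permutation modules\<close>

locale finite_group = group G for G (structure) +
  assumes finite_carrier: "finite (carrier G)"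
begin

abbreviation (input) "CG \<equiv> group_algebra G"

sublocale finite_category "carrier G" "\<lambda>g h. Some (g \<otimes> h)" "{\<one>}"
  rewrites "category_algebra (carrier G) (\<lambda>g h. Some (g \<otimes> h)) {\<one>} = group_algebra G"
  by unfold_locales (auto simp: finite_carrier m_assoc group_algebra_def)

lemma group_mult_apply:
  assumes "m \<in> carrier G"
  shows "(a \<otimes>\<^bsub>CG\<^esub> b) m = (\<Sum>x\<in>carrier G. a x * b (inv x \<otimes> m))"
  unfolding mult_apply
proof (rule sum.cong[OF refl])
  fix x assume x: "x \<in> carrier G"
  have "(\<Sum>y\<in>carrier G. of_bool (Some (x \<otimes> y) = Some m) * (a x * b y)) =
      (\<Sum>y\<in>carrier G. if y = inv x \<otimes> m then a x * b (inv x \<otimes> m) else 0)"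
  proof (rule sum.cong[OF refl])
    fix y assume y: "y \<in> carrier G"
    have "x \<otimes> y = m \<longleftrightarrow> y = inv x \<otimes> m"
      using inv_solve_left[OF y x assms] x y assms by auto
    then show "of_bool (Some (x \<otimes> y) = Some m) * (a x * b y) =
        (if y = inv x \<otimes> m then a x * b (inv x \<otimes> m) else 0)" by auto
  qed
  then show "(\<Sum>y\<in>carrier G. of_bool (Some (x \<otimes> y) = Some m) * (a x * b y)) = a x * b (inv x \<otimes> m)"
    using finite_carrier x assms by simp
qed

lemma basis_vector_closed: "g \<in> carrier G \<Longrightarrow> basis_vector g \<in> carrier CG"
  by (auto simp: algebra_simps basis_vector_def)

lemma one_is_basis_vector: "\<one>\<^bsub>CG\<^esub> = basis_vector \<one>"
  by (auto simp: algebra_simps basis_vector_def)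

end

locale permutation_action = finite_group +
  fixes X :: "'x set" and act
  assumes act_closed: "g \<in> carrier G \<Longrightarrow> x \<in> X \<Longrightarrow> act g x \<in> X"
    and act_one: "x \<in> X \<Longrightarrow> act \<one> x = x"
    and act_mult: "g \<in> carrier G \<Longrightarrow> h \<in> carrier G \<Longrightarrow> x \<in> X \<Longrightarrow> act (g \<otimes> h) x = act g (act h x)"
begin

abbreviation (input) "CX \<equiv> permutation_module G X act"

lemma act_eq_iff:
  assumes "g \<in> carrier G" "x \<in> X" "y \<in> X"
  shows "act g x = y \<longleftrightarrow> x = act (inv g) y"
proof
  show "act g x = y \<Longrightarrow> x = act (inv g) y"
    using act_mult[of "inv g" g x] act_one assms by auto
  show "x = act (inv g) y \<Longrightarrow> act g x = y"
    using act_mult[of g "inv g" y] act_one assms by auto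
qed

lemma permutation_module_simps:
  "carrier CX = {v. finite {x. v x \<noteq> 0} \<and> (\<forall>x. x \<notin> X \<longrightarrow> v x = 0)}"
  "\<zero>\<^bsub>CX\<^esub> = 0" "v \<oplus>\<^bsub>CX\<^esub> w = v + w"
  by (auto simp: permutation_module_def fun_eq_iff)

text \<open>As the group acts by bijections, the sum over preimages in the definition has at most one term.
  This form is valid for infinite \<open>X\<close> as well.\<close>

lemma smult_apply:
  "(a \<odot>\<^bsub>CX\<^esub> v) y = (if y \<in> X then \<Sum>g\<in>carrier G. a g * v (act (inv g) y) else 0)"
proof -
  have "(a \<odot>\<^bsub>CX\<^esub> v) y = (\<Sum>g\<in>carrier G. \<Sum>x\<in>{x\<in>X. v x \<noteq> 0 \<and> act g x = y}. a g * v x)"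
    by (simp add: permutation_module_def)
  also have "\<dots> = (\<Sum>g\<in>carrier G. if y \<in> X then a g * v (act (inv g) y) else 0)"
  proof (rule sum.cong[OF refl])
    fix g assume g: "g \<in> carrier G"
    show "(\<Sum>x\<in>{x\<in>X. v x \<noteq> 0 \<and> act g x = y}. a g * v x) = (if y \<in> X then a g * v (act (inv g) y) else 0)"
    proof (cases "y \<in> X")
      case True
      then have "{x\<in>X. v x \<noteq> 0 \<and> act g x = y} = (if v (act (inv g) y) \<noteq> 0 then {act (inv g) y} else {})"
        using act_eq_iff[OF g] act_closed g by auto
      then show ?thesis using True by auto
    next
      case False
      then have "{x\<in>X. v x \<noteq> 0 \<and> act g x = y} = {}"
        using act_closed g by auto
      then show ?thesis using False by (simp only: sum.empty if_False)
    qed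
  qed
  finally show ?thesis by simp
qed

lemma smult_basis_vector:
  assumes "g \<in> carrier G" "x \<in> X"
  shows "basis_vector g \<odot>\<^bsub>CX\<^esub> basis_vector x = basis_vector (act g x)"
proof
  fix y
  have "(\<Sum>h\<in>carrier G. basis_vector g h * basis_vector x (act (inv h) y)) = 
      (\<Sum>h\<in>carrier G. if h = g then basis_vector x (act (inv g) y) else 0)"
    by (intro sum.cong) (auto simp: basis_vector_def)
  then show "(basis_vector g \<odot>\<^bsub>CX\<^esub> basis_vector x) y = basis_vector (act g x) y"
    using assms finite_carrier act_eq_iff[OF assms, of y] act_closed[OF assms]
    by (auto simp: smult_apply basis_vector_def)
qed

lemma smult_closed_pm:
  assumes "v \<in> carrier CX" shows "a \<odot>\<^bsub>CX\<^esub> v \<in> carrier CX"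
proof -
  have "{y. (a \<odot>\<^bsub>CX\<^esub> v) y \<noteq> 0} \<subseteq> (\<Union>g\<in>carrier G. act g ` {x \<in> X. v x \<noteq> 0})"
  proof
    fix y assume "y \<in> {y. (a \<odot>\<^bsub>CX\<^esub> v) y \<noteq> 0}"
    then have y: "y \<in> X" "(\<Sum>g\<in>carrier G. a g * v (act (inv g) y)) \<noteq> 0"
      by (auto simp: smult_apply split: if_splits)
    then obtain g where g: "g \<in> carrier G" "v (act (inv g) y) \<noteq> 0"
      by (metis (no_types, lifting) mult_zero_right sum.neutral)
    then have "act g (act (inv g) y) = y"
      using act_eq_iff[of g "act (inv g) y" y] act_closed y(1) by auto
    then show "y \<in> (\<Union>g\<in>carrier G. act g ` {x \<in> X. v x \<noteq> 0})"
      using g act_closed[of "inv g" y] y(1) by (intro UN_I[of g] image_eqI[of _ _ "act (inv g) y"]) auto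
  qed
  moreover have "finite (\<Union>g\<in>carrier G. act g ` {x \<in> X. v x \<noteq> 0})"
    using assms finite_carrier by (auto simp: permutation_module_simps)
  ultimately have "finite {y. (a \<odot>\<^bsub>CX\<^esub> v) y \<noteq> 0}"
    by (rule finite_subset)
  moreover have "(a \<odot>\<^bsub>CX\<^esub> v) y = 0" if "y \<notin> X" for y
    using that by (simp add: smult_apply)
  ultimately show ?thesis
    unfolding permutation_module_simps by blast
qed

lemma scalar_smult:
  assumes "v \<in> carrier CX" shows "scalar c \<odot>\<^bsub>CX\<^esub> v = fscale c v"
proof
  fix y
  have "(\<Sum>g\<in>carrier G. scalar c g * v (act (inv g) y)) =
      (\<Sum>g\<in>carrier G. if g = \<one> then c * v (act \<one> y) else 0)"
    by (intro sum.cong) (auto simp: scalar_def algebra_simps fscale_apply)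
  then show "(scalar c \<odot>\<^bsub>CX\<^esub> v) y = fscale c v y"
    using assms finite_carrier act_one by (auto simp: smult_apply fscale_apply permutation_module_simps)
qed

lemma permutation_left_module: "left_module CG CX"
proof (intro left_module.intro left_module_axioms.intro)
  show "ring CG" by (rule algebra_ring)
  show "abelian_group CX"
  proof (rule abelian_groupI)
    fix v w assume vw: "v \<in> carrier CX" "w \<in> carrier CX"
    have "{x. (v + w) x \<noteq> 0} \<subseteq> {x. v x \<noteq> 0} \<union> {x. w x \<noteq> 0}"
      by auto
    moreover have "finite ({x. v x \<noteq> 0} \<union> {x. w x \<noteq> 0})"
      using vw unfolding permutation_module_simps by blast
    ultimately have "finite {x. (v + w) x \<noteq> 0}"
      by (rule finite_subset)
    then show "v \<oplus>\<^bsub>CX\<^esub> w \<in> carrier CX"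
      using vw by (simp add: permutation_module_simps)
  next
    fix v assume "v \<in> carrier CX"
    then have "- v \<in> carrier CX" "(- v) \<oplus>\<^bsub>CX\<^esub> v = \<zero>\<^bsub>CX\<^esub>"
      by (auto simp: permutation_module_simps)
    then show "\<exists>w\<in>carrier CX. w \<oplus>\<^bsub>CX\<^esub> v = \<zero>\<^bsub>CX\<^esub>" by blast
  qed (simp_all add: permutation_module_simps add_ac)
next
  fix a b v w assume vw: "v \<in> carrier CX" "w \<in> carrier CX"
  show "a \<odot>\<^bsub>CX\<^esub> v \<in> carrier CX" by (rule smult_closed_pm[OF vw(1)])
  show "(a \<oplus>\<^bsub>CG\<^esub> b) \<odot>\<^bsub>CX\<^esub> v = a \<odot>\<^bsub>CX\<^esub> v \<oplus>\<^bsub>CX\<^esub> b \<odot>\<^bsub>CX\<^esub> v"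
    by (rule ext) (simp add: smult_apply permutation_module_simps algebra_simps(4) sum.distrib[symmetric] Rings.ring_distribs)
  show "a \<odot>\<^bsub>CX\<^esub> (v \<oplus>\<^bsub>CX\<^esub> w) = a \<odot>\<^bsub>CX\<^esub> v \<oplus>\<^bsub>CX\<^esub> a \<odot>\<^bsub>CX\<^esub> w"
    by (rule ext) (simp add: smult_apply permutation_module_simps sum.distrib[symmetric] Rings.ring_distribs)
  show "\<one>\<^bsub>CG\<^esub> \<odot>\<^bsub>CX\<^esub> v = v"
    using scalar_smult[OF vw(1), of 1] by (simp add: scalar_def)
  show "(a \<otimes>\<^bsub>CG\<^esub> b) \<odot>\<^bsub>CX\<^esub> v = a \<odot>\<^bsub>CX\<^esub> (b \<odot>\<^bsub>CX\<^esub> v)"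
  proof
    fix y
    show "((a \<otimes>\<^bsub>CG\<^esub> b) \<odot>\<^bsub>CX\<^esub> v) y = (a \<odot>\<^bsub>CX\<^esub> (b \<odot>\<^bsub>CX\<^esub> v)) y"
    proof (cases "y \<in> X")
      case True
      have "((a \<otimes>\<^bsub>CG\<^esub> b) \<odot>\<^bsub>CX\<^esub> v) y =
          (\<Sum>m\<in>carrier G. \<Sum>x\<in>carrier G. a x * b (inv x \<otimes> m) * v (act (inv m) y))"
        using True by (simp add: smult_apply group_mult_apply sum_distrib_right)
      also have "\<dots> = (\<Sum>x\<in>carrier G. \<Sum>m\<in>carrier G. a x * b (inv x \<otimes> m) * v (act (inv m) y))"
        by (rule sum.swap)
      also have "\<dots> = (\<Sum>x\<in>carrier G. \<Sum>h\<in>carrier G. a x * (b h * v (act (inv h) (act (inv x) y))))"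
      proof (rule sum.cong[OF refl])
        fix x assume x: "x \<in> carrier G"
        show "(\<Sum>m\<in>carrier G. a x * b (inv x \<otimes> m) * v (act (inv m) y)) =
            (\<Sum>h\<in>carrier G. a x * (b h * v (act (inv h) (act (inv x) y))))"
        proof (rule sum.reindex_bij_witness[of _ "\<lambda>h. x \<otimes> h" "\<lambda>m. inv x \<otimes> m"])
          fix m assume m: "m \<in> carrier G"
          have "act (inv (inv x \<otimes> m)) (act (inv x) y) = act (inv m) y"
            using act_mult[of "inv (inv x \<otimes> m)" "inv x" y] m x True
            by (simp add: inv_mult_group m_assoc)
          then show "a x * (b (inv x \<otimes> m) * v (act (inv (inv x \<otimes> m)) (act (inv x) y))) =
              a x * b (inv x \<otimes> m) * v (act (inv m) y)" by simp
        qed (use x in \<open>simp_all add: m_assoc[symmetric]\<close>)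
      qed
      also have "\<dots> = (a \<odot>\<^bsub>CX\<^esub> (b \<odot>\<^bsub>CX\<^esub> v)) y"
        using True act_closed by (simp add: smult_apply sum_distrib_left)
      finally show ?thesis .
    qed (simp add: smult_apply)
  qed
qed

end

subsection \<open>The invariant hermitian form\<close>

context finite_group
begin

text \<open>The adjoint of the action of \<open>a\<close> with respect to the hermitian form below.\<close>

definition adj :: "('a \<Rightarrow> complex) \<Rightarrow> 'a \<Rightarrow> complex" where
  "adj a = (\<lambda>g. if g \<in> carrier G then cnj (a (inv g)) else 0)"

lemma adj_closed: "adj a \<in> carrier CG"
  by (simp add: adj_def algebra_simps)

lemma adj_adj: "a \<in> carrier CG \<Longrightarrow> adj (adj a) = a"
  by (auto simp: adj_def algebra_simps fun_eq_iff)

end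

definition hform :: "'x set \<Rightarrow> ('x \<Rightarrow> complex) \<Rightarrow> ('x \<Rightarrow> complex) \<Rightarrow> complex" where
  "hform X v w = (\<Sum>x\<in>X. v x * cnj (w x))"

lemma hform_self_eq_0:
  assumes "finite X" "hform X v v = 0" "x \<in> X" shows "v x = 0"
proof -
  have "complex_of_real (\<Sum>x\<in>X. (cmod (v x))\<^sup>2) = hform X v v"
    unfolding hform_def of_real_sum by (intro sum.cong refl complex_norm_square)
  then have "(\<Sum>x\<in>X. (cmod (v x))\<^sup>2) = 0"
    using assms(2) by (metis of_real_eq_0_iff)
  then show ?thesis
    using assms by (simp add: sum_nonneg_eq_0_iff)
qed

locale finite_permutation_action = permutation_action +
  assumes finite_X: "finite X"
begin

lemma hform_adj: "hform X (a \<odot>\<^bsub>CX\<^esub> v) w = hform X v (adj a \<odot>\<^bsub>CX\<^esub> w)"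
proof -
  have "hform X (a \<odot>\<^bsub>CX\<^esub> v) w = (\<Sum>y\<in>X. \<Sum>g\<in>carrier G. a g * v (act (inv g) y) * cnj (w y))"
    by (simp add: hform_def smult_apply sum_distrib_right)
  also have "\<dots> = (\<Sum>g\<in>carrier G. \<Sum>y\<in>X. a g * v (act (inv g) y) * cnj (w y))"
    by (rule sum.swap)
  also have "\<dots> = (\<Sum>g\<in>carrier G. \<Sum>x\<in>X. a g * v x * cnj (w (act g x)))"
  proof (rule sum.cong[OF refl])
    fix g assume g: "g \<in> carrier G"
    show "(\<Sum>y\<in>X. a g * v (act (inv g) y) * cnj (w y)) = (\<Sum>x\<in>X. a g * v x * cnj (w (act g x)))"
      by (rule sum.reindex_bij_witness[of _ "act g" "act (inv g)"])
        (use g act_closed act_mult[of g "inv g"] act_mult[of "inv g" g] act_one in \<open>auto simp: r_inv l_inv\<close>)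
  qed
  also have "\<dots> = (\<Sum>g\<in>carrier G. \<Sum>x\<in>X. a (inv g) * v x * cnj (w (act (inv g) x)))"
    by (rule sum.reindex_bij_witness[of _ "\<lambda>g. inv g" "\<lambda>g. inv g"]) auto
  also have "\<dots> = (\<Sum>x\<in>X. \<Sum>g\<in>carrier G. a (inv g) * v x * cnj (w (act (inv g) x)))"
    by (rule sum.swap)
  also have "\<dots> = hform X v (adj a \<odot>\<^bsub>CX\<^esub> w)"
    by (simp add: hform_def smult_apply adj_def sum_distrib_left mult_ac)
  finally show ?thesis .
qed

lemma permutation_function_module: "function_module CG scalar CX"
  by (intro function_module.intro function_module_axioms.intro algebra_complex_algebra permutation_left_module
      scalar_smult permutation_module_simps finite_dimensional_mono[OF finite_dimensional_supported[OF finite_X]])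
    (auto simp: permutation_module_simps)

text \<open>Maschke's theorem: the orthogonal complement of a submodule is a submodule, since the adjoint
  of an operator from the group algebra is again one.\<close>

theorem submodule_complement:
  assumes N: "submodule N CG CX"
  shows "\<exists>K. submodule K CG CX \<and> N \<inter> K = {0} \<and> (\<forall>x\<in>carrier CX. \<exists>y\<in>N. x - y \<in> K)"
proof -
  interpret function_module CG scalar CX by (rule permutation_function_module)
  note ND = submoduleD[OF N]
  define K where "K = {v \<in> carrier CX. \<forall>w\<in>N. hform X v w = 0}"
  have "submodule K CG CX"
  proof (rule submodule_of_closed)
    show "\<zero>\<^bsub>CX\<^esub> \<in> K"
      using M.zero_closed by (auto simp: K_def permutation_module_simps(2) hform_def)
  next
    fix v w assume "v \<in> K" "w \<in> K"
    then show "v \<oplus>\<^bsub>CX\<^esub> w \<in> K"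
      using M.a_closed[of v w] by (auto simp: K_def permutation_module_simps(3) hform_def distrib_right sum.distrib)
  next
    fix a v assume "a \<in> carrier CG" "v \<in> K"
    then show "a \<odot>\<^bsub>CX\<^esub> v \<in> K"
      using ND(4)[OF adj_closed] smult_closed_pm by (auto simp: K_def hform_adj)
  qed (auto simp: K_def)
  moreover have "N \<inter> K = {0}"
  proof
    show "{0} \<subseteq> N \<inter> K"
      using ND(2) submoduleD(2)[OF \<open>submodule K CG CX\<close>] by (simp add: permutation_module_simps(2))
    show "N \<inter> K \<subseteq> {0}"
    proof
      fix v assume v: "v \<in> N \<inter> K"
      then have "hform X v v = 0" by (simp add: K_def)
      then have "v x = 0" for x
        using hform_self_eq_0[OF finite_X, of v x] v by (cases "x \<in> X") (auto simp: K_def permutation_module_simps(1))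
      then show "v \<in> {0}" by (auto simp: fun_eq_iff)
    qed
  qed
  moreover have "\<exists>y\<in>N. x - y \<in> K" if x: "x \<in> carrier CX" for x
  proof -
    obtain l where l: "l \<in> N" "\<And>z. z \<in> N \<Longrightarrow> (\<Sum>t\<in>X. (x t - l t) * cnj (z t)) = 0"
    proof (rule orthogonal_decomposition[of X N x])
      show "finite X" by (rule finite_X)
      show "fs.subspace N" by (rule submodule_subspace[OF N])
      show "\<And>v t. v \<in> N \<Longrightarrow> t \<notin> X \<Longrightarrow> v t = 0"
        using ND(1) by (auto simp: permutation_module_simps(1))
    qed (rule that)
    have "x - l \<in> carrier CX"
      using fs.subspace_diff[OF submodule_subspace[OF carrier_submodule] x] l(1) ND(1) by blast
    then have "x - l \<in> K"
      using l(2) by (simp add: K_def hform_def)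
    then show ?thesis using l(1) by blast
  qed
  ultimately show ?thesis by blast
qed

end

section \<open>Primitive idempotents of complex group algebras\<close>

text \<open>Such a module is the image of \<open>Re\<close> under \<open>a \<mapsto> a x\<close>, so the preimage of a submodule is trivial
  or everything.\<close>

lemma (in ring) cyclic_image_of_simple_left_ideal:
  assumes e: "e \<in> carrier R" "e \<otimes> e = e" and simple: "simple_module R (left_ideal_module R e)"
    and M: "left_module R M" and x: "x \<in> carrier M" "e \<odot>\<^bsub>M\<^esub> x = x" "x \<noteq> \<zero>\<^bsub>M\<^esub>"
    and generates: "carrier M = {a \<odot>\<^bsub>M\<^esub> x | a. a \<in> carrier R}"
  shows "simple_module R M"
  unfolding simple_module_def
proof (intro conjI allI impI M)
  interpret M: left_module R M by (rule M)
  let ?P = "left_ideal_module R e"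
  interpret P: left_module R ?P by (rule left_ideal_module_left_module[OF e(1)])
  note PR = subsetD[OF left_ideal_module_subset[OF e(1)]]
  note eP = idempotent_in_left_ideal_module(1)[OF e]
  show "carrier M \<noteq> {\<zero>\<^bsub>M\<^esub>}" using x by blast
  fix N assume "submodule N R M"
  note N = submoduleD[OF this]
  define L where "L = {a \<in> carrier ?P. a \<odot>\<^bsub>M\<^esub> x \<in> N}"
  have "submodule L R ?P"
  proof (rule P.submodule_of_closed)
    show "\<zero>\<^bsub>?P\<^esub> \<in> L"
      using P.M.zero_closed N(2) M.zero_smult[OF x(1)] by (simp add: L_def left_ideal_module_simps(2))
  next
    fix a b assume ab: "a \<in> L" "b \<in> L"
    then have "(a \<oplus> b) \<odot>\<^bsub>M\<^esub> x = a \<odot>\<^bsub>M\<^esub> x \<oplus>\<^bsub>M\<^esub> b \<odot>\<^bsub>M\<^esub> x"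
      using M.smult_l_distr[of a b x] PR x(1) by (simp add: L_def)
    then show "a \<oplus>\<^bsub>?P\<^esub> b \<in> L"
      using ab P.M.a_closed[of a b] N(3) by (simp add: L_def left_ideal_module_simps(3))
  next
    fix a b assume a: "a \<in> carrier R" and b: "b \<in> L"
    then have "(a \<otimes> b) \<odot>\<^bsub>M\<^esub> x = a \<odot>\<^bsub>M\<^esub> (b \<odot>\<^bsub>M\<^esub> x)"
      using M.smult_assoc1[of a b x] PR x(1) by (simp add: L_def)
    then show "a \<odot>\<^bsub>?P\<^esub> b \<in> L"
      using a b P.smult_closed[of a b] N(4) by (simp add: L_def left_ideal_module_simps(4))
  qed (auto simp: L_def)
  then have "L = {\<zero>\<^bsub>?P\<^esub>} \<or> L = carrier ?P"
    using simple by (simp add: simple_module_def)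
  then show "N = {\<zero>\<^bsub>M\<^esub>} \<or> N = carrier M"
  proof
    assume L: "L = {\<zero>\<^bsub>?P\<^esub>}"
    have "y = \<zero>\<^bsub>M\<^esub>" if y: "y \<in> N" for y
    proof -
      obtain a where a: "a \<in> carrier R" "y = a \<odot>\<^bsub>M\<^esub> x"
        using y N(1) unfolding generates by blast
      have y_eq: "(a \<otimes> e) \<odot>\<^bsub>M\<^esub> x = y"
        using a x(1,2) e(1) M.smult_assoc1[of a e x] by simp
      have "a \<otimes> e \<in> carrier ?P"
        unfolding left_ideal_module_simps(1) using a(1) by blast
      then have "a \<otimes> e \<in> L"
        using y y_eq by (simp add: L_def)
      then have "a \<otimes> e = \<zero>"
        using L by (simp add: left_ideal_module_simps(2))
      then show ?thesis
        using y_eq M.zero_smult[OF x(1)] by simp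
    qed
    then show ?thesis using N(2) by blast
  next
    assume "L = carrier ?P"
    then have "e \<in> L" using eP by blast
    then have "e \<odot>\<^bsub>M\<^esub> x \<in> N" unfolding L_def by blast
    then have "x \<in> N" unfolding x(2) .
    then have "carrier M \<subseteq> N"
      unfolding generates using N(4) by blast
    then show ?thesis using N(1) by blast
  qed
qed

context finite_group
begin

sublocale CG: complex_algebra CG scalar
  by (rule algebra_complex_algebra)

lemma regular_action: "finite_permutation_action G (carrier G) (\<lambda>g h. g \<otimes> h)"
  by unfold_locales (auto simp: m_assoc finite_carrier)

text \<open>The group algebra is the permutation module of the regular action, so the hermitian form is
  available on it.\<close>

lemma mult_eq_regular_smult:
  "a \<otimes>\<^bsub>CG\<^esub> b = a \<odot>\<^bsub>permutation_module G (carrier G) (\<lambda>g h. g \<otimes> h)\<^esub> b"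
proof
  fix m
  interpret reg: finite_permutation_action G "carrier G" "\<lambda>g h. g \<otimes> h" by (rule regular_action)
  show "(a \<otimes>\<^bsub>CG\<^esub> b) m = (a \<odot>\<^bsub>permutation_module G (carrier G) (\<lambda>g h. g \<otimes> h)\<^esub> b) m"
    using mult_closed[of a b]
    by (cases "m \<in> carrier G") (simp_all add: reg.smult_apply group_mult_apply algebra_simps(1))
qed

lemma hform_mult: "hform (carrier G) (a \<otimes>\<^bsub>CG\<^esub> v) w = hform (carrier G) v (adj a \<otimes>\<^bsub>CG\<^esub> w)"
proof -
  interpret reg: finite_permutation_action G "carrier G" "\<lambda>g h. g \<otimes> h" by (rule regular_action)
  show ?thesis unfolding mult_eq_regular_smult by (rule reg.hform_adj)
qed

lemma hform_eq_0_imp: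
  assumes "a \<in> carrier CG" "hform (carrier G) a a = 0" shows "a = 0"
proof
  fix g show "a g = 0 g"
    using hform_self_eq_0[OF finite_carrier assms(2), of g] assms(1)
    by (cases "g \<in> carrier G") (auto simp: algebra_simps(1))
qed

text \<open>For \<open>a\<close> in the ideal, \<open>b = a\<^sup>* a\<close> lies in the ideal and is self-adjoint. From \<open>b b = 0\<close> positivity
  of the form gives \<open>b = 0\<close>, and then \<open>a = 0\<close> in the same way.\<close>

lemma nilpotent_left_ideal_trivial:
  assumes N: "N \<subseteq> carrier CG" "\<And>b a. b \<in> carrier CG \<Longrightarrow> a \<in> N \<Longrightarrow> b \<otimes>\<^bsub>CG\<^esub> a \<in> N"
    and nil: "\<And>a b. a \<in> N \<Longrightarrow> b \<in> N \<Longrightarrow> a \<otimes>\<^bsub>CG\<^esub> b = 0"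
    and a: "a \<in> N"
  shows "a = 0"
proof -
  let ?h = "hform (carrier G)"
  have aR: "a \<in> carrier CG" using N(1) a by blast
  define b where "b = adj a \<otimes>\<^bsub>CG\<^esub> a"
  have bN: "b \<in> N" unfolding b_def by (rule N(2)[OF adj_closed a])
  have b_form: "?h (b \<otimes>\<^bsub>CG\<^esub> v) w = ?h (a \<otimes>\<^bsub>CG\<^esub> v) (a \<otimes>\<^bsub>CG\<^esub> w)" for v w
    unfolding b_def mult_assoc by (simp add: hform_mult[of "adj a"] adj_adj[OF aR])
  have b_form': "?h (a \<otimes>\<^bsub>CG\<^esub> v) (a \<otimes>\<^bsub>CG\<^esub> w) = ?h v (b \<otimes>\<^bsub>CG\<^esub> w)" for v w
    unfolding b_def mult_assoc by (rule hform_mult)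
  have one: "c \<otimes>\<^bsub>CG\<^esub> \<one>\<^bsub>CG\<^esub> = c" if "c \<in> N" for c
    using that N(1) mult_one by blast
  have "?h b b = ?h (b \<otimes>\<^bsub>CG\<^esub> \<one>\<^bsub>CG\<^esub>) b" by (simp add: one[OF bN])
  also have "\<dots> = ?h \<one>\<^bsub>CG\<^esub> (b \<otimes>\<^bsub>CG\<^esub> b)" by (simp only: b_form b_form')
  also have "\<dots> = 0" by (simp add: nil[OF bN bN] hform_def)
  finally have b0: "b = 0" using hform_eq_0_imp bN N(1) by blast
  have "?h a a = ?h (a \<otimes>\<^bsub>CG\<^esub> \<one>\<^bsub>CG\<^esub>) (a \<otimes>\<^bsub>CG\<^esub> \<one>\<^bsub>CG\<^esub>)" by (simp add: one[OF a])
  also have "\<dots> = ?h \<one>\<^bsub>CG\<^esub> b" by (simp only: b_form' one[OF bN])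
  also have "\<dots> = 0" by (simp add: b0 hform_def)
  finally show "a = 0" by (rule hform_eq_0_imp[OF aR])
qed

text \<open>The largest proper submodule of the left ideal multiplies to zero with itself: for \<open>a\<close> and \<open>b\<close> in
  it, \<open>a b = a (e b e) = 0\<close>.\<close>

theorem corner_left_ideal_simple:
  assumes "scalar_corner CG scalar e"
  shows "simple_module CG (left_ideal_module CG e)"
proof -
  interpret scalar_corner CG scalar e by (rule assms)
  let ?P = "left_ideal_module CG e"
  let ?K = "{a \<in> carrier ?P. \<forall>b\<in>carrier CG. e \<otimes>\<^bsub>CG\<^esub> (b \<otimes>\<^bsub>CG\<^esub> a) \<otimes>\<^bsub>CG\<^esub> e = \<zero>\<^bsub>CG\<^esub>}"
  note Pe = CG.idempotent_in_left_ideal_module(2)[OF e_closed e_idem]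
  note PR = subsetD[OF CG.left_ideal_module_subset[OF e_closed]]
  have max: "maximal_submodule ?K CG ?P" by (rule unique_maximal_submodule(1))
  then have "submodule ?K CG ?P" unfolding maximal_submodule_def by (rule conjunct1)
  note KD = submoduleD[OF this]
  have nil: "a \<otimes>\<^bsub>CG\<^esub> b = 0" if a: "a \<in> ?K" and b: "b \<in> ?K" for a b
  proof -
    have aP: "a \<in> carrier ?P" "b \<in> carrier ?P" using a b by blast+
    have "a \<otimes>\<^bsub>CG\<^esub> b = (a \<otimes>\<^bsub>CG\<^esub> e) \<otimes>\<^bsub>CG\<^esub> (b \<otimes>\<^bsub>CG\<^esub> e)"
      using Pe[OF aP(1)] Pe[OF aP(2)] by simp
    also have "\<dots> = a \<otimes>\<^bsub>CG\<^esub> (e \<otimes>\<^bsub>CG\<^esub> (\<one>\<^bsub>CG\<^esub> \<otimes>\<^bsub>CG\<^esub> b) \<otimes>\<^bsub>CG\<^esub> e)"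
      using one_mult[OF PR[OF aP(2)]] by (simp add: mult_assoc)
    also have "\<dots> = a \<otimes>\<^bsub>CG\<^esub> \<zero>\<^bsub>CG\<^esub>"
      using b one_closed by simp
    finally show ?thesis
      using CG.r_null[OF PR[OF aP(1)]] by (simp add: algebra_simps(2))
  qed
  have K0: "?K = {\<zero>\<^bsub>?P\<^esub>}"
  proof
    show "{\<zero>\<^bsub>?P\<^esub>} \<subseteq> ?K" using KD(2) by blast
    show "?K \<subseteq> {\<zero>\<^bsub>?P\<^esub>}"
    proof
      fix a assume a: "a \<in> ?K"
      have "a = 0"
      proof (rule nilpotent_left_ideal_trivial[OF _ _ nil a])
        show "?K \<subseteq> carrier CG" using PR by blast
        show "\<And>b a. b \<in> carrier CG \<Longrightarrow> a \<in> ?K \<Longrightarrow> b \<otimes>\<^bsub>CG\<^esub> a \<in> ?K"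
          using KD(4) unfolding left_ideal_module_simps(4) .
      qed
      then show "a \<in> {\<zero>\<^bsub>?P\<^esub>}" by (simp add: left_ideal_module_simps(2) algebra_simps(2))
    qed
  qed
  show ?thesis
    unfolding simple_module_def
  proof (intro conjI allI impI)
    show "left_module CG ?P" by (rule P.left_module_axioms)
    show "carrier ?P \<noteq> {\<zero>\<^bsub>?P\<^esub>}"
      using max unfolding K0 maximal_submodule_def by blast
    fix N assume N: "submodule N CG ?P"
    then show "N = {\<zero>\<^bsub>?P\<^esub>} \<or> N = carrier ?P"
      using max submoduleD(2)[OF N] unfolding K0 maximal_submodule_def by blast
  qed
qed

text \<open>Brauer's lemma: a minimal left ideal \<open>L\<close> that is not nilpotent contains a nonzero idempotent \<open>f\<close>.
  For \<open>L\<close> inside the left ideal of \<open>e\<close>, the product \<open>g = e f\<close> is an idempotent with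
  \<open>e g = g e = g\<close>, and primitivity applied to \<open>e = g + (e - g)\<close> gives \<open>e = g\<close>.\<close>

lemma primitive_idempotent_generates_minimal:
  assumes prim: "primitive_idempotent CG e"
    and W: "submodule W CG (left_ideal_module CG e)" "W \<noteq> {0}"
  shows "e \<in> W"
proof -
  let ?P = "left_ideal_module CG e"
  have e: "e \<in> carrier CG" "e \<otimes>\<^bsub>CG\<^esub> e = e"
    using prim by (auto simp: primitive_idempotent_def idempotent_in_def)
  interpret P: function_module CG scalar ?P by (rule left_ideal_function_module[OF e(1)])
  note Pe = CG.idempotent_in_left_ideal_module(2)[OF e]
  note PR = subsetD[OF CG.left_ideal_module_subset[OF e(1)]]
  obtain L where L: "submodule L CG ?P" "L \<subseteq> W" "L \<noteq> {0}"
    and min: "\<And>V. submodule V CG ?P \<Longrightarrow> V \<subseteq> L \<Longrightarrow> V \<noteq> {0} \<Longrightarrow> V = L"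
    using minimal_nonzero_subset_exists[of "\<lambda>V. submodule V CG ?P", OF W P.submodule_subspace
        P.submodule_finite_dimensional[OF W(1)]] by blast
  note LD = submoduleD[OF L(1)]
  have LR: "x \<in> carrier CG" if "x \<in> L" for x using that LD(1) PR by blast
  have Lmult: "a \<otimes>\<^bsub>CG\<^esub> x \<in> L" if "a \<in> carrier CG" "x \<in> L" for a x
    using LD(4)[OF that] by (simp add: left_ideal_module_simps(4))
  obtain a b where ab: "a \<in> L" "b \<in> L" "a \<otimes>\<^bsub>CG\<^esub> b \<noteq> 0"
  proof (rule ccontr)
    assume "\<not> thesis"
    then have "x = 0" if "x \<in> L" for x
      using nilpotent_left_ideal_trivial[of L x] LR Lmult that \<open>\<And>a b. \<lbrakk>a \<in> L; b \<in> L; a \<otimes>\<^bsub>CG\<^esub> b \<noteq> 0\<rbrakk> \<Longrightarrow> thesis\<close>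
      by blast
    then have "L = {0}" using LD(2) by (auto simp: left_ideal_module_simps(2) algebra_simps(2))
    then show False using L(3) by simp
  qed
  have zero0: "\<zero>\<^bsub>?P\<^esub> = 0" by (simp add: left_ideal_module_simps(2) algebra_simps(2))
  have zb: "0 \<otimes>\<^bsub>CG\<^esub> b = 0"
    using CG.l_null[OF LR[OF ab(2)]] by (simp add: algebra_simps(2))
  \<comment> \<open>\<open>L b\<close> is a nonzero ideal in \<open>L\<close>, so it is \<open>L\<close>, and some \<open>f\<close> in \<open>L\<close> fixes \<open>b\<close>\<close>
  define Lb where "Lb = {x \<otimes>\<^bsub>CG\<^esub> b | x. x \<in> L}"
  have "submodule Lb CG ?P"
  proof (rule P.submodule_of_closed)
    show "Lb \<subseteq> carrier ?P"
      unfolding Lb_def using Lmult LR ab(2) LD(1) by blast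
    show "\<zero>\<^bsub>?P\<^esub> \<in> Lb"
      unfolding Lb_def zero0 using zb LD(2) zero0 by force
  next
    fix x y assume "x \<in> Lb" "y \<in> Lb"
    then obtain u v where uv: "u \<in> L" "v \<in> L" "x = u \<otimes>\<^bsub>CG\<^esub> b" "y = v \<otimes>\<^bsub>CG\<^esub> b"
      unfolding Lb_def by blast
    have "u \<oplus>\<^bsub>?P\<^esub> v \<in> L" using LD(3)[OF uv(1,2)] .
    moreover have "x \<oplus>\<^bsub>?P\<^esub> y = (u \<oplus>\<^bsub>?P\<^esub> v) \<otimes>\<^bsub>CG\<^esub> b"
      unfolding uv(3,4) left_ideal_module_simps(3) algebra_simps(4) by (rule mult_add_left[symmetric])
    ultimately show "x \<oplus>\<^bsub>?P\<^esub> y \<in> Lb" unfolding Lb_def by blast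
  next
    fix c x assume c: "c \<in> carrier CG" and "x \<in> Lb"
    then obtain u where u: "u \<in> L" "x = u \<otimes>\<^bsub>CG\<^esub> b" unfolding Lb_def by blast
    then have "c \<odot>\<^bsub>?P\<^esub> x = (c \<otimes>\<^bsub>CG\<^esub> u) \<otimes>\<^bsub>CG\<^esub> b"
      by (simp add: left_ideal_module_simps(4) mult_assoc)
    then show "c \<odot>\<^bsub>?P\<^esub> x \<in> Lb" unfolding Lb_def using Lmult[OF c u(1)] by blast
  qed
  moreover have "Lb \<subseteq> L" unfolding Lb_def using Lmult LR ab(2) by blast
  moreover have "Lb \<noteq> {0}" unfolding Lb_def using ab by blast
  ultimately have "Lb = L" by (rule min)
  then obtain f where f: "f \<in> L" "f \<otimes>\<^bsub>CG\<^esub> b = b"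
    using ab(2) unfolding Lb_def by (smt (verit) mem_Collect_eq)
  \<comment> \<open>the annihilator of \<open>b\<close> in \<open>L\<close> vanishes by minimality, and it contains \<open>f f - f\<close>\<close>
  define Ann where "Ann = {x \<in> L. x \<otimes>\<^bsub>CG\<^esub> b = 0}"
  have "submodule Ann CG ?P"
  proof (rule P.submodule_of_closed)
    show "Ann \<subseteq> carrier ?P" unfolding Ann_def using LD(1) by blast
    show "\<zero>\<^bsub>?P\<^esub> \<in> Ann" unfolding Ann_def using LD(2) zb zero0 by simp
  next
    fix x y assume "x \<in> Ann" "y \<in> Ann"
    then show "x \<oplus>\<^bsub>?P\<^esub> y \<in> Ann"
      unfolding Ann_def using LD(3)[of x y]
      by (simp add: left_ideal_module_simps(3) algebra_simps(4) mult_add_left)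
  next
    fix c x assume c: "c \<in> carrier CG" and x: "x \<in> Ann"
    have "c \<otimes>\<^bsub>CG\<^esub> x \<otimes>\<^bsub>CG\<^esub> b = c \<otimes>\<^bsub>CG\<^esub> \<zero>\<^bsub>CG\<^esub>"
      using x by (simp add: Ann_def mult_assoc algebra_simps(2))
    then show "c \<odot>\<^bsub>?P\<^esub> x \<in> Ann"
      using Lmult[OF c, of x] CG.r_null[OF c] x
      by (simp add: Ann_def left_ideal_module_simps(4) algebra_simps(2))
  qed
  moreover have "Ann \<subseteq> L" "Ann \<noteq> L" unfolding Ann_def using ab by blast+
  ultimately have Ann0: "Ann = {0}" using min by blast
  have "f \<otimes>\<^bsub>CG\<^esub> f - f \<in> L"
    using fs.subspace_diff[OF P.submodule_subspace[OF L(1)]] Lmult[OF LR[OF f(1)] f(1)] f(1) by blast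
  moreover have "(f \<otimes>\<^bsub>CG\<^esub> f - f) \<otimes>\<^bsub>CG\<^esub> b = 0"
  proof -
    have "(f \<otimes>\<^bsub>CG\<^esub> f - f) \<otimes>\<^bsub>CG\<^esub> b + f \<otimes>\<^bsub>CG\<^esub> b = f \<otimes>\<^bsub>CG\<^esub> f \<otimes>\<^bsub>CG\<^esub> b"
      unfolding mult_add_left[symmetric] by simp
    then show ?thesis using f(2) by (simp add: mult_assoc)
  qed
  ultimately have "f \<otimes>\<^bsub>CG\<^esub> f - f \<in> {0}" using Ann0 unfolding Ann_def by blast
  then have ff: "f \<otimes>\<^bsub>CG\<^esub> f = f" by simp
  have fR: "f \<in> carrier CG" by (rule LR[OF f(1)])
  have fe: "f \<otimes>\<^bsub>CG\<^esub> e = f" using Pe LD(1) f(1) by blast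
  define g where "g = e \<otimes>\<^bsub>CG\<^esub> f"
  have gL: "g \<in> L" unfolding g_def by (rule Lmult[OF e(1) f(1)])
  have gR: "g \<in> carrier CG" by (rule LR[OF gL])
  have gg: "g \<otimes>\<^bsub>CG\<^esub> g = g"
  proof -
    have "g \<otimes>\<^bsub>CG\<^esub> g = e \<otimes>\<^bsub>CG\<^esub> ((f \<otimes>\<^bsub>CG\<^esub> e) \<otimes>\<^bsub>CG\<^esub> f)"
      by (simp add: g_def mult_assoc)
    then show ?thesis by (simp add: fe ff g_def)
  qed
  have ge: "g \<otimes>\<^bsub>CG\<^esub> e = g" by (simp add: g_def mult_assoc fe)
  have eg: "e \<otimes>\<^bsub>CG\<^esub> g = g" unfolding g_def mult_assoc[symmetric] e(2) ..
  have g0: "g \<noteq> 0"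
  proof
    assume "g = 0"
    have "f = f \<otimes>\<^bsub>CG\<^esub> g" unfolding g_def mult_assoc[symmetric] fe ff ..
    also have "\<dots> = 0" using CG.r_null[OF fR] \<open>g = 0\<close> by (simp add: algebra_simps(2))
    finally have "f = 0" .
    then have "b = 0" using f(2) zb by simp
    then have "a \<otimes>\<^bsub>CG\<^esub> b = 0" using CG.r_null[OF LR[OF ab(1)]] by (simp add: algebra_simps(2))
    then show False using ab(3) by simp
  qed
  define h where "h = e - g"
  have eh: "e = g + h" by (simp add: h_def)
  have hR: "h \<in> carrier CG" using e(1) gR by (simp add: h_def algebra_simps(1))
  have gh: "g \<otimes>\<^bsub>CG\<^esub> h = 0"
    using ge gg mult_add_right[of g g h] unfolding eh[symmetric] by simp
  have hg: "h \<otimes>\<^bsub>CG\<^esub> g = 0"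
    using eg gg mult_add_left[of g h g] unfolding eh[symmetric] by simp
  have hh: "h \<otimes>\<^bsub>CG\<^esub> h = h"
  proof -
    have "e = e \<otimes>\<^bsub>CG\<^esub> e" using e(2) by simp
    also have "\<dots> = g + h \<otimes>\<^bsub>CG\<^esub> h"
      unfolding eh by (simp add: mult_add_left mult_add_right gg gh hg)
    finally show ?thesis using eh by simp
  qed
  have "g = \<zero>\<^bsub>CG\<^esub> \<or> h = \<zero>\<^bsub>CG\<^esub>"
    using prim gR hR gg hh gh hg eh
    unfolding primitive_idempotent_def idempotent_in_def algebra_simps(2,4) by blast
  then have "e = g" using g0 eh by (simp add: algebra_simps(2))
  then show ?thesis using gL L(2) by blast
qed

text \<open>Schur's lemma: an element \<open>y\<close> of the corner has an eigenvector \<open>v = e v\<close>, with eigenvalue \<open>\<mu>\<close>. If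
  \<open>z = y - \<mu> e\<close> were not zero, the left ideal of \<open>z\<close> would contain \<open>e\<close>, and \<open>z v = 0\<close> would imply
  \<open>v = 0\<close>.\<close>

theorem primitive_idempotent_scalar_corner:
  assumes prim: "primitive_idempotent CG e"
  shows "scalar_corner CG scalar e"
proof (intro scalar_corner.intro algebra_complex_algebra scalar_corner_axioms.intro)
  show eR: "e \<in> carrier CG" and ee: "e \<otimes>\<^bsub>CG\<^esub> e = e" and e0: "e \<noteq> \<zero>\<^bsub>CG\<^esub>"
    using prim by (auto simp: primitive_idempotent_def idempotent_in_def)
  let ?P = "left_ideal_module CG e"
  interpret P: function_module CG scalar ?P by (rule left_ideal_function_module[OF eR])
  fix x assume x: "x \<in> carrier CG"
  define y where "y = e \<otimes>\<^bsub>CG\<^esub> x \<otimes>\<^bsub>CG\<^esub> e"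
  have ye: "y \<otimes>\<^bsub>CG\<^esub> e = y" and ey: "e \<otimes>\<^bsub>CG\<^esub> y = y"
    by (simp_all add: y_def mult_assoc ee) (simp add: mult_assoc[symmetric] ee)
  define V where "V = {v \<in> carrier CG. e \<otimes>\<^bsub>CG\<^esub> v = v}"
  have "fs.subspace V"
    unfolding fs.subspace_def V_def
    using CG.r_null[OF eR]
    by (auto simp: algebra_simps(1,2) mult_add_right mult_fscale_right fscale_apply)
  moreover have "finite_dimensional V"
    using finite_dimensional_supported[OF finite_carrier] by (rule finite_dimensional_mono) (auto simp: V_def algebra_simps(1))
  moreover have "y \<otimes>\<^bsub>CG\<^esub> v \<in> V" for v
    unfolding V_def using mult_closed[of y v] by (simp add: mult_assoc[symmetric] ey)
  moreover have "e \<in> V" "e \<noteq> 0"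
    using eR ee e0 by (auto simp: V_def algebra_simps(2))
  ultimately obtain \<mu> v where v: "v \<in> V" "v \<noteq> 0" "y \<otimes>\<^bsub>CG\<^esub> v = fscale \<mu> v"
    using eigenvector_exists[OF mult_linear, of V y e] by blast
  define z where "z = y - fscale \<mu> e"
  have ze: "z + fscale \<mu> e = y" by (simp add: z_def)
  have zv: "z \<otimes>\<^bsub>CG\<^esub> v = 0"
  proof -
    have "z \<otimes>\<^bsub>CG\<^esub> v + fscale \<mu> (e \<otimes>\<^bsub>CG\<^esub> v) = y \<otimes>\<^bsub>CG\<^esub> v"
      unfolding mult_fscale_left[symmetric] mult_add_left[symmetric] ze ..
    then show ?thesis using v(1,3) by (simp add: V_def)
  qed
  have "z \<otimes>\<^bsub>CG\<^esub> e = z"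
  proof -
    have "z \<otimes>\<^bsub>CG\<^esub> e + fscale \<mu> (e \<otimes>\<^bsub>CG\<^esub> e) = y \<otimes>\<^bsub>CG\<^esub> e"
      unfolding mult_fscale_left[symmetric] mult_add_left[symmetric] ze ..
    then have "z \<otimes>\<^bsub>CG\<^esub> e = y - fscale \<mu> e" by (simp only: eq_diff_eq ee ye)
    then show ?thesis by (simp only: z_def)
  qed
  moreover have "z \<in> carrier CG"
    using mult_closed[of "e \<otimes>\<^bsub>CG\<^esub> x" e] eR unfolding z_def y_def algebra_simps(1) by (auto simp: fscale_apply)
  ultimately have zP: "z \<in> carrier ?P"
    unfolding left_ideal_module_simps(1) by (intro CollectI exI[of _ z]) simp
  have "z = 0"
  proof (rule ccontr)
    assume z0: "z \<noteq> 0"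
    let ?W = "{a \<odot>\<^bsub>?P\<^esub> z | a. a \<in> carrier CG}"
    have W: "submodule ?W CG ?P" by (rule P.cyclic_submodule[OF zP])
    have "z \<in> ?W"
      using P.smult_one[OF zP] one_closed by force
    then have "?W \<noteq> {0}" using z0 by blast
    then have "e \<in> ?W" by (rule primitive_idempotent_generates_minimal[OF prim W])
    then obtain a where a: "a \<in> carrier CG" "e = a \<otimes>\<^bsub>CG\<^esub> z"
      unfolding left_ideal_module_simps(4) by blast
    have "v = e \<otimes>\<^bsub>CG\<^esub> v" using v(1) by (simp add: V_def)
    also have "\<dots> = a \<otimes>\<^bsub>CG\<^esub> \<zero>\<^bsub>CG\<^esub>"
      unfolding a(2) mult_assoc zv algebra_simps(2) ..
    also have "\<dots> = 0" using CG.r_null[OF a(1)] by (simp add: algebra_simps(2))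
    finally show False using v(2) by simp
  qed
  then have "y = scalar \<mu> \<otimes>\<^bsub>CG\<^esub> e"
    using ze scalar_mult[OF eR] by simp
  then show "\<exists>c. e \<otimes>\<^bsub>CG\<^esub> x \<otimes>\<^bsub>CG\<^esub> e = scalar c \<otimes>\<^bsub>CG\<^esub> e"
    unfolding y_def by blast
qed

subsection \<open>The inversion anti-automorphism\<close>

text \<open>The linear extension of the inversion of the group. It turns right multiplication into an
  action from the left.\<close>

definition flip :: "('a \<Rightarrow> complex) \<Rightarrow> 'a \<Rightarrow> complex" where
  "flip a = (\<lambda>g. if g \<in> carrier G then a (inv g) else 0)"

lemma flip_closed: "flip a \<in> carrier CG"
  by (simp add: flip_def algebra_simps(1))

lemma flip_flip: "a \<in> carrier CG \<Longrightarrow> flip (flip a) = a"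
  by (auto simp: flip_def algebra_simps(1) fun_eq_iff)

lemma flip_mult: "flip (a \<otimes>\<^bsub>CG\<^esub> b) = flip b \<otimes>\<^bsub>CG\<^esub> flip a"
proof
  fix m
  show "flip (a \<otimes>\<^bsub>CG\<^esub> b) m = (flip b \<otimes>\<^bsub>CG\<^esub> flip a) m"
  proof (cases "m \<in> carrier G")
    case m: True
    have "flip (a \<otimes>\<^bsub>CG\<^esub> b) m = (\<Sum>x\<in>carrier G. a x * b (inv x \<otimes> inv m))"
      using m by (simp add: flip_def group_mult_apply)
    also have "\<dots> = (\<Sum>x\<in>carrier G. b (inv x) * a (inv (inv x \<otimes> m)))"
      by (rule sum.reindex_bij_witness[of _ "\<lambda>x. inv m \<otimes> x" "\<lambda>x. m \<otimes> x"])
        (use m in \<open>simp_all add: m_assoc[symmetric] inv_mult_group\<close>)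
    also have "\<dots> = (flip b \<otimes>\<^bsub>CG\<^esub> flip a) m"
      using m by (simp add: group_mult_apply flip_def)
    finally show ?thesis .
  qed (use mult_closed[of "flip b" "flip a"] in \<open>simp add: flip_def algebra_simps(1)\<close>)
qed

lemma flip_scalar_corner:
  assumes "scalar_corner CG scalar e"
  shows "scalar_corner CG scalar (flip e)"
proof (intro scalar_corner.intro algebra_complex_algebra scalar_corner_axioms.intro)
  interpret scalar_corner CG scalar e by (rule assms)
  show "flip e \<in> carrier CG" by (rule flip_closed)
  show "flip e \<otimes>\<^bsub>CG\<^esub> flip e = flip e" by (simp add: flip_mult[symmetric] e_idem)
  show "flip e \<noteq> \<zero>\<^bsub>CG\<^esub>"
  proof
    assume "flip e = \<zero>\<^bsub>CG\<^esub>"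
    then have "flip (flip e) = 0" by (simp add: algebra_simps(2) flip_def fun_eq_iff)
    then show False using e_nonzero by (simp add: flip_flip algebra_simps(2))
  qed
  fix a assume a: "a \<in> carrier CG"
  obtain c where c: "e \<otimes>\<^bsub>CG\<^esub> flip a \<otimes>\<^bsub>CG\<^esub> e = scalar c \<otimes>\<^bsub>CG\<^esub> e"
    using corner[OF flip_closed] by blast
  have "flip e \<otimes>\<^bsub>CG\<^esub> a \<otimes>\<^bsub>CG\<^esub> flip e = flip (e \<otimes>\<^bsub>CG\<^esub> flip a \<otimes>\<^bsub>CG\<^esub> e)"
    by (simp add: flip_mult flip_flip[OF a] mult_assoc)
  also have "\<dots> = fscale c (flip e)"
    unfolding c scalar_mult[OF e_closed] by (auto simp: flip_def fscale_apply fun_eq_iff)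
  also have "\<dots> = scalar c \<otimes>\<^bsub>CG\<^esub> flip e"
    by (rule scalar_mult[OF flip_closed, symmetric])
  finally show "\<exists>c. flip e \<otimes>\<^bsub>CG\<^esub> a \<otimes>\<^bsub>CG\<^esub> flip e = scalar c \<otimes>\<^bsub>CG\<^esub> flip e" by blast
qed

end

section \<open>Outer tensor products of simple modules\<close>

lemma finite_group_DirProd:
  assumes "finite_group G" "finite_group H"
  shows "finite_group (G \<times>\<times> H)"
proof -
  interpret G: finite_group G by fact
  interpret H: finite_group H by fact
  show ?thesis
    by (intro finite_group.intro DirProd_group G.group_axioms H.group_axioms finite_group_axioms.intro)
      (simp add: G.finite_carrier H.finite_carrier)
qed

definition tens :: "('g \<Rightarrow> complex) \<Rightarrow> ('h \<Rightarrow> complex) \<Rightarrow> 'g \<times> 'h \<Rightarrow> complex" where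
  "tens a b = (\<lambda>(g, h). a g * b h)"

lemma tens_apply [simp]: "tens a b (g, h) = a g * b h"
  by (simp add: tens_def)

lemma (in finite_group) algebra_element_expansion:
  assumes "a \<in> carrier CG"
  shows "a = (\<Sum>g\<in>carrier G. fscale (a g) (basis_vector g))"
  using assms by (intro basis_expansion finite_carrier) (simp add: algebra_simps(1))

locale two_groups = G: finite_group G + H: finite_group H
  for G :: "('g, 'm) monoid_scheme" and H :: "('h, 'n) monoid_scheme"
begin

sublocale GH: finite_group "G \<times>\<times> H"
  by (intro finite_group_DirProd G.finite_group_axioms H.finite_group_axioms)

lemma tens_closed:
  assumes "a \<in> carrier (group_algebra G)" "b \<in> carrier (group_algebra H)"
  shows "tens a b \<in> carrier (group_algebra (G \<times>\<times> H))"
  using assms by (auto simp: GH.algebra_simps(1) G.algebra_simps(1) H.algebra_simps(1))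

lemma tens_mult:
  shows "tens a b \<otimes>\<^bsub>group_algebra (G \<times>\<times> H)\<^esub> tens a' b' =
    tens (a \<otimes>\<^bsub>group_algebra G\<^esub> a') (b \<otimes>\<^bsub>group_algebra H\<^esub> b')"
proof
  fix m :: "'g \<times> 'h"
  obtain m1 m2 where m: "m = (m1, m2)" by (cases m)
  show "(tens a b \<otimes>\<^bsub>group_algebra (G \<times>\<times> H)\<^esub> tens a' b') m =
    tens (a \<otimes>\<^bsub>group_algebra G\<^esub> a') (b \<otimes>\<^bsub>group_algebra H\<^esub> b') m"
  proof (cases "m \<in> carrier (G \<times>\<times> H)")
    case True
    then have m12: "m1 \<in> carrier G" "m2 \<in> carrier H" by (auto simp: m)
    have "(tens a b \<otimes>\<^bsub>group_algebra (G \<times>\<times> H)\<^esub> tens a' b') m =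
        (\<Sum>(g, h)\<in>carrier G \<times> carrier H. (a g * a' (inv\<^bsub>G\<^esub> g \<otimes>\<^bsub>G\<^esub> m1)) * (b h * b' (inv\<^bsub>H\<^esub> h \<otimes>\<^bsub>H\<^esub> m2)))"
      unfolding GH.group_mult_apply[OF True] carrier_DirProd
      by (intro sum.cong) (auto simp: m inv_DirProd G.group_axioms H.group_axioms)
    also have "\<dots> = tens (a \<otimes>\<^bsub>group_algebra G\<^esub> a') (b \<otimes>\<^bsub>group_algebra H\<^esub> b') m"
      using m12 by (simp add: m G.group_mult_apply H.group_mult_apply sum_product sum.cartesian_product)
    finally show ?thesis .
  next
    case False
    then have "m1 \<notin> carrier G \<or> m2 \<notin> carrier H" by (auto simp: m)
    then show ?thesis
      using GH.mult_closed[of "tens a b" "tens a' b'"] G.mult_closed[of a a'] H.mult_closed[of b b'] False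
      by (auto simp: m GH.algebra_simps(1) G.algebra_simps(1) H.algebra_simps(1))
  qed
qed

text \<open>On elements \<open>a \<otimes> b\<close> the corner is the product of the two corners, and these elements span the
  algebra.\<close>

theorem tens_scalar_corner:
  assumes x: "scalar_corner (group_algebra G) G.scalar x" and y: "scalar_corner (group_algebra H) H.scalar y"
  shows "scalar_corner (group_algebra (G \<times>\<times> H)) GH.scalar (tens x y)"
proof (intro scalar_corner.intro GH.algebra_complex_algebra scalar_corner_axioms.intro)
  interpret x: scalar_corner "group_algebra G" G.scalar x by (rule x)
  interpret y: scalar_corner "group_algebra H" H.scalar y by (rule y)
  let ?GH = "group_algebra (G \<times>\<times> H)"
  let ?E = "tens x y"
  show closed: "?E \<in> carrier ?GH" by (rule tens_closed[OF x.e_closed y.e_closed])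
  show "?E \<otimes>\<^bsub>?GH\<^esub> ?E = ?E" by (simp add: tens_mult x.e_idem y.e_idem)
  show "?E \<noteq> \<zero>\<^bsub>?GH\<^esub>"
  proof
    assume E0: "?E = \<zero>\<^bsub>?GH\<^esub>"
    obtain g h where "x g \<noteq> 0" "y h \<noteq> 0"
      using x.e_nonzero y.e_nonzero by (auto simp: G.algebra_simps(2) H.algebra_simps(2) fun_eq_iff)
    moreover have "x g * y h = 0"
      using fun_cong[OF E0, of "(g, h)"] by (simp add: GH.algebra_simps(2))
    ultimately show False by simp
  qed
  define V where "V = {c. \<exists>k. ?E \<otimes>\<^bsub>?GH\<^esub> c \<otimes>\<^bsub>?GH\<^esub> ?E = fscale k ?E}"
  have "fs.subspace V"
  proof (rule fs.subspaceI)
    have "?E \<otimes>\<^bsub>?GH\<^esub> 0 \<otimes>\<^bsub>?GH\<^esub> ?E = fscale 0 ?E"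
      using GH.CG.r_null[OF closed] GH.CG.l_null[OF closed] by (simp add: GH.algebra_simps(2))
    then show "0 \<in> V" unfolding V_def by blast
  next
    fix c d assume "c \<in> V" "d \<in> V"
    then obtain k l where "?E \<otimes>\<^bsub>?GH\<^esub> c \<otimes>\<^bsub>?GH\<^esub> ?E = fscale k ?E" "?E \<otimes>\<^bsub>?GH\<^esub> d \<otimes>\<^bsub>?GH\<^esub> ?E = fscale l ?E"
      unfolding V_def by blast
    then have "?E \<otimes>\<^bsub>?GH\<^esub> (c + d) \<otimes>\<^bsub>?GH\<^esub> ?E = fscale (k + l) ?E"
      unfolding GH.mult_add_left GH.mult_add_right fs.scale_left_distrib by simp
    then show "c + d \<in> V" unfolding V_def by blast
  next
    fix k c assume "c \<in> V"
    then obtain l where "?E \<otimes>\<^bsub>?GH\<^esub> c \<otimes>\<^bsub>?GH\<^esub> ?E = fscale l ?E" unfolding V_def by blast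
    then have "?E \<otimes>\<^bsub>?GH\<^esub> fscale k c \<otimes>\<^bsub>?GH\<^esub> ?E = fscale (k * l) ?E"
      unfolding GH.mult_fscale_left GH.mult_fscale_right by simp
    then show "fscale k c \<in> V" unfolding V_def by blast
  qed
  moreover have "basis_vector p \<in> V" if pG: "p \<in> carrier (G \<times>\<times> H)" for p
  proof -
    obtain g h where p: "p = (g, h)" "g \<in> carrier G" "h \<in> carrier H" using pG by auto
    have bp: "basis_vector p = tens (basis_vector g) (basis_vector h)"
      by (auto simp: p(1) basis_vector_def tens_def fun_eq_iff)
    obtain c where c: "x \<otimes>\<^bsub>group_algebra G\<^esub> basis_vector g \<otimes>\<^bsub>group_algebra G\<^esub> x = fscale c x"
      using x.corner[OF G.basis_vector_closed[OF p(2)]] G.scalar_mult[OF x.e_closed] by auto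
    obtain d where d: "y \<otimes>\<^bsub>group_algebra H\<^esub> basis_vector h \<otimes>\<^bsub>group_algebra H\<^esub> y = fscale d y"
      using y.corner[OF H.basis_vector_closed[OF p(3)]] H.scalar_mult[OF y.e_closed] by auto
    have "?E \<otimes>\<^bsub>?GH\<^esub> basis_vector p \<otimes>\<^bsub>?GH\<^esub> ?E = fscale (c * d) ?E"
      unfolding bp tens_mult c d by (auto simp: tens_def fscale_apply fun_eq_iff)
    then show ?thesis unfolding V_def by blast
  qed
  ultimately have sums: "(\<Sum>p\<in>carrier (G \<times>\<times> H). fscale (a p) (basis_vector p)) \<in> V" for a
    by (intro fs.subspace_sum fs.subspace_scale)
  have all: "a \<in> V" if "a \<in> carrier ?GH" for a
    by (rule back_subst[of "\<lambda>c. c \<in> V", OF sums[of a] GH.algebra_element_expansion[OF that, symmetric]])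
  fix a assume "a \<in> carrier ?GH"
  then show "\<exists>c. ?E \<otimes>\<^bsub>?GH\<^esub> a \<otimes>\<^bsub>?GH\<^esub> ?E = GH.scalar c \<otimes>\<^bsub>?GH\<^esub> ?E"
    using all[of a] GH.scalar_mult[OF closed] unfolding V_def by simp
qed

end

lemma (in permutation_action) smult_expansion:
  assumes "finite S" "S \<subseteq> X" "\<And>x. x \<notin> S \<Longrightarrow> v x = 0"
  shows "a \<odot>\<^bsub>CX\<^esub> v = (\<Sum>g\<in>carrier G. \<Sum>x\<in>S. fscale (a g * v x) (basis_vector (act g x)))"
proof
  fix y
  have "(\<Sum>x\<in>S. (a g * v x) * basis_vector (act g x) y) = (if y \<in> X then a g * v (act (inv g) y) else 0)"
    if g: "g \<in> carrier G" for g
  proof (cases "y \<in> X")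
    case True
    have "(\<Sum>x\<in>S. (a g * v x) * basis_vector (act g x) y) =
        (\<Sum>x\<in>S. if x = act (inv g) y then a g * v (act (inv g) y) else 0)"
    proof (rule sum.cong[OF refl])
      fix x assume "x \<in> S"
      then have "act g x = y \<longleftrightarrow> x = act (inv g) y"
        using act_eq_iff[OF g _ True] assms(2) by blast
      then show "(a g * v x) * basis_vector (act g x) y =
          (if x = act (inv g) y then a g * v (act (inv g) y) else 0)"
        by (auto simp: basis_vector_def)
    qed
    then show ?thesis using True assms(1,3) by auto
  next
    case False
    then have "(\<Sum>x\<in>S. (a g * v x) * basis_vector (act g x) y) = 0"
      using act_closed[OF g] assms(2) by (intro sum.neutral) (auto simp: basis_vector_def)
    then show ?thesis using False by simp
  qed
  then show "(a \<odot>\<^bsub>CX\<^esub> v) y = (\<Sum>g\<in>carrier G. \<Sum>x\<in>S. fscale (a g * v x) (basis_vector (act g x))) y"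
    by (simp add: smult_apply sum_fun_apply fscale_apply)
qed

lemma (in finite_group) smult_group_expansion:
  assumes M: "function_module CG scalar M" and a: "a \<in> carrier CG" and v: "v \<in> carrier M"
  shows "a \<odot>\<^bsub>M\<^esub> v = (\<Sum>g\<in>carrier G. fscale (a g) (basis_vector g \<odot>\<^bsub>M\<^esub> v))"
proof -
  interpret M: function_module CG scalar M by (rule M)
  have sum: "(\<Sum>g\<in>I. fscale (a g) (basis_vector g)) \<in> carrier CG \<and>
      (\<Sum>g\<in>I. fscale (a g) (basis_vector g)) \<odot>\<^bsub>M\<^esub> v = (\<Sum>g\<in>I. fscale (a g) (basis_vector g \<odot>\<^bsub>M\<^esub> v))"
    if "finite I" "I \<subseteq> carrier G" for I
    using that
  proof (induction I)
    case empty
    have "\<zero>\<^bsub>CG\<^esub> \<in> carrier CG" "\<zero>\<^bsub>CG\<^esub> \<odot>\<^bsub>M\<^esub> v = \<zero>\<^bsub>M\<^esub>"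
      using M.zero_smult[OF v] by simp_all
    then show "(\<Sum>g\<in>{}. fscale (a g) (basis_vector g)) \<in> carrier CG \<and>
        (\<Sum>g\<in>{}. fscale (a g) (basis_vector g)) \<odot>\<^bsub>M\<^esub> v = (\<Sum>g\<in>{}. fscale (a g) (basis_vector g \<odot>\<^bsub>M\<^esub> v))"
      unfolding algebra_simps(2) M.zero_fun sum.empty by (rule conjI)
  next
    case (insert g I)
    let ?s = "\<Sum>g\<in>I. fscale (a g) (basis_vector g)"
    have IH: "?s \<in> carrier CG" "?s \<odot>\<^bsub>M\<^esub> v = (\<Sum>g\<in>I. fscale (a g) (basis_vector g \<odot>\<^bsub>M\<^esub> v))"
      using insert by auto
    have g: "g \<in> carrier G" using insert.prems by simp
    note bg = basis_vector_closed[OF g]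
    have t: "fscale (a g) (basis_vector g) = scalar (a g) \<otimes>\<^bsub>CG\<^esub> basis_vector g"
      by (rule scalar_mult[OF bg, symmetric])
    have tR: "fscale (a g) (basis_vector g) \<in> carrier CG"
      unfolding t by (rule mult_closed)
    have tv: "fscale (a g) (basis_vector g) \<odot>\<^bsub>M\<^esub> v = fscale (a g) (basis_vector g \<odot>\<^bsub>M\<^esub> v)"
      unfolding t using M.smult_assoc1[OF CG.sc_closed bg v] M.sc_smult[OF M.smult_closed[OF bg v]] by simp
    have "(fscale (a g) (basis_vector g) \<oplus>\<^bsub>CG\<^esub> ?s) \<odot>\<^bsub>M\<^esub> v =
        fscale (a g) (basis_vector g \<odot>\<^bsub>M\<^esub> v) \<oplus>\<^bsub>M\<^esub> (\<Sum>g\<in>I. fscale (a g) (basis_vector g \<odot>\<^bsub>M\<^esub> v))"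
      using M.smult_l_distr[OF tR IH(1) v] unfolding tv IH(2) .
    moreover have "fscale (a g) (basis_vector g) \<oplus>\<^bsub>CG\<^esub> ?s \<in> carrier CG"
      using tR IH(1) by simp
    ultimately show "(\<Sum>g\<in>insert g I. fscale (a g) (basis_vector g)) \<in> carrier CG \<and>
        (\<Sum>g\<in>insert g I. fscale (a g) (basis_vector g)) \<odot>\<^bsub>M\<^esub> v =
        (\<Sum>g\<in>insert g I. fscale (a g) (basis_vector g \<odot>\<^bsub>M\<^esub> v))"
      unfolding algebra_simps(4) M.add_fun sum.insert[OF insert.hyps] by blast
  qed
  have "a \<odot>\<^bsub>M\<^esub> v = (\<Sum>g\<in>carrier G. fscale (a g) (basis_vector g)) \<odot>\<^bsub>M\<^esub> v"
    by (rule arg_cong[OF algebra_element_expansion[OF a]])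
  then show ?thesis
    using sum[OF finite_carrier subset_refl] by simp
qed

text \<open>The tensor product is the quotient of the free vector space \<open>F\<close> on pairs of vectors by the
  submodule \<open>T\<close> generated by the bilinearity relations.\<close>

locale tensor_factors = two_groups G H
  for G :: "('g, 'm) monoid_scheme" and H :: "('h, 'n) monoid_scheme" +
  fixes V :: "('g \<Rightarrow> complex, 'v \<Rightarrow> complex, 'p) module_scheme"
    and W :: "('h \<Rightarrow> complex, 'w \<Rightarrow> complex, 'q) module_scheme"
  assumes V: "function_module (group_algebra G) G.scalar V"
    and W: "function_module (group_algebra H) H.scalar W"
begin

sublocale V: function_module "group_algebra G" G.scalar V by (rule V)
sublocale W: function_module "group_algebra H" H.scalar W by (rule W)

definition act where
  "act = (\<lambda>(g, h) (v, w). (basis_vector g \<odot>\<^bsub>V\<^esub> v, basis_vector h \<odot>\<^bsub>W\<^esub> w))"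

lemma basis_vector_mult:
  assumes "finite_group K" "g \<in> carrier K" "g' \<in> carrier K"
  shows "basis_vector (g \<otimes>\<^bsub>K\<^esub> g') = basis_vector g \<otimes>\<^bsub>group_algebra K\<^esub> basis_vector g'"
proof -
  interpret K: finite_group K by fact
  interpret reg: finite_permutation_action K "carrier K" "\<lambda>g h. g \<otimes>\<^bsub>K\<^esub> h" by (rule K.regular_action)
  show ?thesis
    unfolding K.mult_eq_regular_smult using reg.smult_basis_vector[OF assms(2,3)] by simp
qed

lemma act_action: "permutation_action (G \<times>\<times> H) (carrier V \<times> carrier W) act"
proof (intro permutation_action.intro GH.finite_group_axioms permutation_action_axioms.intro)
  fix p q z assume p: "p \<in> carrier (G \<times>\<times> H)" and z: "z \<in> carrier V \<times> carrier W"
  show "act p z \<in> carrier V \<times> carrier W"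
    using p z V.smult_closed W.smult_closed G.basis_vector_closed H.basis_vector_closed
    by (auto simp: act_def)
  assume q: "q \<in> carrier (G \<times>\<times> H)"
  show "act (p \<otimes>\<^bsub>G \<times>\<times> H\<^esub> q) z = act p (act q z)"
    using p q z G.basis_vector_closed H.basis_vector_closed
    by (auto simp: act_def basis_vector_mult[OF G.finite_group_axioms] basis_vector_mult[OF H.finite_group_axioms]
        V.smult_assoc1 W.smult_assoc1)
next
  fix z assume "z \<in> carrier V \<times> carrier W"
  then show "act \<one>\<^bsub>G \<times>\<times> H\<^esub> z = z"
    using V.smult_one W.smult_one
    by (auto simp: act_def G.one_is_basis_vector[symmetric] H.one_is_basis_vector[symmetric])
qed

sublocale F: permutation_action "G \<times>\<times> H" "carrier V \<times> carrier W" act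
  by (rule act_action)

abbreviation (input) "R \<equiv> group_algebra (G \<times>\<times> H)"
abbreviation (input) "F \<equiv> permutation_module (G \<times>\<times> H) (carrier V \<times> carrier W) act"

definition T where "T = generated_submodule R F (tensor_relators G H V W)"

sublocale FM: left_module R F by (rule F.permutation_left_module)

lemma outer_tensor_eq: "outer_tensor G H V W = quotient_module F T"
  by (simp add: outer_tensor_def act_def T_def Let_def)

lemma basis_vector_in_F: "v \<in> carrier V \<Longrightarrow> w \<in> carrier W \<Longrightarrow> basis_vector (v, w) \<in> carrier F"
  by (auto simp: F.permutation_module_simps(1) basis_vector_def)

lemma F_subspace:
  assumes "submodule N R F" shows "fs.subspace N"
proof (rule fs.subspaceI)
  note N = submoduleD[OF assms]
  show "0 \<in> N" using N(2) by (simp add: F.permutation_module_simps(2))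
  show "x + y \<in> N" if "x \<in> N" "y \<in> N" for x y
    using N(3)[OF that] by (simp add: F.permutation_module_simps(3))
  show "fscale c x \<in> N" if "x \<in> N" for c x
    using N(4)[OF GH.CG.sc_closed that, of c] N(1) that F.scalar_smult[of x c] by auto
qed

lemma group_scalar_smult:
  "v \<in> carrier V \<Longrightarrow> group_scalar G c \<odot>\<^bsub>V\<^esub> v = fscale c v"
  "w \<in> carrier W \<Longrightarrow> group_scalar H c \<odot>\<^bsub>W\<^esub> w = fscale c w"
proof -
  have "group_scalar G c = G.scalar c" "group_scalar H c = H.scalar c"
    by (simp_all add: group_scalar_def G.scalar_def H.scalar_def G.one_is_basis_vector H.one_is_basis_vector fscale_def)
  then show "v \<in> carrier V \<Longrightarrow> group_scalar G c \<odot>\<^bsub>V\<^esub> v = fscale c v"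
    "w \<in> carrier W \<Longrightarrow> group_scalar H c \<odot>\<^bsub>W\<^esub> w = fscale c w"
    by (simp_all add: V.sc_smult W.sc_smult)
qed

lemma tensor_relators_eq:
  "tensor_relators G H V W =
     {basis_vector (v + v', w) - basis_vector (v, w) - basis_vector (v', w)
        | v v' w. v \<in> carrier V \<and> v' \<in> carrier V \<and> w \<in> carrier W} \<union>
     {basis_vector (v, w + w') - basis_vector (v, w) - basis_vector (v, w')
        | v w w'. v \<in> carrier V \<and> w \<in> carrier W \<and> w' \<in> carrier W} \<union>
     {basis_vector (fscale c v, w) - fscale c (basis_vector (v, w)) | c v w. v \<in> carrier V \<and> w \<in> carrier W} \<union>
     {basis_vector (v, fscale c w) - fscale c (basis_vector (v, w)) | c v w. v \<in> carrier V \<and> w \<in> carrier W}"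
proof -
  have minus_scaled: "(\<lambda>p. f p - c * g p) = f - fscale c g" for c and f g :: "_ \<Rightarrow> complex"
    by (auto simp: fscale_apply)
  have minus: "(\<lambda>p. f p - g p) = f - g" for f g :: "_ \<Rightarrow> complex" by auto
  show ?thesis
    unfolding tensor_relators_def V.add_fun W.add_fun minus_scaled
    unfolding minus
    by (intro arg_cong2[of _ _ _ _ "(\<union>)"] refl Collect_cong ex_cong1) (auto simp: group_scalar_smult)
qed

lemma relators_in_F: "tensor_relators G H V W \<subseteq> carrier F"
proof -
  have S: "fs.subspace (carrier F)" by (rule F_subspace[OF FM.carrier_submodule])
  have Va: "v + v' \<in> carrier V" if "v \<in> carrier V" "v' \<in> carrier V" for v v'
    using V.M.a_closed[OF that] by (simp add: V.add_fun)
  have Wa: "w + w' \<in> carrier W" if "w \<in> carrier W" "w' \<in> carrier W" for w w'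
    using W.M.a_closed[OF that] by (simp add: W.add_fun)
  show ?thesis
    unfolding tensor_relators_eq
    by (auto intro!: fs.subspace_diff[OF S] fs.subspace_scale[OF S] basis_vector_in_F Va Wa
        V.fscale_closed W.fscale_closed)
qed

lemma T_submodule: "submodule T R F"
  unfolding T_def by (rule FM.generated_submodule_is_submodule[OF relators_in_F])

lemma relator_in_T: "x \<in> tensor_relators G H V W \<Longrightarrow> x \<in> T"
  unfolding T_def using FM.generated_submodule_superset by blast

text \<open>A bilinear form extends linearly to the free vector space \<open>F\<close>. These extensions separate \<open>T\<close>
  from generators that are not zero in the tensor product.\<close>

definition bilinear_form :: "(('v \<Rightarrow> complex) \<times> ('w \<Rightarrow> complex) \<Rightarrow> complex) \<Rightarrow> bool" where
  "bilinear_form B \<longleftrightarrow>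
     (\<forall>v\<in>carrier V. \<forall>v'\<in>carrier V. \<forall>w\<in>carrier W. B (v + v', w) = B (v, w) + B (v', w)) \<and>
     (\<forall>v\<in>carrier V. \<forall>w\<in>carrier W. \<forall>w'\<in>carrier W. B (v, w + w') = B (v, w) + B (v, w')) \<and>
     (\<forall>c. \<forall>v\<in>carrier V. \<forall>w\<in>carrier W. B (fscale c v, w) = c * B (v, w)) \<and>
     (\<forall>c. \<forall>v\<in>carrier V. \<forall>w\<in>carrier W. B (v, fscale c w) = c * B (v, w))"

definition extend_form :: "('z \<Rightarrow> complex) \<Rightarrow> ('z \<Rightarrow> complex) \<Rightarrow> complex" where
  "extend_form B p = (\<Sum>q\<in>{q. p q \<noteq> 0}. p q * B q)"

lemma extend_form_superset:
  assumes "finite S" "\<And>q. q \<notin> S \<Longrightarrow> p q = 0"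
  shows "extend_form B p = (\<Sum>q\<in>S. p q * B q)"
  unfolding extend_form_def using assms by (intro sum.mono_neutral_left) auto

lemma extend_form_add:
  assumes "finite {q. p q \<noteq> 0}" "finite {q. p' q \<noteq> 0}"
  shows "extend_form B (p + p') = extend_form B p + extend_form B p'"
proof -
  let ?S = "{q. p q \<noteq> 0} \<union> {q. p' q \<noteq> 0}"
  have fin: "finite ?S" using assms by simp
  have "extend_form B (p + p') = (\<Sum>q\<in>?S. (p + p') q * B q)"
    by (rule extend_form_superset[OF fin]) auto
  moreover have "extend_form B p = (\<Sum>q\<in>?S. p q * B q)"
    by (rule extend_form_superset[OF fin]) auto
  moreover have "extend_form B p' = (\<Sum>q\<in>?S. p' q * B q)"
    by (rule extend_form_superset[OF fin]) auto
  ultimately show ?thesis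
    by (simp only: plus_fun_apply distrib_right sum.distrib)
qed

lemma extend_form_fscale:
  assumes "finite {q. p q \<noteq> 0}"
  shows "extend_form B (fscale c p) = c * extend_form B p"
proof -
  have "extend_form B (fscale c p) = (\<Sum>q\<in>{q. p q \<noteq> 0}. fscale c p q * B q)"
    by (rule extend_form_superset[OF assms]) (simp add: fscale_apply)
  then show ?thesis
    by (simp only: extend_form_def[of B p] fscale_apply sum_distrib_left mult.assoc)
qed

lemma extend_form_basis_vector: "extend_form B (basis_vector q) = B q"
  using extend_form_superset[of "{q}" "basis_vector q" B] by (simp add: basis_vector_def)

lemma finite_support_basis_vector: "finite {x. basis_vector q x \<noteq> 0}"
  by (rule finite_subset[of _ "{q}"]) (auto simp: basis_vector_def)

lemma finite_support_sum:
  fixes f :: "'i \<Rightarrow> 'z \<Rightarrow> complex"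
  assumes "\<And>i. i \<in> I \<Longrightarrow> finite {q. f i q \<noteq> 0}"
  shows "finite {q. (\<Sum>i\<in>I. f i) q \<noteq> 0}"
proof (cases "finite I")
  case True
  have "{q. (\<Sum>i\<in>I. f i) q \<noteq> 0} \<subseteq> (\<Union>i\<in>I. {q. f i q \<noteq> 0})"
    unfolding sum_fun_apply by (auto dest: sum.not_neutral_contains_not_neutral)
  then show ?thesis by (rule finite_subset) (use True assms in auto)
qed simp

lemma extend_form_sum:
  fixes f :: "'i \<Rightarrow> 'z \<Rightarrow> complex"
  assumes "finite I" "\<And>i. i \<in> I \<Longrightarrow> finite {q. f i q \<noteq> 0}"
  shows "extend_form B (\<Sum>i\<in>I. f i) = (\<Sum>i\<in>I. extend_form B (f i))"
  using assms
proof (induction I)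
  case empty
  show ?case by (simp add: extend_form_def)
next
  case (insert i I)
  have "extend_form B (f i + (\<Sum>i\<in>I. f i)) = extend_form B (f i) + extend_form B (\<Sum>i\<in>I. f i)"
    using insert.prems by (intro extend_form_add finite_support_sum) auto
  then show "extend_form B (\<Sum>i\<in>insert i I. f i) = (\<Sum>i\<in>insert i I. extend_form B (f i))"
    using insert by simp
qed

lemma extend_form_smult:
  assumes "p \<in> carrier F"
  shows "extend_form B (a \<odot>\<^bsub>F\<^esub> p) = (\<Sum>g\<in>carrier (G \<times>\<times> H). a g * extend_form (\<lambda>q. B (act g q)) p)"
proof -
  let ?S = "{q. p q \<noteq> 0}"
  have S: "finite ?S" "?S \<subseteq> carrier V \<times> carrier W"
    using assms unfolding F.permutation_module_simps(1) by blast+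
  have fin: "finite {q. fscale c (basis_vector z) q \<noteq> 0}" for c and z :: "('v \<Rightarrow> complex) \<times> ('w \<Rightarrow> complex)"
    by (rule finite_subset[OF _ finite_support_basis_vector[of z]]) (auto simp: fscale_apply)
  have "a \<odot>\<^bsub>F\<^esub> p = (\<Sum>g\<in>carrier (G \<times>\<times> H). \<Sum>q\<in>?S. fscale (a g * p q) (basis_vector (act g q)))"
    using S by (intro F.smult_expansion) auto
  then have "extend_form B (a \<odot>\<^bsub>F\<^esub> p) =
      (\<Sum>g\<in>carrier (G \<times>\<times> H). \<Sum>q\<in>?S. extend_form B (fscale (a g * p q) (basis_vector (act g q))))"
    using S(1) GH.finite_carrier fin by (simp add: extend_form_sum finite_support_sum del: carrier_DirProd)
  also have "\<dots> = (\<Sum>g\<in>carrier (G \<times>\<times> H). \<Sum>q\<in>?S. a g * (p q * B (act g q)))"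
    by (simp add: extend_form_fscale[OF finite_support_basis_vector] extend_form_basis_vector mult_ac)
  finally show ?thesis
    by (simp add: extend_form_def sum_distrib_left)
qed

lemma bilinear_form_act:
  assumes "bilinear_form B" "p \<in> carrier (G \<times>\<times> H)"
  shows "bilinear_form (\<lambda>q. B (act p q))"
proof -
  obtain g h where p: "p = (g, h)" "g \<in> carrier G" "h \<in> carrier H" using assms(2) by auto
  note bg = G.basis_vector_closed[OF p(2)] and bh = H.basis_vector_closed[OF p(3)]
  show ?thesis
    using assms(1) unfolding bilinear_form_def
    by (simp add: p(1) act_def V.smult_add[OF bg] W.smult_add[OF bh] V.smult_fscale[OF bg] W.smult_fscale[OF bh]
        V.smult_closed[OF bg] W.smult_closed[OF bh])
qed

text \<open>The vectors killed by all bilinear forms are stable under the group, because the group acts on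
  bilinear forms too. So they are a submodule that contains the relations.\<close>

lemma extend_form_T:
  assumes "p \<in> T" "bilinear_form B"
  shows "extend_form B p = 0"
proof -
  define K where "K = {p \<in> carrier F. \<forall>B. bilinear_form B \<longrightarrow> extend_form B p = 0}"
  have fin: "finite {q. p q \<noteq> 0}" if "p \<in> carrier F" for p
    using that unfolding F.permutation_module_simps(1) by blast
  have "submodule K R F"
  proof (rule FM.submodule_of_closed)
    show "\<zero>\<^bsub>F\<^esub> \<in> K"
      using FM.M.zero_closed by (simp add: K_def F.permutation_module_simps(2) extend_form_def)
  next
    fix x y assume "x \<in> K" "y \<in> K"
    then show "x \<oplus>\<^bsub>F\<^esub> y \<in> K"
      using FM.M.a_closed[of x y] fin extend_form_add[of x y]
      unfolding K_def F.permutation_module_simps(3) by simp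
  next
    fix a x assume a: "a \<in> carrier R" and x: "x \<in> K"
    then show "a \<odot>\<^bsub>F\<^esub> x \<in> K"
      unfolding K_def using FM.smult_closed[OF a, of x] extend_form_smult[of x _ a] bilinear_form_act
      by (simp del: carrier_DirProd)
  qed (auto simp: K_def)
  moreover have "tensor_relators G H V W \<subseteq> K"
  proof
    fix x assume x: "x \<in> tensor_relators G H V W"
    have diff: "extend_form B (p - p') = extend_form B p - extend_form B p'"
      if "finite {q. p q \<noteq> 0}" "finite {q. p' q \<noteq> 0}" for p p' :: "_ \<Rightarrow> complex" and B
    proof -
      have "p - p' = p + fscale (-1) p'" by (simp add: fun_eq_iff fscale_apply)
      moreover have "finite {q. fscale (-1) p' q \<noteq> 0}" using that(2) by (simp add: fscale_apply)
      ultimately show ?thesis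
        using extend_form_add[OF that(1), of "fscale (-1) p'" B] extend_form_fscale[OF that(2), of B "-1"] by simp
    qed
    have fins: "finite {q. (p - p') q \<noteq> 0}" if "finite {q. p q \<noteq> 0}" "finite {q. p' q \<noteq> 0}" for p p' :: "_ \<Rightarrow> complex"
      by (rule finite_subset[of _ "{q. p q \<noteq> 0} \<union> {q. p' q \<noteq> 0}"]) (use that in auto)
    have "extend_form B x = 0" if B: "bilinear_form B" for B
      using x B unfolding tensor_relators_eq bilinear_form_def
      by (auto simp: diff fins finite_support_basis_vector extend_form_basis_vector extend_form_fscale
          fscale_apply finite_subset[OF _ finite_support_basis_vector] 
          simp del: minus_apply)
    then show "x \<in> K" using relators_in_F x unfolding K_def by blast
  qed
  ultimately have "T \<subseteq> K" unfolding T_def by (rule FM.generated_submodule_least)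
  then show ?thesis using assms unfolding K_def by blast
qed

subsection \<open>Congruence modulo the bilinearity relations\<close>

definition cong (infix \<open>\<approx>\<close> 50) where "p \<approx> p' \<longleftrightarrow> p - p' \<in> T"

lemma T_subspace: "fs.subspace T" by (rule F_subspace[OF T_submodule])

lemma cong_refl: "p \<approx> p"
  using fs.subspace_0[OF T_subspace] by (simp add: cong_def)

lemma cong_sym: "p \<approx> p' \<Longrightarrow> p' \<approx> p"
  using fs.subspace_neg[OF T_subspace, of "p - p'"] by (simp add: cong_def)

lemma cong_trans: "p \<approx> p' \<Longrightarrow> p' \<approx> p'' \<Longrightarrow> p \<approx> p''"
  using fs.subspace_add[OF T_subspace, of "p - p'" "p' - p''"] by (simp add: cong_def)

lemma cong_add: "p \<approx> p' \<Longrightarrow> q \<approx> q' \<Longrightarrow> p + q \<approx> p' + q'"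
  using fs.subspace_add[OF T_subspace, of "p - p'" "q - q'"] by (simp add: cong_def algebra_simps)

lemma cong_fscale: "p \<approx> p' \<Longrightarrow> fscale c p \<approx> fscale c p'"
  using fs.subspace_scale[OF T_subspace, of "p - p'" c] by (simp add: cong_def fs.scale_right_diff_distrib)

lemma cong_sum: "(\<And>i. i \<in> I \<Longrightarrow> f i \<approx> g i) \<Longrightarrow> (\<Sum>i\<in>I. f i) \<approx> (\<Sum>i\<in>I. g i)"
  using fs.subspace_sum[OF T_subspace, of I "\<lambda>i. f i - g i"] by (simp add: cong_def sum_subtractf)

lemma cong_relations:
  assumes "v \<in> carrier V" "w \<in> carrier W"
  shows "v' \<in> carrier V \<Longrightarrow> basis_vector (v + v', w) \<approx> basis_vector (v, w) + basis_vector (v', w)"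
    and "w' \<in> carrier W \<Longrightarrow> basis_vector (v, w + w') \<approx> basis_vector (v, w) + basis_vector (v, w')"
    and "basis_vector (fscale c v, w) \<approx> fscale c (basis_vector (v, w))"
    and "basis_vector (v, fscale c w) \<approx> fscale c (basis_vector (v, w))"
  unfolding cong_def diff_diff_eq[symmetric]
  by (rule relator_in_T, unfold tensor_relators_eq, use assms in blast)+

lemma cong_linear_combination:
  assumes S: "fs.subspace S" and f: "\<And>i. i \<in> I \<Longrightarrow> f i \<in> S" and I: "finite I"
    and add: "\<And>x y. x \<in> S \<Longrightarrow> y \<in> S \<Longrightarrow> L (x + y) \<approx> L x + L y"
    and scale: "\<And>c x. x \<in> S \<Longrightarrow> L (fscale c x) \<approx> fscale c (L x)"
  shows "L (\<Sum>i\<in>I. fscale (c i) (f i)) \<approx> (\<Sum>i\<in>I. fscale (c i) (L (f i)))"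
  using I f
proof (induction I)
  case empty
  from scale[OF fs.subspace_0[OF S], of 0]
  show "L (\<Sum>i\<in>{}. fscale (c i) (f i)) \<approx> (\<Sum>i\<in>{}. fscale (c i) (L (f i)))"
    by simp
next
  case (insert i I)
  let ?s = "\<Sum>i\<in>I. fscale (c i) (f i)"
  have fi: "f i \<in> S" using insert.prems by simp
  have s: "?s \<in> S"
    using insert.prems by (intro fs.subspace_sum[OF S] fs.subspace_scale[OF S]) simp
  have "L (fscale (c i) (f i) + ?s) \<approx> L (fscale (c i) (f i)) + L ?s"
    by (rule add[OF fs.subspace_scale[OF S fi] s])
  moreover have "L (fscale (c i) (f i)) + L ?s \<approx>
      fscale (c i) (L (f i)) + (\<Sum>i\<in>I. fscale (c i) (L (f i)))"
    using insert by (intro cong_add scale[OF fi]) simp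
  ultimately have "L (fscale (c i) (f i) + ?s) \<approx> fscale (c i) (L (f i)) + (\<Sum>i\<in>I. fscale (c i) (L (f i)))"
    by (rule cong_trans)
  then show "L (\<Sum>i\<in>insert i I. fscale (c i) (f i)) \<approx> (\<Sum>i\<in>insert i I. fscale (c i) (L (f i)))"
    unfolding sum.insert[OF insert.hyps] .
qed

lemma tens_smult_cong:
  assumes a: "a \<in> carrier (group_algebra G)" and b: "b \<in> carrier (group_algebra H)"
    and v: "v \<in> carrier V" and w: "w \<in> carrier W"
  shows "tens a b \<odot>\<^bsub>F\<^esub> basis_vector (v, w) \<approx> basis_vector (a \<odot>\<^bsub>V\<^esub> v, b \<odot>\<^bsub>W\<^esub> w)"
proof (rule cong_sym)
  let ?gv = "\<lambda>g. basis_vector g \<odot>\<^bsub>V\<^esub> v" and ?hw = "\<lambda>h. basis_vector h \<odot>\<^bsub>W\<^esub> w"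
  have gv: "?gv g \<in> carrier V" if "g \<in> carrier G" for g
    using V.smult_closed[OF G.basis_vector_closed[OF that] v] .
  have hw: "?hw h \<in> carrier W" if "h \<in> carrier H" for h
    using W.smult_closed[OF H.basis_vector_closed[OF that] w] .
  have bw: "b \<odot>\<^bsub>W\<^esub> w \<in> carrier W" by (rule W.smult_closed[OF b w])
  have "basis_vector (a \<odot>\<^bsub>V\<^esub> v, b \<odot>\<^bsub>W\<^esub> w) \<approx> (\<Sum>g\<in>carrier G. fscale (a g) (basis_vector (?gv g, b \<odot>\<^bsub>W\<^esub> w)))"
    unfolding G.smult_group_expansion[OF V a v] using V.submodule_subspace[OF V.carrier_submodule] gv G.finite_carrier
    by (rule cong_linear_combination[where L = "\<lambda>v. basis_vector (v, b \<odot>\<^bsub>W\<^esub> w)"])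
      (assumption | rule cong_relations(1,3)[OF _ bw])+
  moreover have "(\<Sum>g\<in>carrier G. fscale (a g) (basis_vector (?gv g, b \<odot>\<^bsub>W\<^esub> w))) \<approx>
      (\<Sum>g\<in>carrier G. fscale (a g) (\<Sum>h\<in>carrier H. fscale (b h) (basis_vector (?gv g, ?hw h))))"
    unfolding H.smult_group_expansion[OF W b w]
  proof (intro cong_sum cong_fscale)
    fix g assume g: "g \<in> carrier G"
    show "basis_vector (?gv g, \<Sum>h\<in>carrier H. fscale (b h) (?hw h)) \<approx>
        (\<Sum>h\<in>carrier H. fscale (b h) (basis_vector (?gv g, ?hw h)))"
      using W.submodule_subspace[OF W.carrier_submodule] hw H.finite_carrier
      by (rule cong_linear_combination[where L = "\<lambda>w. basis_vector (?gv g, w)"])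
        (assumption | rule cong_relations(2,4)[OF gv[OF g]])+
  qed
  moreover have "(\<Sum>g\<in>carrier G. fscale (a g) (\<Sum>h\<in>carrier H. fscale (b h) (basis_vector (?gv g, ?hw h)))) =
      tens a b \<odot>\<^bsub>F\<^esub> basis_vector (v, w)"
  proof -
    have "tens a b \<odot>\<^bsub>F\<^esub> basis_vector (v, w) = (\<Sum>p\<in>carrier (G \<times>\<times> H). \<Sum>x\<in>{(v, w)}.
        fscale (tens a b p * basis_vector (v, w) x) (basis_vector (act p x)))"
      using v w by (intro F.smult_expansion) (auto simp: basis_vector_def)
    also have "\<dots> = (\<Sum>p\<in>carrier G \<times> carrier H. fscale (tens a b p) (basis_vector (act p (v, w))))"
      by (simp add: basis_vector_apply)
    also have "\<dots> = (\<Sum>g\<in>carrier G. \<Sum>h\<in>carrier H. fscale (tens a b (g, h)) (basis_vector (act (g, h) (v, w))))"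
      by (simp add: sum.cartesian_product case_prod_unfold tens_def)
    also have "\<dots> = (\<Sum>g\<in>carrier G. fscale (a g) (\<Sum>h\<in>carrier H. fscale (b h) (basis_vector (?gv g, ?hw h))))"
      by (simp add: act_def fs.scale_sum_right)
    finally show ?thesis by (rule sym)
  qed
  ultimately show "basis_vector (a \<odot>\<^bsub>V\<^esub> v, b \<odot>\<^bsub>W\<^esub> w) \<approx> tens a b \<odot>\<^bsub>F\<^esub> basis_vector (v, w)"
    using cong_trans by simp
qed

text \<open>Let \<open>v = x v\<close> and \<open>w = y w\<close> be nonzero. They generate \<open>V\<close> and \<open>W\<close>, so the class of \<open>(v, w)\<close>
  generates the tensor product, and it is fixed by \<open>x \<otimes> y\<close>. Hence the tensor product is an image
  of the simple left ideal of \<open>x \<otimes> y\<close>. It is not zero: for points \<open>s\<close> and \<open>t\<close> with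
  \<open>v s \<noteq> 0\<close> and \<open>w t \<noteq> 0\<close>, the bilinear form that multiplies the values at \<open>s\<close> and \<open>t\<close> does not
  vanish on \<open>(v, w)\<close>.\<close>

theorem outer_tensor_simple:
  assumes x: "scalar_corner (group_algebra G) G.scalar x" and y: "scalar_corner (group_algebra H) H.scalar y"
    and simple: "simple_module (group_algebra G) V" "simple_module (group_algebra H) W"
    and acts: "acts_nontrivially x V" "acts_nontrivially y W"
  shows "simple_module R (outer_tensor G H V W)" "acts_nontrivially (tens x y) (outer_tensor G H V W)"
proof -
  interpret x: scalar_corner "group_algebra G" G.scalar x by (rule x)
  interpret y: scalar_corner "group_algebra H" H.scalar y by (rule y)
  interpret E: scalar_corner R GH.scalar "tens x y" by (rule tens_scalar_corner[OF x y])
  interpret Q: module_quotient R F T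
    by (intro module_quotient.intro FM.left_module_axioms module_quotient_axioms.intro T_submodule)
  obtain v where v: "v \<in> carrier V" "x \<odot>\<^bsub>V\<^esub> v = v" "v \<noteq> \<zero>\<^bsub>V\<^esub>"
    using x.fixed_vector_exists[OF simple_moduleD(1)[OF simple(1)] acts(1)] by blast
  obtain w where w: "w \<in> carrier W" "y \<odot>\<^bsub>W\<^esub> w = w" "w \<noteq> \<zero>\<^bsub>W\<^esub>"
    using y.fixed_vector_exists[OF simple_moduleD(1)[OF simple(2)] acts(2)] by blast
  define q where "q = basis_vector (v, w)"
  have qF: "q \<in> carrier F" unfolding q_def by (rule basis_vector_in_F[OF v(1) w(1)])
  have cong_coset: "T +>\<^bsub>F\<^esub> p = T +>\<^bsub>F\<^esub> p'" if "p \<approx> p'" "p \<in> carrier F" "p' \<in> carrier F" for p p'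
  proof -
    have "p \<ominus>\<^bsub>F\<^esub> p' = p - p'"
    proof -
      have "(p \<ominus>\<^bsub>F\<^esub> p') \<oplus>\<^bsub>F\<^esub> p' = p"
        using that(2,3) by (simp add: a_minus_def FM.M.a_assoc FM.M.l_neg)
      then have "(p \<ominus>\<^bsub>F\<^esub> p') + p' = p" by (simp only: F.permutation_module_simps(3))
      then show ?thesis by (simp only: eq_diff_eq)
    qed
    then show ?thesis
      using that(1) unfolding Q.coset_eq_iff[OF that(2,3)] cong_def by simp
  qed
  have Eq: "tens x y \<odot>\<^bsub>F\<^esub> q \<approx> q"
    using tens_smult_cong[OF x.e_closed y.e_closed v(1) w(1)] unfolding v(2) w(2) q_def .
  have EqF: "tens x y \<odot>\<^bsub>F\<^esub> q \<in> carrier F" by (rule FM.smult_closed[OF E.e_closed qF])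
  have notin: "q \<notin> T"
  proof
    assume "q \<in> T"
    obtain s where s: "v s \<noteq> 0" using v(3) by (auto simp: V.zero_fun fun_eq_iff)
    obtain t where t: "w t \<noteq> 0" using w(3) by (auto simp: W.zero_fun fun_eq_iff)
    define B where "B = (\<lambda>(v :: 'v \<Rightarrow> complex, w :: 'w \<Rightarrow> complex). v s * w t)"
    have "bilinear_form B"
      by (auto simp: bilinear_form_def B_def Rings.ring_distribs fscale_apply)
    then have "extend_form B q = 0" by (rule extend_form_T[OF \<open>q \<in> T\<close>])
    then show False using s t by (simp add: q_def extend_form_basis_vector B_def)
  qed
  show acts_E: "acts_nontrivially (tens x y) (outer_tensor G H V W)"
    unfolding outer_tensor_eq
  proof (rule Q.acts_nontrivially_quotient[OF E.e_closed qF])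
    show "tens x y \<odot>\<^bsub>F\<^esub> q \<notin> T"
      using notin cong_coset[OF Eq EqF qF] Q.coset_eq_zero_iff[OF qF] Q.coset_eq_zero_iff[OF EqF] by simp
  qed
  have genV: "carrier V = {a \<odot>\<^bsub>V\<^esub> v | a. a \<in> carrier (group_algebra G)}"
    by (rule x.simple_module_generated_by[OF simple(1) v(1,3)])
  have genW: "carrier W = {b \<odot>\<^bsub>W\<^esub> w | b. b \<in> carrier (group_algebra H)}"
    by (rule y.simple_module_generated_by[OF simple(2) w(1,3)])
  define N where "N = {p. \<exists>a\<in>carrier R. p \<approx> a \<odot>\<^bsub>F\<^esub> q}"
  have "fs.subspace N"
  proof (rule fs.subspaceI)
    have "\<zero>\<^bsub>R\<^esub> \<odot>\<^bsub>F\<^esub> q = 0" using FM.zero_smult[OF qF] by (simp add: F.permutation_module_simps(2))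
    then show "0 \<in> N" unfolding N_def using cong_refl[of 0] by (intro CollectI bexI[of _ "\<zero>\<^bsub>R\<^esub>"]) simp_all
  next
    fix p p' assume "p \<in> N" "p' \<in> N"
    then obtain a b where ab: "a \<in> carrier R" "b \<in> carrier R" "p \<approx> a \<odot>\<^bsub>F\<^esub> q" "p' \<approx> b \<odot>\<^bsub>F\<^esub> q"
      unfolding N_def by blast
    have "p + p' \<approx> (a \<oplus>\<^bsub>R\<^esub> b) \<odot>\<^bsub>F\<^esub> q"
      unfolding FM.smult_l_distr[OF ab(1,2) qF] F.permutation_module_simps(3) by (rule cong_add[OF ab(3,4)])
    then show "p + p' \<in> N"
      unfolding N_def using GH.CG.a_closed[OF ab(1,2)] by blast
  next
    fix c p assume "p \<in> N"
    then obtain a where a: "a \<in> carrier R" "p \<approx> a \<odot>\<^bsub>F\<^esub> q" unfolding N_def by blast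
    have "fscale c p \<approx> (GH.scalar c \<otimes>\<^bsub>R\<^esub> a) \<odot>\<^bsub>F\<^esub> q"
      unfolding FM.smult_assoc1[OF GH.CG.sc_closed a(1) qF] F.scalar_smult[OF FM.smult_closed[OF a(1) qF]]
      by (rule cong_fscale[OF a(2)])
    then show "fscale c p \<in> N"
      unfolding N_def using GH.mult_closed by blast
  qed
  moreover have "basis_vector z \<in> N" if z: "z \<in> carrier V \<times> carrier W" for z
  proof -
    obtain a b where ab: "a \<in> carrier (group_algebra G)" "b \<in> carrier (group_algebra H)"
      "z = (a \<odot>\<^bsub>V\<^esub> v, b \<odot>\<^bsub>W\<^esub> w)"
      using z genV genW by blast
    show ?thesis
      unfolding N_def ab(3) q_def
      using cong_sym[OF tens_smult_cong[OF ab(1,2) v(1) w(1)]] tens_closed[OF ab(1,2)] by blast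
  qed
  ultimately have FN: "p \<in> N" if p: "p \<in> carrier F" for p
  proof -
    let ?S = "{z. p z \<noteq> 0}"
    have S: "finite ?S" "?S \<subseteq> carrier V \<times> carrier W"
      using p unfolding F.permutation_module_simps(1) by blast+
    have "(\<Sum>z\<in>?S. fscale (p z) (basis_vector z)) \<in> N"
      using S(2) \<open>fs.subspace N\<close> \<open>\<And>z. z \<in> carrier V \<times> carrier W \<Longrightarrow> basis_vector z \<in> N\<close>
      by (intro fs.subspace_sum fs.subspace_scale) auto
    moreover have "p = (\<Sum>z\<in>?S. fscale (p z) (basis_vector z))"
      by (rule basis_expansion[OF S(1)]) simp
    ultimately show ?thesis by (rule back_subst[of "\<lambda>p. p \<in> N", OF _ sym])
  qed
  let ?Q = "quotient_module F T"
  have "simple_module R ?Q"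
  proof (rule GH.CG.cyclic_image_of_simple_left_ideal[OF E.e_closed E.e_idem])
    show "simple_module R (left_ideal_module R (tens x y))"
      by (rule GH.corner_left_ideal_simple[OF E.scalar_corner_axioms])
    show "left_module R ?Q" by (rule Q.quotient_left_module)
    show "T +>\<^bsub>F\<^esub> q \<in> carrier ?Q" by (rule Q.coset_in_quotient[OF qF])
    show "tens x y \<odot>\<^bsub>?Q\<^esub> (T +>\<^bsub>F\<^esub> q) = T +>\<^bsub>F\<^esub> q"
      unfolding Q.smult_quotient[OF E.e_closed qF] by (rule cong_coset[OF Eq EqF qF])
    show "T +>\<^bsub>F\<^esub> q \<noteq> \<zero>\<^bsub>?Q\<^esub>"
      unfolding Q.zero_quotient Q.coset_eq_zero_iff[OF qF] by (rule notin)
    show "carrier ?Q = {a \<odot>\<^bsub>?Q\<^esub> (T +>\<^bsub>F\<^esub> q) | a. a \<in> carrier R}"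
    proof (intro Set.set_eqI iffI)
      fix Z assume "Z \<in> carrier ?Q"
      then obtain p where p: "p \<in> carrier F" "Z = T +>\<^bsub>F\<^esub> p" unfolding Q.carrier_quotient by blast
      then obtain a where a: "a \<in> carrier R" "p \<approx> a \<odot>\<^bsub>F\<^esub> q" using FN unfolding N_def by blast
      have "Z = a \<odot>\<^bsub>?Q\<^esub> (T +>\<^bsub>F\<^esub> q)"
        unfolding p(2) Q.smult_quotient[OF a(1) qF]
        by (rule cong_coset[OF a(2) p(1) FM.smult_closed[OF a(1) qF]])
      then show "Z \<in> {a \<odot>\<^bsub>?Q\<^esub> (T +>\<^bsub>F\<^esub> q) | a. a \<in> carrier R}" using a(1) by blast
    next
      fix Z assume "Z \<in> {a \<odot>\<^bsub>?Q\<^esub> (T +>\<^bsub>F\<^esub> q) | a. a \<in> carrier R}"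
      then obtain a where a: "a \<in> carrier R" "Z = a \<odot>\<^bsub>?Q\<^esub> (T +>\<^bsub>F\<^esub> q)" by blast
      show "Z \<in> carrier ?Q"
        unfolding a(2) Q.smult_quotient[OF a(1) qF] by (rule Q.coset_in_quotient[OF FM.smult_closed[OF a(1) qF]])
    qed
  qed
  then show "simple_module R (outer_tensor G H V W)" unfolding outer_tensor_eq .
qed

end

section \<open>Specht modules are self-dual\<close>

lemma (in function_module) restrict_function_module:
  assumes "submodule N R M" shows "function_module R sc (M\<lparr>carrier := N\<rparr>)"
  using restrict_left_module[OF assms] submoduleD(1)[OF assms] submodule_finite_dimensional[OF assms]
  by (intro function_module.intro function_module_axioms.intro complex_algebra_axioms)
    (auto simp: zero_fun add_fun sc_smult)

lemma finite_group_sym_group: "finite_group (sym_group k)"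
  by (intro finite_group.intro sym_group_is_group finite_group_axioms.intro)
    (simp add: sym_group_def finite_permutations)

lemma image_compose_subset: "B \<subseteq> A \<Longrightarrow> compose A g f ` B = g ` f ` B"
  by (auto simp: compose_def image_iff)

lemma finite_tableaux: "finite (tableaux k \<alpha>)"
proof -
  have "cells \<alpha> = (SIGMA i:{..<length \<alpha>}. {..<\<alpha> ! i})" by (auto simp: cells_def)
  then have "finite (cells \<alpha> \<rightarrow>\<^sub>E {1..k})" by (auto intro!: finite_PiE)
  moreover have "tableaux k \<alpha> \<subseteq> cells \<alpha> \<rightarrow>\<^sub>E {1..k}"
    by (auto simp: tableaux_def PiE_def bij_betw_def)
  ultimately show ?thesis by (rule finite_subset[rotated])
qed

lemma compose_tableau:
  assumes "\<sigma> permutes {1..k}" "t \<in> tableaux k \<alpha>"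
  shows "compose (cells \<alpha>) \<sigma> t \<in> tableaux k \<alpha>"
proof -
  have "bij_betw (\<sigma> \<circ> t) (cells \<alpha>) {1..k}"
    using assms permutes_imp_bij by (auto simp: tableaux_def intro: bij_betw_trans)
  then have "bij_betw (compose (cells \<alpha>) \<sigma> t) (cells \<alpha>) {1..k}"
    by (rule bij_betw_cong[THEN iffD1, rotated]) (simp add: compose_def)
  then show ?thesis by (simp add: tableaux_def compose_extensional)
qed

lemma compose_inverse_tableau:
  assumes "\<And>i. \<sigma> (\<tau> i) = i" "s \<in> tableaux k \<alpha>"
  shows "compose (cells \<alpha>) \<sigma> (compose (cells \<alpha>) \<tau> s) = s"
  using assms by (auto simp: compose_def tableaux_def extensional_def restrict_def fun_eq_iff)

lemma compose_tabloid:
  assumes \<sigma>: "\<sigma> permutes {1..k}"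
  shows "compose (cells \<alpha>) \<sigma> ` tabloid k \<alpha> t = tabloid k \<alpha> (compose (cells \<alpha>) \<sigma> t)"
proof
  have rows: "compose (cells \<alpha>) \<tau> s ` {c \<in> cells \<alpha>. fst c = i} = \<tau> ` s ` {c \<in> cells \<alpha>. fst c = i}"
    for \<tau> :: "nat \<Rightarrow> nat" and s i
    by (rule image_compose_subset) blast
  show "compose (cells \<alpha>) \<sigma> ` tabloid k \<alpha> t \<subseteq> tabloid k \<alpha> (compose (cells \<alpha>) \<sigma> t)"
  proof
    fix z assume "z \<in> compose (cells \<alpha>) \<sigma> ` tabloid k \<alpha> t"
    then obtain s where s: "z = compose (cells \<alpha>) \<sigma> s" "s \<in> tableaux k \<alpha>"
      "\<And>i. s ` {c \<in> cells \<alpha>. fst c = i} = t ` {c \<in> cells \<alpha>. fst c = i}"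
      by (auto simp: tabloid_def)
    then show "z \<in> tabloid k \<alpha> (compose (cells \<alpha>) \<sigma> t)"
      unfolding tabloid_def s(1) rows mem_Collect_eq using compose_tableau[OF \<sigma> s(2)] s(3) by simp
  qed
  show "tabloid k \<alpha> (compose (cells \<alpha>) \<sigma> t) \<subseteq> compose (cells \<alpha>) \<sigma> ` tabloid k \<alpha> t"
  proof
    fix s assume s: "s \<in> tabloid k \<alpha> (compose (cells \<alpha>) \<sigma> t)"
    define u where "u = compose (cells \<alpha>) (inv' \<sigma>) s"
    have sT: "s \<in> tableaux k \<alpha>" and s_rows: "\<And>i. s ` {c \<in> cells \<alpha>. fst c = i} = \<sigma> ` t ` {c \<in> cells \<alpha>. fst c = i}"
      using s unfolding tabloid_def rows by blast+
    have "u ` {c \<in> cells \<alpha>. fst c = i} = t ` {c \<in> cells \<alpha>. fst c = i}" for i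
      unfolding u_def rows s_rows by (simp add: image_image permutes_inverses[OF \<sigma>])
    then have "u \<in> tabloid k \<alpha> t"
      using compose_tableau[OF permutes_inv[OF \<sigma>] sT] by (simp add: tabloid_def u_def)
    moreover have "s = compose (cells \<alpha>) \<sigma> u"
      unfolding u_def using compose_inverse_tableau[OF _ sT, of \<sigma> "inv' \<sigma>"] permutes_inverses(1)[OF \<sigma>] by simp
    ultimately show "s \<in> compose (cells \<alpha>) \<sigma> ` tabloid k \<alpha> t" by blast
  qed
qed

lemma tabloid_action:
  "finite_permutation_action (sym_group k) (tabloid k \<alpha> ` tableaux k \<alpha>) (\<lambda>\<sigma> T. compose (cells \<alpha>) \<sigma> ` T)"
proof (intro finite_permutation_action.intro permutation_action.intro finite_group_sym_group
    permutation_action_axioms.intro finite_permutation_action_axioms.intro)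
  fix \<sigma> \<tau> T assume \<sigma>: "\<sigma> \<in> carrier (sym_group k)" and T: "T \<in> tabloid k \<alpha> ` tableaux k \<alpha>"
  then obtain t where t: "t \<in> tableaux k \<alpha>" "T = tabloid k \<alpha> t" by blast
  then show "compose (cells \<alpha>) \<sigma> ` T \<in> tabloid k \<alpha> ` tableaux k \<alpha>"
    using \<sigma> compose_tabloid[of \<sigma> k \<alpha> t] compose_tableau[of \<sigma> k t \<alpha>] by (auto simp: sym_group_carrier)
  show "compose (cells \<alpha>) (\<sigma> \<otimes>\<^bsub>sym_group k\<^esub> \<tau>) ` T = compose (cells \<alpha>) \<sigma> ` compose (cells \<alpha>) \<tau> ` T"
    unfolding image_image by (intro image_cong refl) (auto simp: sym_group_mult compose_def fun_eq_iff)
next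
  fix T assume "T \<in> tabloid k \<alpha> ` tableaux k \<alpha>"
  then have "compose (cells \<alpha>) id s = s" if "s \<in> T" for s
    using that by (auto simp: tabloid_def tableaux_def compose_def extensional_def restrict_def fun_eq_iff)
  then show "compose (cells \<alpha>) \<one>\<^bsub>sym_group k\<^esub> ` T = T" by (simp add: sym_group_one)
qed (simp add: finite_tableaux)

context
  fixes k :: nat and \<alpha> :: "nat list"
begin

interpretation S: finite_group "sym_group k" by (rule finite_group_sym_group)

interpretation T: finite_permutation_action "sym_group k" "tabloid k \<alpha> ` tableaux k \<alpha>"
    "\<lambda>\<sigma> T. compose (cells \<alpha>) \<sigma> ` T"
  by (rule tabloid_action)

interpretation TM: function_module "group_algebra (sym_group k)" S.scalar "tabloid_module k \<alpha>"
  unfolding tabloid_module_def by (rule T.permutation_function_module)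

lemma polytabloid_in_tabloid_module:
  assumes "t \<in> tableaux k \<alpha>" shows "polytabloid k \<alpha> t \<in> carrier (tabloid_module k \<alpha>)"
proof -
  have "polytabloid k \<alpha> t T = 0" if T: "T \<notin> tabloid k \<alpha> ` tableaux k \<alpha>" for T
    unfolding polytabloid_def
  proof (intro sum.neutral ballI)
    fix \<pi> assume "\<pi> \<in> column_group k \<alpha> t"
    then have "\<pi> permutes {1..k}" by (simp add: column_group_def sym_group_carrier)
    then have "tabloid k \<alpha> (compose (cells \<alpha>) \<pi> t) \<noteq> T"
      using compose_tableau[OF _ assms] T by blast
    then show "of_int (sign \<pi>) * basis_vector (tabloid k \<alpha> (compose (cells \<alpha>) \<pi> t)) T = 0"
      by (simp add: basis_vector_def)
  qed
  moreover from this have "{T. polytabloid k \<alpha> t T \<noteq> 0} \<subseteq> tabloid k \<alpha> ` tableaux k \<alpha>" by blast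
  ultimately show ?thesis
    unfolding tabloid_module_def T.permutation_module_simps(1)
    using finite_subset[OF _ T.finite_X] by blast
qed

lemma specht_submodule: "submodule (carrier (specht_module k \<alpha>)) (group_algebra (sym_group k)) (tabloid_module k \<alpha>)"
  unfolding specht_module_def
  using TM.generated_submodule_is_submodule[of "polytabloid k \<alpha> ` tableaux k \<alpha>"] polytabloid_in_tabloid_module
  by auto

lemma specht_function_module: "function_module (group_algebra (sym_group k)) S.scalar (specht_module k \<alpha>)"
  using TM.restrict_function_module[OF specht_submodule] by (simp add: specht_module_def)

lemma cnj_smult:
  "(\<lambda>T. cnj ((a \<odot>\<^bsub>tabloid_module k \<alpha>\<^esub> v) T)) =
    (\<lambda>g. cnj (a g)) \<odot>\<^bsub>tabloid_module k \<alpha>\<^esub> (\<lambda>T. cnj (v T))"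
  unfolding tabloid_module_def by (rule ext) (simp add: T.smult_apply)

text \<open>The generating polytabloids have integer coefficients.\<close>

lemma specht_cnj_closed:
  assumes "v \<in> carrier (specht_module k \<alpha>)"
  shows "(\<lambda>T. cnj (v T)) \<in> carrier (specht_module k \<alpha>)"
proof -
  define N where "N = {v \<in> carrier (tabloid_module k \<alpha>). (\<lambda>T. cnj (v T)) \<in> carrier (specht_module k \<alpha>)}"
  note SD = submoduleD[OF specht_submodule]
  have "submodule N (group_algebra (sym_group k)) (tabloid_module k \<alpha>)"
  proof (rule TM.submodule_of_closed)
    have "(\<lambda>T. cnj ((0 :: (nat \<times> nat \<Rightarrow> nat) set \<Rightarrow> complex) T)) = 0" by auto
    then show "\<zero>\<^bsub>tabloid_module k \<alpha>\<^esub> \<in> N"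
      using TM.M.zero_closed SD(2) unfolding N_def TM.zero_fun by simp
  next
    fix v w assume vw: "v \<in> N" "w \<in> N"
    have "(\<lambda>T. cnj ((v + w) T)) = (\<lambda>T. cnj (v T)) + (\<lambda>T. cnj (w T))" by auto
    then show "v \<oplus>\<^bsub>tabloid_module k \<alpha>\<^esub> w \<in> N"
      using vw SD(3)[of "\<lambda>T. cnj (v T)" "\<lambda>T. cnj (w T)"] TM.M.a_closed[of v w]
      unfolding N_def TM.add_fun by simp
  next
    fix a v assume a: "a \<in> carrier (group_algebra (sym_group k))" and v: "v \<in> N"
    have "(\<lambda>g. cnj (a g)) \<in> carrier (group_algebra (sym_group k))"
      using a by (simp add: S.algebra_simps(1))
    then show "a \<odot>\<^bsub>tabloid_module k \<alpha>\<^esub> v \<in> N"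
      using v SD(4)[of "\<lambda>g. cnj (a g)" "\<lambda>T. cnj (v T)"] TM.smult_closed[OF a, of v]
      unfolding N_def mem_Collect_eq cnj_smult by blast
  qed (auto simp: N_def)
  moreover have "polytabloid k \<alpha> ` tableaux k \<alpha> \<subseteq> N"
  proof
    fix p assume "p \<in> polytabloid k \<alpha> ` tableaux k \<alpha>"
    then obtain t where t: "t \<in> tableaux k \<alpha>" "p = polytabloid k \<alpha> t" by blast
    have "(\<lambda>T. cnj (p T)) = p"
      unfolding t(2) polytabloid_def by (rule ext) (auto simp: basis_vector_def intro!: sum.cong)
    moreover have "p \<in> carrier (specht_module k \<alpha>)"
      using TM.generated_submodule_superset[of "polytabloid k \<alpha> ` tableaux k \<alpha>"] t
      unfolding specht_module_def by auto
    ultimately show "p \<in> N"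
      using polytabloid_in_tabloid_module[OF t(1)] t(2) unfolding N_def by simp
  qed
  ultimately have "carrier (specht_module k \<alpha>) \<subseteq> N"
    unfolding specht_module_def using TM.generated_submodule_least by simp
  then show ?thesis using assms unfolding N_def by blast
qed

text \<open>Let \<open>v = e v\<close> be a nonzero vector of the Specht module, and let \<open>w\<close> be its complex conjugate,
  which lies in the Specht module as well. Conjugation turns the action of \<open>flip e\<close> on \<open>w\<close> into the
  action of the adjoint of \<open>e\<close> on \<open>v\<close>. If this were zero, then moving \<open>e\<close> to the other side of the
  form would give \<open>\<langle>v, v\<rangle> = \<langle>e v, v\<rangle> = 0\<close>.\<close>

theorem specht_flip_acts_nontrivially:
  assumes e: "e \<in> carrier (group_algebra (sym_group k))" "e \<otimes>\<^bsub>group_algebra (sym_group k)\<^esub> e = e"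
      "e \<noteq> 0"
    and iso: "module_iso (group_algebra (sym_group k)) (left_ideal_module (group_algebra (sym_group k)) e)
      (specht_module k \<alpha>)"
  shows "acts_nontrivially e (specht_module k \<alpha>)" "acts_nontrivially (S.flip e) (specht_module k \<alpha>)"
proof -
  let ?CS = "group_algebra (sym_group k)"
  let ?X = "tabloid k \<alpha> ` tableaux k \<alpha>"
  interpret SM: function_module ?CS S.scalar "specht_module k \<alpha>" by (rule specht_function_module)
  have eP: "e \<in> carrier (left_ideal_module ?CS e)"
    by (rule S.CG.idempotent_in_left_ideal_module(1)[OF e(1,2)])
  have "e \<odot>\<^bsub>left_ideal_module ?CS e\<^esub> e \<noteq> \<zero>\<^bsub>left_ideal_module ?CS e\<^esub>"
    unfolding left_ideal_module_simps(2,4) S.algebra_simps(2) e(2) by (rule e(3))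
  then have "acts_nontrivially e (left_ideal_module ?CS e)"
    unfolding acts_nontrivially_def using eP by blast
  then show acts: "acts_nontrivially e (specht_module k \<alpha>)"
    by (rule acts_nontrivially_iso[OF iso S.CG.left_ideal_module_left_module[OF e(1)] SM.left_module_axioms e(1)])
  then obtain u where u: "u \<in> carrier (specht_module k \<alpha>)" "e \<odot>\<^bsub>specht_module k \<alpha>\<^esub> u \<noteq> 0"
    unfolding acts_nontrivially_def SM.zero_fun by blast
  have smult_eq: "a \<odot>\<^bsub>specht_module k \<alpha>\<^esub> v = a \<odot>\<^bsub>tabloid_module k \<alpha>\<^esub> v" for a v
    by (simp add: specht_module_def)
  define v where "v = e \<odot>\<^bsub>specht_module k \<alpha>\<^esub> u"
  have v: "v \<in> carrier (specht_module k \<alpha>)" "v \<noteq> 0" "e \<odot>\<^bsub>tabloid_module k \<alpha>\<^esub> v = v"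
    using u SM.smult_closed[OF e(1) u(1)] SM.smult_assoc1[OF e(1) e(1) u(1)]
    by (simp_all add: v_def e(2) smult_eq[symmetric])
  define w where "w = (\<lambda>T. cnj (v T))"
  have w: "w \<in> carrier (specht_module k \<alpha>)" unfolding w_def by (rule specht_cnj_closed[OF v(1)])
  have "S.flip e \<odot>\<^bsub>specht_module k \<alpha>\<^esub> w \<noteq> 0"
  proof
    assume *: "S.flip e \<odot>\<^bsub>specht_module k \<alpha>\<^esub> w = 0"
    have adj_flip: "(\<lambda>g. cnj (S.flip e g)) = S.adj e"
      by (auto simp: S.flip_def S.adj_def)
    have "(\<lambda>T. cnj ((S.flip e \<odot>\<^bsub>tabloid_module k \<alpha>\<^esub> w) T)) = S.adj e \<odot>\<^bsub>tabloid_module k \<alpha>\<^esub> v"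
      unfolding cnj_smult adj_flip by (simp add: w_def)
    then have adj0: "S.adj e \<odot>\<^bsub>tabloid_module k \<alpha>\<^esub> v = 0"
      using * unfolding smult_eq by (auto simp: fun_eq_iff)
    have "hform ?X v v = hform ?X (e \<odot>\<^bsub>tabloid_module k \<alpha>\<^esub> v) v" by (simp only: v(3))
    also have "\<dots> = hform ?X v (S.adj e \<odot>\<^bsub>tabloid_module k \<alpha>\<^esub> v)"
      unfolding tabloid_module_def by (rule T.hform_adj)
    also have "\<dots> = 0" unfolding adj0 by (simp add: hform_def)
    finally have "hform ?X v v = 0" .
    then have "v T = 0" for T
      using hform_self_eq_0[OF T.finite_X, of v T] subsetD[OF submoduleD(1)[OF specht_submodule] v(1)]
      unfolding tabloid_module_def T.permutation_module_simps(1) by blast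
    then show False using v(2) by (auto simp: fun_eq_iff)
  qed
  then show "acts_nontrivially (S.flip e) (specht_module k \<alpha>)"
    unfolding acts_nontrivially_def SM.zero_fun using w by blast
qed

end

section \<open>The algebra of the category of onto functions\<close>

lemma finite_SE_hom: "finite (SE_hom r k)"
proof -
  have "finite {f \<in> {1..r} \<rightarrow>\<^sub>E {1..k}. f ` {1..r} = {1..k}}"
    by (rule finite_subset[of _ "{1..r} \<rightarrow>\<^sub>E {1..k}"]) (auto intro: finite_PiE)
  then show ?thesis
    using bij_betw_finite[OF SE_hom_encoding] by blast
qed

lemma SE_finite_category:
  "finite_category (SE_morphisms n) SE_comp {(k, k, id) | k. k \<le> n}"
proof
  have "SE_morphisms n \<subseteq> (SIGMA r:{..n}. SIGMA k:{..n}. SE_hom r k)"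
    by (auto simp: SE_morphisms_def)
  moreover have "finite (SIGMA r:{..n}. SIGMA k:{..n}. SE_hom r k)"
    by (intro finite_SigmaI finite_SE_hom) auto
  ultimately show "finite (SE_morphisms n)" by (rule finite_subset)
  have id: "id \<in> SE_hom k k" for k by (auto simp: SE_hom_def)
  then show "{(k, k, id) | k. k \<le> n} \<subseteq> SE_morphisms n"
    by (auto simp: SE_morphisms_def)
next
  fix x y z assume "x \<in> SE_morphisms n" "y \<in> SE_morphisms n" "SE_comp x y = Some z"
  then show "z \<in> SE_morphisms n"
    by (cases x; cases y) (auto simp: SE_morphisms_def SE_hom_comp split: if_splits)
next
  fix x y z
  show "Option.bind (SE_comp x y) (\<lambda>w. SE_comp w z) = Option.bind (SE_comp y z) (\<lambda>w. SE_comp x w)"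
    by (cases x; cases y; cases z) (auto simp: comp_assoc)
next
  fix m assume "m \<in> SE_morphisms n"
  then obtain r k f where m: "m = (r, k, f)" "r \<le> n" "k \<le> n" by (auto simp: SE_morphisms_def)
  show "\<exists>i\<in>{(k, k, id) | k. k \<le> n}. \<forall>j\<in>{(k, k, id) | k. k \<le> n}. SE_comp j m = (if j = i then Some m else None)"
    by (rule bexI[of _ "(k, k, id)"]) (auto simp: m)
  show "\<exists>i\<in>{(k, k, id) | k. k \<le> n}. \<forall>j\<in>{(k, k, id) | k. k \<le> n}. SE_comp m j = (if j = i then Some m else None)"
    by (rule bexI[of _ "(r, r, id)"]) (auto simp: m)
qed

lemma SE_hom_action:
  "finite_permutation_action (sym_group k \<times>\<times> sym_group r) (SE_hom r k)
    (\<lambda>(g\<^sub>1, g\<^sub>2) m. g\<^sub>1 \<circ> m \<circ> inv\<^bsub>sym_group r\<^esub> g\<^sub>2)"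
proof (intro finite_permutation_action.intro permutation_action.intro finite_group_DirProd finite_group_sym_group
    permutation_action_axioms.intro finite_permutation_action_axioms.intro finite_SE_hom)
  interpret Sk: finite_group "sym_group k" by (rule finite_group_sym_group)
  interpret Sr: finite_group "sym_group r" by (rule finite_group_sym_group)
  fix p q m assume p: "p \<in> carrier (sym_group k \<times>\<times> sym_group r)" and m: "m \<in> SE_hom r k"
  obtain g h where gh: "p = (g, h)" "g \<in> carrier (sym_group k)" "h \<in> carrier (sym_group r)"
    using p by auto
  have "g \<circ> m \<circ> inv\<^bsub>sym_group r\<^esub> h \<in> SE_hom r k"
    using gh(2) Sr.inv_closed[OF gh(3)] m unfolding SE_hom_self[symmetric] by (intro SE_hom_comp)
  then show "(case p of (g\<^sub>1, g\<^sub>2) \<Rightarrow> \<lambda>m. g\<^sub>1 \<circ> m \<circ> inv\<^bsub>sym_group r\<^esub> g\<^sub>2) m \<in> SE_hom r k"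
    by (simp only: gh(1) prod.case)
  assume q: "q \<in> carrier (sym_group k \<times>\<times> sym_group r)"
  obtain g' h' where gh': "q = (g', h')" "g' \<in> carrier (sym_group k)" "h' \<in> carrier (sym_group r)"
    using q by auto
  have "inv\<^bsub>sym_group r\<^esub> (h \<otimes>\<^bsub>sym_group r\<^esub> h') = inv\<^bsub>sym_group r\<^esub> h' \<circ> inv\<^bsub>sym_group r\<^esub> h"
    using Sr.inv_mult_group[OF gh(3) gh'(3)] by (simp only: sym_group_mult)
  then show "(case p \<otimes>\<^bsub>sym_group k \<times>\<times> sym_group r\<^esub> q of (g\<^sub>1, g\<^sub>2) \<Rightarrow> \<lambda>m. g\<^sub>1 \<circ> m \<circ> inv\<^bsub>sym_group r\<^esub> g\<^sub>2) m =
      (case p of (g\<^sub>1, g\<^sub>2) \<Rightarrow> \<lambda>m. g\<^sub>1 \<circ> m \<circ> inv\<^bsub>sym_group r\<^esub> g\<^sub>2)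
        ((case q of (g\<^sub>1, g\<^sub>2) \<Rightarrow> \<lambda>m. g\<^sub>1 \<circ> m \<circ> inv\<^bsub>sym_group r\<^esub> g\<^sub>2) m)"
    unfolding gh(1) gh'(1) mult_DirProd prod.case by (simp only: sym_group_mult comp_assoc)
next
  interpret Sr: finite_group "sym_group r" by (rule finite_group_sym_group)
  fix m assume "m \<in> SE_hom r k"
  show "(case \<one>\<^bsub>sym_group k \<times>\<times> sym_group r\<^esub> of (g\<^sub>1, g\<^sub>2) \<Rightarrow> \<lambda>m. g\<^sub>1 \<circ> m \<circ> inv\<^bsub>sym_group r\<^esub> g\<^sub>2) m = m"
    unfolding one_DirProd prod.case Sr.inv_one by (simp only: sym_group_one id_comp comp_id)
qed

lemma comp_eq_iff_left:
  assumes "g \<in> carrier (sym_group k)"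
  shows "g \<circ> m = f \<longleftrightarrow> m = inv\<^bsub>sym_group k\<^esub> g \<circ> f"
proof -
  interpret S: finite_group "sym_group k" by (rule finite_group_sym_group)
  have "inv\<^bsub>sym_group k\<^esub> g \<circ> g = id" "g \<circ> inv\<^bsub>sym_group k\<^esub> g = id"
    using S.l_inv[OF assms] S.r_inv[OF assms] by (simp_all only: sym_group_mult sym_group_one)
  then show ?thesis by (metis comp_assoc id_comp)
qed

lemma comp_eq_iff_right:
  assumes "h \<in> carrier (sym_group r)"
  shows "m \<circ> h = f \<longleftrightarrow> m = f \<circ> inv\<^bsub>sym_group r\<^esub> h"
proof -
  interpret S: finite_group "sym_group r" by (rule finite_group_sym_group)
  have "inv\<^bsub>sym_group r\<^esub> h \<circ> h = id" "h \<circ> inv\<^bsub>sym_group r\<^esub> h = id"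
    using S.l_inv[OF assms] S.r_inv[OF assms] by (simp_all only: sym_group_mult sym_group_one)
  then show ?thesis by (metis comp_assoc comp_id)
qed

text \<open>An element of the category algebra is a family of functions on the hom-sets; these are the
  inclusion and the projection of the component with source \<open>r\<close> and target \<open>k\<close>.\<close>

definition extend_hom :: "nat \<Rightarrow> nat \<Rightarrow> ((nat \<Rightarrow> nat) \<Rightarrow> complex) \<Rightarrow> SE_morphism \<Rightarrow> complex" where
  "extend_hom r k m = (\<lambda>(s, t, f). if s = r \<and> t = k then m f else 0)"

definition restrict_hom :: "nat \<Rightarrow> nat \<Rightarrow> (SE_morphism \<Rightarrow> complex) \<Rightarrow> (nat \<Rightarrow> nat) \<Rightarrow> complex" where
  "restrict_hom r k a = (\<lambda>f. if f \<in> SE_hom r k then a (r, k, f) else 0)"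

lemma SE_embed_eq_extend_hom: "SE_embed k = extend_hom k k"
  by (auto simp: SE_embed_def extend_hom_def fun_eq_iff)

context
  fixes n :: nat
begin

interpretation A: finite_category "SE_morphisms n" SE_comp "{(k, k, id) | k. k \<le> n}"
  rewrites "category_algebra (SE_morphisms n) SE_comp {(k, k, id) | k. k \<le> n} = SE_algebra n"
  by (rule SE_finite_category) (simp add: SE_algebra_def)

lemma embed_mult_apply:
  assumes k: "k \<le> n" and M: "(s, k, f) \<in> SE_morphisms n"
  shows "(SE_embed k u \<otimes>\<^bsub>SE_algebra n\<^esub> a) (s, k, f) =
    (\<Sum>g\<in>carrier (sym_group k). u g * a (s, k, inv\<^bsub>sym_group k\<^esub> g \<circ> f))"
proof -
  interpret S: finite_group "sym_group k" by (rule finite_group_sym_group)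
  let ?I = "(\<lambda>g. (k, k, g)) ` carrier (sym_group k)"
  let ?t = "\<lambda>x y. of_bool (SE_comp x y = Some (s, k, f)) * (SE_embed k u x * a y)"
  have "(SE_embed k u \<otimes>\<^bsub>SE_algebra n\<^esub> a) (s, k, f) = (\<Sum>x\<in>SE_morphisms n. \<Sum>y\<in>SE_morphisms n. ?t x y)"
    by (rule A.mult_apply)
  also have "\<dots> = (\<Sum>x\<in>?I. \<Sum>y\<in>SE_morphisms n. ?t x y)"
  proof (rule sum.mono_neutral_right[OF A.finite_C])
    show "?I \<subseteq> SE_morphisms n" using k by (auto simp: SE_morphisms_def SE_hom_self)
    show "\<forall>x\<in>SE_morphisms n - ?I. (\<Sum>y\<in>SE_morphisms n. ?t x y) = 0"
      by (auto simp: SE_embed_def SE_morphisms_def SE_hom_self intro!: sum.neutral)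
  qed
  also have "\<dots> = (\<Sum>g\<in>carrier (sym_group k). \<Sum>y\<in>SE_morphisms n. ?t (k, k, g) y)"
    by (simp add: sum.reindex inj_on_def)
  also have "\<dots> = (\<Sum>g\<in>carrier (sym_group k). u g * a (s, k, inv\<^bsub>sym_group k\<^esub> g \<circ> f))"
  proof (rule sum.cong[OF refl])
    fix g assume g: "g \<in> carrier (sym_group k)"
    let ?y = "(s, k, inv\<^bsub>sym_group k\<^esub> g \<circ> f)"
    have "?y \<in> SE_morphisms n"
      using M S.inv_closed[OF g] unfolding SE_morphisms_def SE_hom_self[symmetric]
      by (auto simp del: sym_group_inv_equality intro!: SE_hom_comp)
    moreover have "?t (k, k, g) y = (if y = ?y then u g * a ?y else 0)" for y
      using comp_eq_iff_left[OF g, of _ f] by (cases y) (auto simp: SE_embed_def simp del: sym_group_inv_equality)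
    ultimately show "(\<Sum>y\<in>SE_morphisms n. ?t (k, k, g) y) = u g * a ?y"
      using A.finite_C by simp
  qed
  finally show ?thesis .
qed

lemma embed_mult_apply_0:
  assumes "t \<noteq> k" shows "(SE_embed k u \<otimes>\<^bsub>SE_algebra n\<^esub> a) (s, t, f) = 0"
  unfolding A.mult_apply using assms by (intro sum.neutral ballI) (auto simp: SE_embed_def split: if_splits)

lemma mult_embed_apply:
  assumes r: "r \<le> n" and M: "(r, t, f) \<in> SE_morphisms n"
  shows "(a \<otimes>\<^bsub>SE_algebra n\<^esub> SE_embed r w) (r, t, f) =
    (\<Sum>h\<in>carrier (sym_group r). a (r, t, f \<circ> inv\<^bsub>sym_group r\<^esub> h) * w h)"
proof -
  interpret S: finite_group "sym_group r" by (rule finite_group_sym_group)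
  let ?I = "(\<lambda>h. (r, r, h)) ` carrier (sym_group r)"
  let ?t = "\<lambda>x y. of_bool (SE_comp x y = Some (r, t, f)) * (a x * SE_embed r w y)"
  have "(a \<otimes>\<^bsub>SE_algebra n\<^esub> SE_embed r w) (r, t, f) = (\<Sum>x\<in>SE_morphisms n. \<Sum>y\<in>SE_morphisms n. ?t x y)"
    by (rule A.mult_apply)
  also have "\<dots> = (\<Sum>y\<in>SE_morphisms n. \<Sum>x\<in>SE_morphisms n. ?t x y)"
    by (rule sum.swap)
  also have "\<dots> = (\<Sum>y\<in>?I. \<Sum>x\<in>SE_morphisms n. ?t x y)"
  proof (rule sum.mono_neutral_right[OF A.finite_C])
    show "?I \<subseteq> SE_morphisms n" using r by (auto simp: SE_morphisms_def SE_hom_self)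
    show "\<forall>y\<in>SE_morphisms n - ?I. (\<Sum>x\<in>SE_morphisms n. ?t x y) = 0"
      by (auto simp: SE_embed_def SE_morphisms_def SE_hom_self intro!: sum.neutral)
  qed
  also have "\<dots> = (\<Sum>h\<in>carrier (sym_group r). \<Sum>x\<in>SE_morphisms n. ?t x (r, r, h))"
    by (simp add: sum.reindex inj_on_def)
  also have "\<dots> = (\<Sum>h\<in>carrier (sym_group r). a (r, t, f \<circ> inv\<^bsub>sym_group r\<^esub> h) * w h)"
  proof (rule sum.cong[OF refl])
    fix h assume h: "h \<in> carrier (sym_group r)"
    let ?x = "(r, t, f \<circ> inv\<^bsub>sym_group r\<^esub> h)"
    have "?x \<in> SE_morphisms n"
      using M S.inv_closed[OF h] unfolding SE_morphisms_def SE_hom_self[symmetric]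
      by (auto simp del: sym_group_inv_equality intro!: SE_hom_comp)
    moreover have "?t x (r, r, h) = (if x = ?x then a ?x * w h else 0)" for x
      using comp_eq_iff_right[OF h, of _ f] by (cases x) (auto simp: SE_embed_def simp del: sym_group_inv_equality)
    ultimately show "(\<Sum>x\<in>SE_morphisms n. ?t x (r, r, h)) = a ?x * w h"
      using A.finite_C by simp
  qed
  finally show ?thesis .
qed

lemma mult_embed_apply_0:
  assumes "s \<noteq> r" shows "(a \<otimes>\<^bsub>SE_algebra n\<^esub> SE_embed r w) (s, t, f) = 0"
  unfolding A.mult_apply using assms by (intro sum.neutral ballI) (auto simp: SE_embed_def split: if_splits)

text \<open>Multiplication by group elements from both sides keeps only the component of \<open>a\<close> with source \<open>r\<close>
  and target \<open>k\<close>, and acts on it through permutations. The second group acts on this component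
  through inverses, which \<open>flip\<close> compensates.\<close>

theorem embed_mult_embed:
  assumes r: "r \<le> n" and k: "k \<le> n"
  shows "SE_embed k u \<otimes>\<^bsub>SE_algebra n\<^esub> a \<otimes>\<^bsub>SE_algebra n\<^esub> SE_embed r w =
    extend_hom r k (tens u (finite_group.flip (sym_group r) w) \<odot>\<^bsub>SE_hom_module r k\<^esub> restrict_hom r k a)"
    (is "?L = extend_hom r k ?R")
proof
  interpret Sk: finite_group "sym_group k" by (rule finite_group_sym_group)
  interpret Sr: finite_group "sym_group r" by (rule finite_group_sym_group)
  interpret X: finite_permutation_action "sym_group k \<times>\<times> sym_group r" "SE_hom r k"
    "\<lambda>(g\<^sub>1, g\<^sub>2) m. g\<^sub>1 \<circ> m \<circ> inv\<^bsub>sym_group r\<^esub> g\<^sub>2"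
    by (rule SE_hom_action)
  fix z :: SE_morphism
  obtain s t f where z: "z = (s, t, f)" by (cases z)
  show "?L z = extend_hom r k ?R z"
  proof (cases "s = r \<and> t = k")
    case False
    then have "?L z = 0"
    proof (cases "s = r")
      case True
      show ?thesis
        unfolding A.mult_assoc z using True False by (intro embed_mult_apply_0) simp
    next
      case False
      then show ?thesis unfolding z by (rule mult_embed_apply_0)
    qed
    then show ?thesis using False by (auto simp: z extend_hom_def)
  next
    case st: True
    show ?thesis
    proof (cases "f \<in> SE_hom r k")
      case False
      then have "(r, k, f) \<notin> SE_morphisms n" by (simp add: SE_morphisms_def)
      then have "?L z = 0"
        using A.mult_closed[of "SE_embed k u \<otimes>\<^bsub>SE_algebra n\<^esub> a" "SE_embed r w"] st
        by (simp add: z A.algebra_simps(1))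
      moreover have "?R f = 0"
        unfolding SE_hom_module_def X.smult_apply using False by simp
      ultimately show ?thesis using st by (simp add: z extend_hom_def)
    next
      case f: True
      then have M: "(r, k, f) \<in> SE_morphisms n" using r k by (simp add: SE_morphisms_def)
      have inv_in: "f \<circ> inv\<^bsub>sym_group r\<^esub> h \<in> SE_hom r k" if "h \<in> carrier (sym_group r)" for h
        using f Sr.inv_closed[OF that] unfolding SE_hom_self[symmetric] by (intro SE_hom_comp)
      have "?L z = (\<Sum>h\<in>carrier (sym_group r). (\<Sum>g\<in>carrier (sym_group k).
          u g * a (r, k, inv\<^bsub>sym_group k\<^esub> g \<circ> (f \<circ> inv\<^bsub>sym_group r\<^esub> h))) * w h)"
        using st unfolding z by (simp only: mult_embed_apply[OF r M])
          (intro sum.cong refl arg_cong2[of _ _ _ _ "(*)"] embed_mult_apply k;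
            use inv_in r k in \<open>simp add: SE_morphisms_def del: sym_group_inv_equality\<close>)
      also have "\<dots> = (\<Sum>h\<in>carrier (sym_group r). \<Sum>g\<in>carrier (sym_group k).
          u g * w h * a (r, k, inv\<^bsub>sym_group k\<^esub> g \<circ> f \<circ> inv\<^bsub>sym_group r\<^esub> h))"
        by (simp only: sum_distrib_right comp_assoc) (simp only: mult_ac)
      also have "\<dots> = (\<Sum>h\<in>carrier (sym_group r). \<Sum>g\<in>carrier (sym_group k).
          u g * w (inv\<^bsub>sym_group r\<^esub> h) *
            a (r, k, inv\<^bsub>sym_group k\<^esub> g \<circ> f \<circ> inv\<^bsub>sym_group r\<^esub> (inv\<^bsub>sym_group r\<^esub> h)))"
        by (rule sum.reindex_bij_witness[of _ "\<lambda>h. inv\<^bsub>sym_group r\<^esub> h" "\<lambda>h. inv\<^bsub>sym_group r\<^esub> h"])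
          (simp_all only: Sr.inv_inv Sr.inv_closed)
      also have "\<dots> = (\<Sum>g\<in>carrier (sym_group k). \<Sum>h\<in>carrier (sym_group r).
          u g * w (inv\<^bsub>sym_group r\<^esub> h) *
            a (r, k, inv\<^bsub>sym_group k\<^esub> g \<circ> f \<circ> inv\<^bsub>sym_group r\<^esub> (inv\<^bsub>sym_group r\<^esub> h)))"
        by (rule sum.swap)
      also have "\<dots> = (\<Sum>p\<in>carrier (sym_group k) \<times> carrier (sym_group r).
          u (fst p) * w (inv\<^bsub>sym_group r\<^esub> snd p) *
            a (r, k, inv\<^bsub>sym_group k\<^esub> fst p \<circ> f \<circ> inv\<^bsub>sym_group r\<^esub> (inv\<^bsub>sym_group r\<^esub> snd p)))"
        by (simp only: sum.cartesian_product case_prod_unfold)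
      also have "\<dots> = ?R f"
      proof -
        have summand: "u (fst p) * w (inv\<^bsub>sym_group r\<^esub> snd p) *
            a (r, k, inv\<^bsub>sym_group k\<^esub> fst p \<circ> f \<circ> inv\<^bsub>sym_group r\<^esub> (inv\<^bsub>sym_group r\<^esub> snd p)) =
          tens u (Sr.flip w) p * restrict_hom r k a
            ((\<lambda>(g\<^sub>1, g\<^sub>2) m. g\<^sub>1 \<circ> m \<circ> inv\<^bsub>sym_group r\<^esub> g\<^sub>2) (inv\<^bsub>sym_group k \<times>\<times> sym_group r\<^esub> p) f)"
          if p: "p \<in> carrier (sym_group k) \<times> carrier (sym_group r)" for p
        proof -
          obtain g h where gh: "p = (g, h)" "g \<in> carrier (sym_group k)" "h \<in> carrier (sym_group r)"
            using p by auto
          have pc: "p \<in> carrier (sym_group k \<times>\<times> sym_group r)" using p by simp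
          have inv_p: "inv\<^bsub>sym_group k \<times>\<times> sym_group r\<^esub> p = (inv\<^bsub>sym_group k\<^esub> g, inv\<^bsub>sym_group r\<^esub> h)"
            unfolding gh(1) by (rule inv_DirProd[OF Sk.group_axioms Sr.group_axioms gh(2,3)])
          have mem: "inv\<^bsub>sym_group k\<^esub> g \<circ> f \<circ> inv\<^bsub>sym_group r\<^esub> (inv\<^bsub>sym_group r\<^esub> h) \<in> SE_hom r k"
            using X.act_closed[OF X.inv_closed[OF pc] f] unfolding inv_p prod.case .
          show ?thesis
            unfolding inv_p prod.case restrict_hom_def if_P[OF mem]
            using gh by (simp add: Sr.flip_def del: sym_group_inv_equality)
        qed
        show ?thesis
          unfolding SE_hom_module_def X.smult_apply if_P[OF f] carrier_DirProd
          by (rule sum.cong[OF refl summand])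
      qed
      finally show ?thesis using st by (simp add: z extend_hom_def)
    qed
  qed
qed

lemma extend_hom_closed:
  assumes "r \<le> n" "k \<le> n" "\<And>f. f \<notin> SE_hom r k \<Longrightarrow> m f = 0"
  shows "extend_hom r k m \<in> carrier (SE_algebra n)"
  using assms by (auto simp: A.algebra_simps(1) extend_hom_def SE_morphisms_def)

lemma restrict_extend_hom:
  assumes "\<And>f. f \<notin> SE_hom r k \<Longrightarrow> m f = 0"
  shows "restrict_hom r k (extend_hom r k m) = m"
  using assms by (auto simp: restrict_hom_def extend_hom_def fun_eq_iff)

lemma embed_closed:
  assumes "k \<le> n" "u \<in> carrier (group_algebra (sym_group k))"
  shows "SE_embed k u \<in> carrier (SE_algebra n)"
proof -
  interpret S: finite_group "sym_group k" by (rule finite_group_sym_group)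
  show ?thesis
    unfolding SE_embed_eq_extend_hom
    using assms by (intro extend_hom_closed) (auto simp: S.algebra_simps(1) SE_hom_self)
qed

lemma embed_mult:
  assumes k: "k \<le> n"
  shows "SE_embed k u \<otimes>\<^bsub>SE_algebra n\<^esub> SE_embed k w = SE_embed k (u \<otimes>\<^bsub>group_algebra (sym_group k)\<^esub> w)"
proof
  interpret S: finite_group "sym_group k" by (rule finite_group_sym_group)
  fix z :: SE_morphism
  obtain s t f where z: "z = (s, t, f)" by (cases z)
  show "(SE_embed k u \<otimes>\<^bsub>SE_algebra n\<^esub> SE_embed k w) z = SE_embed k (u \<otimes>\<^bsub>group_algebra (sym_group k)\<^esub> w) z"
  proof (cases "s = k \<and> t = k")
    case False
    then have "(SE_embed k u \<otimes>\<^bsub>SE_algebra n\<^esub> SE_embed k w) z = 0"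
      using embed_mult_apply_0[of t k u "SE_embed k w" s f] mult_embed_apply_0[of s k "SE_embed k u" w t f]
      unfolding z by blast
    then show ?thesis using False by (auto simp: z SE_embed_def)
  next
    case st: True
    show ?thesis
    proof (cases "f \<in> carrier (sym_group k)")
      case True
      then have "(k, k, f) \<in> SE_morphisms n" using k by (simp add: SE_morphisms_def SE_hom_self)
      from embed_mult_apply[OF k this, of u "SE_embed k w"] show ?thesis
        using st S.group_mult_apply[OF True, of u w] by (simp add: z SE_embed_def sym_group_mult)
    next
      case False
      then have "(k, k, f) \<notin> SE_morphisms n" by (simp add: SE_morphisms_def SE_hom_self)
      then show ?thesis
        using A.mult_closed[of "SE_embed k u" "SE_embed k w"] S.mult_closed[of u w] st False
        by (simp add: z A.algebra_simps(1) S.algebra_simps(1) SE_embed_def)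
    qed
  qed
qed

text \<open>The corner only sees the component of an element with source and target \<open>k\<close>, and this component
  is an element of the group algebra.\<close>

lemma embed_scalar_corner:
  assumes k: "k \<le> n"
    and e: "scalar_corner (group_algebra (sym_group k)) (finite_category.scalar (carrier (sym_group k)) (\<lambda>g h. Some (g \<otimes>\<^bsub>sym_group k\<^esub> h)) {\<one>\<^bsub>sym_group k\<^esub>}) e"
  shows "scalar_corner (SE_algebra n) A.scalar (SE_embed k e)"
proof (intro scalar_corner.intro A.algebra_complex_algebra scalar_corner_axioms.intro)
  interpret S: finite_group "sym_group k" by (rule finite_group_sym_group)
  interpret e: scalar_corner "group_algebra (sym_group k)" S.scalar e by (rule e)
  let ?A = "SE_algebra n" and ?E = "SE_embed k e"
  show closed: "?E \<in> carrier ?A" by (rule embed_closed[OF k e.e_closed])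
  show "?E \<otimes>\<^bsub>?A\<^esub> ?E = ?E" by (simp add: embed_mult[OF k] e.e_idem)
  show "?E \<noteq> \<zero>\<^bsub>?A\<^esub>"
  proof
    assume E0: "?E = \<zero>\<^bsub>?A\<^esub>"
    have "e f = 0" for f
      using fun_cong[OF E0, of "(k, k, f)"] by (simp add: SE_embed_def A.algebra_simps(2))
    then show False using e.e_nonzero by (auto simp: S.algebra_simps(2) fun_eq_iff)
  qed
  fix a
  let ?a = "restrict_hom k k a"
  have aS: "?a \<in> carrier (group_algebra (sym_group k))"
    by (simp add: restrict_hom_def S.algebra_simps(1) SE_hom_self)
  obtain c where c: "e \<otimes>\<^bsub>group_algebra (sym_group k)\<^esub> ?a \<otimes>\<^bsub>group_algebra (sym_group k)\<^esub> e = fscale c e"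
    using e.corner[OF aS] S.scalar_mult[OF e.e_closed] by auto
  have "restrict_hom k k (SE_embed k ?a) = ?a"
    unfolding SE_embed_eq_extend_hom by (rule restrict_extend_hom) (simp add: restrict_hom_def)
  then have "?E \<otimes>\<^bsub>?A\<^esub> a \<otimes>\<^bsub>?A\<^esub> ?E = ?E \<otimes>\<^bsub>?A\<^esub> SE_embed k ?a \<otimes>\<^bsub>?A\<^esub> ?E"
    unfolding embed_mult_embed[OF k k] by simp
  also have "\<dots> = SE_embed k (fscale c e)"
    unfolding embed_mult[OF k] c ..
  also have "\<dots> = A.scalar c \<otimes>\<^bsub>?A\<^esub> ?E"
    unfolding A.scalar_mult[OF closed] by (auto simp: SE_embed_def fscale_apply fun_eq_iff)
  finally show "\<exists>c. ?E \<otimes>\<^bsub>?A\<^esub> a \<otimes>\<^bsub>?A\<^esub> ?E = A.scalar c \<otimes>\<^bsub>?A\<^esub> ?E" by blast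
qed

lemma extend_hom_linear: "Vector_Spaces.linear fscale fscale (extend_hom r k)"
  by (auto simp: Vector_Spaces.linear_iff fs.vector_space_axioms extend_hom_def fscale_apply fun_eq_iff)

theorem multiplicities_agree:
  assumes r: "r \<le> n" and k: "k \<le> n"
    and a: "primitive_idempotent (group_algebra (sym_group r)) a"
      "module_iso (group_algebra (sym_group r)) (left_ideal_module (group_algebra (sym_group r)) a) (specht_module r \<alpha>)"
    and b: "primitive_idempotent (group_algebra (sym_group k)) b"
      "module_iso (group_algebra (sym_group k)) (left_ideal_module (group_algebra (sym_group k)) b) (specht_module k \<beta>)"
  shows "jordan_hoelder_multiplicity (SE_algebra n) (SE_projective n r a) (SE_simple n k b) =
    constituent_multiplicity (group_algebra (sym_group k \<times>\<times> sym_group r)) (SE_hom_module r k)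
      (outer_tensor (sym_group k) (sym_group r) (specht_module k \<beta>) (specht_module r \<alpha>))"
proof -
  interpret K: two_groups "sym_group k" "sym_group r"
    by (intro two_groups.intro finite_group_sym_group)
  interpret b: scalar_corner "group_algebra (sym_group k)" K.G.scalar b
    by (rule K.G.primitive_idempotent_scalar_corner[OF b(1)])
  interpret a: scalar_corner "group_algebra (sym_group r)" K.H.scalar a
    by (rule K.H.primitive_idempotent_scalar_corner[OF a(1)])
  interpret X: finite_permutation_action "sym_group k \<times>\<times> sym_group r" "SE_hom r k"
    "\<lambda>(g\<^sub>1, g\<^sub>2) m. g\<^sub>1 \<circ> m \<circ> inv\<^bsub>sym_group r\<^esub> g\<^sub>2"
    by (rule SE_hom_action)
  let ?A = "SE_algebra n" and ?CG = "group_algebra (sym_group k \<times>\<times> sym_group r)"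
  let ?M = "SE_hom_module r k" and ?P = "left_ideal_module (SE_algebra n) (SE_embed r a)"
  let ?E = "tens b (K.H.flip a)"
  let ?Vb = "specht_module k \<beta>" and ?Va = "specht_module r \<alpha>"
  have nonzero: "a \<noteq> 0" "b \<noteq> 0"
    using a.e_nonzero b.e_nonzero by (simp_all add: K.G.algebra_simps(2) K.H.algebra_simps(2))

  \<comment> \<open>for the category algebra the factor is detected by \<open>b\<close>\<close>
  interpret EA: scalar_corner ?A A.scalar "SE_embed k b"
    by (rule embed_scalar_corner[OF k b.scalar_corner_axioms])
  have Ea: "SE_embed r a \<in> carrier ?A" by (rule embed_closed[OF r a.e_closed])
  interpret P: corner_function_module ?A A.scalar "SE_embed k b" ?P
    by (intro corner_function_module.intro EA.scalar_corner_axioms A.left_ideal_function_module Ea)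
  have left: "jordan_hoelder_multiplicity ?A (SE_projective n r a) (SE_simple n k b) =
      fs.dim (P.part (SE_embed k b) (carrier ?P))"
    unfolding SE_projective_def SE_simple_def
    by (rule P.jordan_hoelder_multiplicity_eq_dim[OF EA.simple_top])

  \<comment> \<open>for the product of the symmetric groups the constituent is detected by \<open>b \<otimes> flip a\<close>\<close>
  interpret T: tensor_factors "sym_group k" "sym_group r" ?Vb ?Va
    by (intro tensor_factors.intro K.two_groups_axioms tensor_factors_axioms.intro specht_function_module)
  have flip_a: "scalar_corner (group_algebra (sym_group r)) K.H.scalar (K.H.flip a)"
    by (rule K.H.flip_scalar_corner[OF a.scalar_corner_axioms])
  have simple: "simple_module (group_algebra (sym_group k)) ?Vb" "simple_module (group_algebra (sym_group r)) ?Va"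
    using simple_module_iso[OF b(2) T.V.left_module_axioms K.G.corner_left_ideal_simple[OF b.scalar_corner_axioms]]
      simple_module_iso[OF a(2) T.W.left_module_axioms K.H.corner_left_ideal_simple[OF a.scalar_corner_axioms]]
    by blast+
  note outer = T.outer_tensor_simple[OF b.scalar_corner_axioms flip_a simple
      specht_flip_acts_nontrivially(1)[OF b.e_closed b.e_idem nonzero(2) b(2)]
      specht_flip_acts_nontrivially(2)[OF a.e_closed a.e_idem nonzero(1) a(2)]]
  have M: "function_module ?CG K.GH.scalar ?M"
    unfolding SE_hom_module_def by (rule X.permutation_function_module)
  interpret M: corner_function_module ?CG K.GH.scalar ?E ?M
    by (intro corner_function_module.intro M K.tens_scalar_corner b.scalar_corner_axioms flip_a)
  have "\<exists>\<U>. simple_decomposition ?CG ?M \<U>"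
    by (rule M.simple_decomposition_exists) (unfold SE_hom_module_def, rule X.submodule_complement)
  then have right: "constituent_multiplicity ?CG ?M (outer_tensor (sym_group k) (sym_group r) ?Vb ?Va) =
      fs.dim (M.part ?E (carrier ?M))"
    by (rule M.constituent_multiplicity_eq_dim[OF outer])

  have M_supp: "m \<in> carrier ?M \<longleftrightarrow> (\<forall>f. f \<notin> SE_hom r k \<longrightarrow> m f = 0)" for m
  proof -
    have "finite {f. m f \<noteq> 0}" if "\<forall>f. f \<notin> SE_hom r k \<longrightarrow> m f = 0"
      using that by (intro finite_subset[OF _ finite_SE_hom[of r k]]) blast
    then show ?thesis unfolding SE_hom_module_def X.permutation_module_simps(1) by blast
  qed
  have triple: "SE_embed k b \<otimes>\<^bsub>?A\<^esub> (c \<otimes>\<^bsub>?A\<^esub> SE_embed r a) = extend_hom r k (?E \<odot>\<^bsub>?M\<^esub> restrict_hom r k c)" for c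
    unfolding A.mult_assoc[symmetric] by (rule embed_mult_embed[OF r k])
  have "P.part (SE_embed k b) (carrier ?P) = extend_hom r k ` M.part ?E (carrier ?M)"
  proof (intro Set.set_eqI iffI)
    fix z assume "z \<in> P.part (SE_embed k b) (carrier ?P)"
    then obtain c where "z = SE_embed k b \<otimes>\<^bsub>?A\<^esub> (c \<otimes>\<^bsub>?A\<^esub> SE_embed r a)"
      unfolding P.part_def left_ideal_module_simps by blast
    moreover have "restrict_hom r k c \<in> carrier ?M" unfolding M_supp by (simp add: restrict_hom_def)
    ultimately show "z \<in> extend_hom r k ` M.part ?E (carrier ?M)"
      unfolding M.part_def triple by blast
  next
    fix z assume "z \<in> extend_hom r k ` M.part ?E (carrier ?M)"
    then obtain m where m: "m \<in> carrier ?M" "z = extend_hom r k (?E \<odot>\<^bsub>?M\<^esub> m)"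
      unfolding M.part_def by blast
    have supp: "\<And>f. f \<notin> SE_hom r k \<Longrightarrow> m f = 0" using m(1) unfolding M_supp by blast
    have restrict: "restrict_hom r k (extend_hom r k m) = m"
      by (rule restrict_extend_hom) (rule supp)
    have closed: "extend_hom r k m \<in> carrier ?A"
      by (rule extend_hom_closed[OF r k]) (rule supp)
    have "z = SE_embed k b \<otimes>\<^bsub>?A\<^esub> (extend_hom r k m \<otimes>\<^bsub>?A\<^esub> SE_embed r a)"
      unfolding triple restrict by (rule m(2))
    then show "z \<in> P.part (SE_embed k b) (carrier ?P)"
      unfolding P.part_def left_ideal_module_simps
      using closed by blast
  qed
  moreover have "fs.dim (extend_hom r k ` M.part ?E (carrier ?M)) = fs.dim (M.part ?E (carrier ?M))"
  proof (rule dim_injective_image[OF extend_hom_linear])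
    show "fs.subspace (M.part ?E (carrier ?M))"
      by (rule M.part_subspace[OF M.e_closed M.carrier_submodule])
    show "finite_dimensional (M.part ?E (carrier ?M))"
      by (rule M.part_finite_dimensional[OF M.e_closed M.carrier_submodule])
    have "m = m'" if "extend_hom r k m = extend_hom r k m'" for m m'
    proof
      fix f show "m f = m' f"
        using fun_cong[OF that, of "(r, k, f)"] by (simp add: extend_hom_def)
    qed
    then show "inj_on (extend_hom r k) (M.part ?E (carrier ?M))" by (rule inj_onI)
  qed
  ultimately show ?thesis using left right by simp
qed

end

theorem corollary4p2:
  fixes n r k :: nat
    and \<alpha> \<beta> :: "nat list"
    and e :: "nat list \<Rightarrow> (nat \<Rightarrow> nat) \<Rightarrow> complex"
  assumes e_primitive: "\<And>j \<gamma>. j \<le> n \<Longrightarrow> \<gamma> \<in> partitions j \<Longrightarrow>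
      primitive_idempotent (group_algebra (sym_group j)) (e \<gamma>)"
    and e_specht: "\<And>j \<gamma>. j \<le> n \<Longrightarrow> \<gamma> \<in> partitions j \<Longrightarrow>
      module_iso (group_algebra (sym_group j))
        (left_ideal_module (group_algebra (sym_group j)) (e \<gamma>)) (specht_module j \<gamma>)"
    and "r \<le> n" and "k \<le> n"
    and "\<alpha> \<in> partitions r" and "\<beta> \<in> partitions k"
  shows "jordan_hoelder_multiplicity (SE_algebra n)
           (SE_projective n r (e \<alpha>)) (SE_simple n k (e \<beta>)) =
         constituent_multiplicity (group_algebra (sym_group k \<times>\<times> sym_group r))
           (SE_hom_module r k)
           (outer_tensor (sym_group k) (sym_group r) (specht_module k \<beta>) (specht_module r \<alpha>))"
  by (rule multiplicities_agree) (use assms in simp_all)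

end
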